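(* Let $m\ge3$ be an integer, let $\vec\mu=(\mu_0,\ldots,\mu_{m-1})\in(\mathcal D')^m$, and let $\nu\in\mathcal D'$. Assume that (i) $\nu\ge0$ and there is a constant $c_0>0$ such that $|\hat f(0)|^2\le c_0\,\mathcal D_{\nu,0}(f)$ for all $f\in\mathcal D_a$; (ii) if $0\le n\le\frac{m-3}2$, then there is a constant $c_n>0$ with $|\hat\mu_n(k)|\le c_n(1+|k|)^{\frac{m-3}2}$ for all $k\in\mathbb Z$; (iii) if $m$ is even and $n=\frac{m-2}2$, then $\mu_n=\sum_{j=0}^{\frac{m-4}2}D^j\nu_j$, where each $\nu_j$ is a finite measure; (iv) if $\frac{m-1}2\le n\le m-2$, then $\mu_n=\sum_{j=0}^{m-2-n}D^j\nu_j$, where each $\nu_j$ (depending on $n$) is a finite measure; (v) there is $c>0$ such that $P_{\mu_{m-1}}\ge c$ on $\mathbb D$. Then $\vec\mu_{\nu,C}=C\nu e_0+\vec\mu+C\mu_{m-1}e_{m-1}$ is an allowable tuple, provided that $C>0$ is sufficiently large.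
   Context: $\mathbb D$ is the open unit disc, $\mathbb T$ the unit circle. $\mathcal D'$ is the space of distributions on $\mathbb T$; for $\mu\in\mathcal D'$, $\hat\mu(k)=\mu(\zeta^{-k})$, $k\in\mathbb Z$; distributions correspond exactly to sequences $(\hat\mu(k))_{k\in\mathbb Z}$ of at most polynomial growth. Finite Borel measures on $\mathbb T$ are regarded as distributions. A distribution $\mu$ is positive, written $\mu\ge0$, if $\mu(f)\ge0$ for every smooth $f\ge0$ on $\mathbb T$; equivalently, $\mu$ is a finite positive measure. $D:\mathcal D'\to\mathcal D'$ is defined by $\widehat{D\mu}(k)=|k|\hat\mu(k)$. The Poisson extension is $P_\mu(z)=\sum_{k\ge0}\hat\mu(k)z^k+\sum_{k\ge1}\hat\mu(-k)\bar z^k$, $z\in\mathbb D$. $\mathcal D_a$ is the space of functions analytic on $\mathbb D$ and smooth on $\overline{\mathbb D}$, $f(z)=\sum_{k\ge0}\hat f(k)z^k$, and $(M_zf)(z)=zf(z)$. For $\mu\in\mathcal D'$, $f\in\mathcal D_a$, $n\ge1$: $\mathcal D_{\mu,n}(f)=\lim_{r\to1^-}\frac1{n!(n-1)!\pi}\int_{r\mathbb D}|f^{(n)}(z)|^2P_\mu(z)(1-|z|^2)^{n-1}\,dA(z)$ ($dA$ area measure), and $\mathcal D_{\mu,0}(f)=\mu(|f|^2)$. The limits exist. For $\vec\mu\in(\mathcal D')^m$ put $\|f\|_{\vec\mu}^2=\sum_{n=0}^{m-1}\mathcal D_{\mu_n,n}(f)$, $f\in\mathcal D_a$. The tuple $\vec\mu$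 is allowable if there is $C'>0$ with $0\le\|M_zf\|_{\vec\mu}^2\le C'^2\|f\|_{\vec\mu}^2$ for all $f\in\mathcal D_a$. $\mu e_n$ denotes the $m$-tuple whose entry with index $n$ is $\mu$ and whose other entries are $0$ (indices $0,\ldots,m-1$); tuples are added entrywise.
   Formalization: The distributions μ_0,…,μ_{m-1} are additionally assumed real (real on real-valued smooth functions); otherwise the claim fails, e.g. m=3, ν=μ_2=normalized Lebesgue measure, μ_1=0, μ_0=i times Lebesgue measure, where the squared norm is not real. *)

theory Defs
  imports "HOL-Analysis.Analysis" "HOL-Library.Complex_Order"
begin

text \<open>
  Inequalities between complex numbers are those of \<^theory>\<open>HOL-Library.Complex_Order\<close>:
  \<open>a \<le> b\<close> says that \<open>b - a\<close> is real and nonnegative.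
\<close>

section \<open>Smooth functions on the unit circle\<close>

text \<open>
  A function on the circle is a function \<open>complex \<Rightarrow> complex\<close> of which only the values on
  \<open>sphere 0 1\<close> matter; it is differentiated in the angular variable.
\<close>

definition circle_deriv :: "nat \<Rightarrow> (complex \<Rightarrow> complex) \<Rightarrow> real \<Rightarrow> complex" where
  "circle_deriv n f = ((\<lambda>h t. vector_derivative h (at t)) ^^ n) (\<lambda>t. f (cis t))"

definition smooth_circle :: "(complex \<Rightarrow> complex) \<Rightarrow> bool" where
  "smooth_circle f \<longleftrightarrow> (\<forall>n t. circle_deriv n f differentiable (at t))"

lemma circle_deriv_0 [simp]: "circle_deriv 0 f = (\<lambda>t. f (cis t))"
  by (simp add: circle_deriv_def)

lemma circle_deriv_Suc:
  "circle_deriv (Suc n) f = (\<lambda>t. vector_derivative (circle_deriv n f) (at t))"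
  by (simp add: circle_deriv_def)

lemma smooth_circle_has_deriv:
  assumes "smooth_circle f"
  shows "(circle_deriv n f has_vector_derivative circle_deriv (Suc n) f t) (at t)"
  using assms by (simp add: smooth_circle_def circle_deriv_Suc vector_derivative_works)

lemma smooth_circleI:
  assumes F0: "\<And>t. F 0 t = f (cis t)"
    and FS: "\<And>n t. (F n has_vector_derivative F (Suc n) t) (at t)"
  shows "smooth_circle f" "circle_deriv n f = F n"
proof -
  have *: "circle_deriv n f = F n" for n
  proof (induction n)
    case 0
    show ?case by (simp add: F0)
  next
    case (Suc n)
    show ?case using FS[of n] by (auto simp: circle_deriv_Suc Suc vector_derivative_at)
  qed
  show "circle_deriv n f = F n" by (rule *)
  show "smooth_circle f"
    unfolding smooth_circle_def * using FS differentiableI_vector by blast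
qed

lemma smooth_circle_lincomb:
  assumes "smooth_circle f" "smooth_circle g"
  shows "smooth_circle (\<lambda>z. a * f z + b * g z)"
    and "circle_deriv n (\<lambda>z. a * f z + b * g z) =
      (\<lambda>t. a * circle_deriv n f t + b * circle_deriv n g t)"
proof -
  define F where "F = (\<lambda>n t. a * circle_deriv n f t + b * circle_deriv n g t)"
  have 1: "F 0 t = a * f (cis t) + b * g (cis t)" for t by (simp add: F_def)
  have 2: "(F n has_vector_derivative F (Suc n) t) (at t)" for n t
    unfolding F_def
    by (intro has_vector_derivative_add has_vector_derivative_mult_right
        smooth_circle_has_deriv assms)
  show "smooth_circle (\<lambda>z. a * f z + b * g z)"
    by (rule smooth_circleI(1)[of F]) (use 1 2 in auto)
  have "circle_deriv n (\<lambda>z. a * f z + b * g z) = F n"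
    by (rule smooth_circleI(2)[of F]) (use 1 2 in auto)
  then show "circle_deriv n (\<lambda>z. a * f z + b * g z) =
      (\<lambda>t. a * circle_deriv n f t + b * circle_deriv n g t)"
    by (simp add: F_def)
qed

section \<open>Distributions on the unit circle\<close>

text \<open>
  A distribution is a linear functional on the smooth functions that is bounded by finitely many
  of the seminorms \<open>f \<mapsto> sup \<bar>circle_deriv n f\<bar>\<close>, i.e. continuous. Being bounded, it does not depend on the
  values of \<open>f\<close> off the circle. The value \<open>0\<close> off the smooth functions is a normalisation, so that
  equality of distributions is equality on smooth functions.
\<close>

typedef distr = "{L :: (complex \<Rightarrow> complex) \<Rightarrow> complex.
    (\<forall>f. \<not> smooth_circle f \<longrightarrow> L f = 0) \<and>
    (\<forall>f g a b. smooth_circle f \<longrightarrow> smooth_circle g \<longrightarrow>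
       L (\<lambda>z. a * f z + b * g z) = a * L f + b * L g) \<and>
    (\<exists>N C. \<forall>f B. smooth_circle f \<longrightarrow> (\<forall>n\<le>N. \<forall>t. cmod (circle_deriv n f t) \<le> B) \<longrightarrow>
       cmod (L f) \<le> C * B)}"
  morphisms dapply Abs_distr
proof -
  have "\<exists>(N::nat) (C::real). \<forall>f B. smooth_circle f \<longrightarrow>
      (\<forall>n\<le>N. \<forall>t. cmod (circle_deriv n f t) \<le> B) \<longrightarrow> cmod 0 \<le> C * B"
    by (rule exI[of _ 0], rule exI[of _ 0]) simp
  then show ?thesis by (intro exI[of _ "\<lambda>_. 0"]) simp
qed

setup_lifting type_definition_distr

lemma distr_eqI:
  assumes "\<And>f. smooth_circle f \<Longrightarrow> dapply \<mu> f = dapply \<nu> f"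
  shows "\<mu> = \<nu>"
proof -
  have "dapply \<mu> f = dapply \<nu> f" for f
    using assms[of f] dapply[of \<mu>] dapply[of \<nu>] by (cases "smooth_circle f") auto
  then show ?thesis by (metis dapply_inject ext)
qed

lemma distr_bound_lincomb:
  fixes L M :: "(complex \<Rightarrow> complex) \<Rightarrow> complex" and c d :: complex
  assumes "\<exists>N C. \<forall>f B. smooth_circle f \<longrightarrow>
      (\<forall>n\<le>N. \<forall>t. cmod (circle_deriv n f t) \<le> B) \<longrightarrow> cmod (L f) \<le> C * B"
    and "\<exists>N C. \<forall>f B. smooth_circle f \<longrightarrow>
      (\<forall>n\<le>N. \<forall>t. cmod (circle_deriv n f t) \<le> B) \<longrightarrow> cmod (M f) \<le> C * B"
  shows "\<exists>N C. \<forall>f B. smooth_circle f \<longrightarrow>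
      (\<forall>n\<le>N. \<forall>t. cmod (circle_deriv n f t) \<le> B) \<longrightarrow> cmod (c * L f + d * M f) \<le> C * B"
proof -
  obtain N1 C1 where 1: "\<And>f B. smooth_circle f \<Longrightarrow>
      (\<forall>n\<le>N1. \<forall>t. cmod (circle_deriv n f t) \<le> B) \<Longrightarrow> cmod (L f) \<le> C1 * B"
    using assms(1) by blast
  obtain N2 C2 where 2: "\<And>f B. smooth_circle f \<Longrightarrow>
      (\<forall>n\<le>N2. \<forall>t. cmod (circle_deriv n f t) \<le> B) \<Longrightarrow> cmod (M f) \<le> C2 * B"
    using assms(2) by blast
  have "cmod (c * L f + d * M f) \<le> (cmod c * C1 + cmod d * C2) * B"
    if f: "smooth_circle f" "\<forall>n\<le>max N1 N2. \<forall>t. cmod (circle_deriv n f t) \<le> B" for f B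
  proof -
    have "cmod (L f) \<le> C1 * B" "cmod (M f) \<le> C2 * B"
      using f by (auto intro!: 1 2)
    then have "cmod c * cmod (L f) + cmod d * cmod (M f) \<le> cmod c * (C1 * B) + cmod d * (C2 * B)"
      by (intro add_mono mult_left_mono) auto
    then show ?thesis
      using norm_triangle_ineq[of "c * L f" "d * M f"]
      by (simp add: norm_mult algebra_simps)
  qed
  then show ?thesis by blast
qed

instantiation distr :: real_vector
begin

lift_definition zero_distr :: distr is "\<lambda>_. 0"
proof -
  have "\<exists>(N::nat) (C::real). \<forall>f B. smooth_circle f \<longrightarrow>
      (\<forall>n\<le>N. \<forall>t. cmod (circle_deriv n f t) \<le> B) \<longrightarrow> cmod 0 \<le> C * B"
    by (rule exI[of _ 0], rule exI[of _ 0]) simp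
  then show "?thesis" by simp
qed

lift_definition plus_distr :: "distr \<Rightarrow> distr \<Rightarrow> distr" is "\<lambda>L M f. L f + M f"
  subgoal for L M
    using distr_bound_lincomb[of L M 1 1] by (auto simp: algebra_simps)
  done

lift_definition uminus_distr :: "distr \<Rightarrow> distr" is "\<lambda>L f. - L f"
  by simp

lift_definition minus_distr :: "distr \<Rightarrow> distr \<Rightarrow> distr" is "\<lambda>L M f. L f - M f"
  subgoal for L M
    using distr_bound_lincomb[of L M 1 "-1"] by (auto simp: algebra_simps)
  done

lift_definition scaleR_distr :: "real \<Rightarrow> distr \<Rightarrow> distr" is "\<lambda>c L f. of_real c * L f"
  subgoal for c L
    using distr_bound_lincomb[of L L "of_real c" 0] by (auto simp: algebra_simps)
  done

instance
  by standard (transfer, auto simp: algebra_simps fun_eq_iff)+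

end

definition fourier :: "distr \<Rightarrow> int \<Rightarrow> complex" where
  "fourier \<mu> k = dapply \<mu> (\<lambda>\<zeta>. \<zeta> powi (- k))"

definition positive_distr :: "distr \<Rightarrow> bool" where
  "positive_distr \<mu> \<longleftrightarrow>
     (\<forall>f. smooth_circle f \<longrightarrow> (\<forall>\<zeta>\<in>sphere 0 1. 0 \<le> f \<zeta>) \<longrightarrow> 0 \<le> dapply \<mu> f)"

text \<open>
  Dirichlet integrals with respect to a general distribution are complex; allowability of a tuple
  requires its squared norm to be real, hence the notion of a real distribution.
\<close>

definition real_distr :: "distr \<Rightarrow> bool" where
  "real_distr \<mu> \<longleftrightarrow>
     (\<forall>f. smooth_circle f \<longrightarrow> (\<forall>\<zeta>\<in>sphere 0 1. f \<zeta> \<in> \<real>) \<longrightarrow> dapply \<mu> f \<in> \<real>)"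

definition pos_circle_measure :: "complex measure \<Rightarrow> bool" where
  "pos_circle_measure M \<longleftrightarrow> sets M = sets (restrict_space borel (sphere 0 1)) \<and> finite_measure M"

text \<open>Finite measures are complex, and integrated through their Jordan decomposition.\<close>

definition finite_measure_distr :: "distr \<Rightarrow> bool" where
  "finite_measure_distr \<mu> \<longleftrightarrow>
     (\<exists>M1 M2 M3 M4. pos_circle_measure M1 \<and> pos_circle_measure M2 \<and>
        pos_circle_measure M3 \<and> pos_circle_measure M4 \<and>
        (\<forall>f. smooth_circle f \<longrightarrow>
           dapply \<mu> f = (LINT \<zeta>|M1. f \<zeta>) - (LINT \<zeta>|M2. f \<zeta>)
                       + \<i> * ((LINT \<zeta>|M3. f \<zeta>) - (LINT \<zeta>|M4. f \<zeta>))))"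

text \<open>The description is proper: see \<open>fourier_D_op\<close> and \<open>fourier_inject\<close> below.\<close>

definition D_op :: "distr \<Rightarrow> distr" where
  "D_op \<mu> = (THE \<mu>'. \<forall>k. fourier \<mu>' k = of_int \<bar>k\<bar> * fourier \<mu> k)"

definition poisson :: "distr \<Rightarrow> complex \<Rightarrow> complex" where
  "poisson \<mu> z = (\<Sum>k. fourier \<mu> (int k) * z ^ k)
               + (\<Sum>k. fourier \<mu> (- int (Suc k)) * cnj z ^ Suc k)"

section \<open>Weighted Dirichlet integrals\<close>

text \<open>
  Smoothness on the closed disc: every derivative on the open disc extends continuously to the
  closed disc. Values of \<open>f\<close> outside the closed disc are irrelevant.
\<close>

definition D_a :: "(complex \<Rightarrow> complex) set" where
  "D_a = {f. f holomorphic_on ball 0 1 \<and> continuous_on (cball 0 1) f \<and>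
     (\<forall>n. \<exists>g. continuous_on (cball 0 1) g \<and> (\<forall>z\<in>ball 0 1. g z = (deriv ^^ n) f z))}"

definition taylor_coeff :: "(complex \<Rightarrow> complex) \<Rightarrow> nat \<Rightarrow> complex" where
  "taylor_coeff f k = (deriv ^^ k) f 0 / fact k"

definition M_z :: "(complex \<Rightarrow> complex) \<Rightarrow> complex \<Rightarrow> complex" where
  "M_z f = (\<lambda>z. z * f z)"

definition dirichlet :: "distr \<Rightarrow> nat \<Rightarrow> (complex \<Rightarrow> complex) \<Rightarrow> complex" where
  "dirichlet \<mu> n f =
     (if n = 0 then dapply \<mu> (\<lambda>\<zeta>. of_real ((cmod (f \<zeta>))\<^sup>2))
      else Lim (at_left 1) (\<lambda>r.
        of_real (1 / (fact n * fact (n - 1) * pi)) *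
        (LINT z:ball 0 r|lborel.
           of_real ((cmod ((deriv ^^ n) f z))\<^sup>2) * poisson \<mu> z
             * of_real ((1 - (cmod z)\<^sup>2) ^ (n - 1)))))"

text \<open>An \<open>m\<close>-tuple is a function on \<open>nat\<close> of which only the values below \<open>m\<close> are used.\<close>

definition norm_sq :: "nat \<Rightarrow> (nat \<Rightarrow> distr) \<Rightarrow> (complex \<Rightarrow> complex) \<Rightarrow> complex" where
  "norm_sq m \<mu> f = (\<Sum>n<m. dirichlet (\<mu> n) n f)"

definition allowable :: "nat \<Rightarrow> (nat \<Rightarrow> distr) \<Rightarrow> bool" where
  "allowable m \<mu> \<longleftrightarrow>
     (\<exists>C'>0. \<forall>f\<in>D_a. 0 \<le> norm_sq m \<mu> (M_z f) \<and>
        norm_sq m \<mu> (M_z f) \<le> of_real (C'\<^sup>2) * norm_sq m \<mu> f)"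

definition single_entry :: "distr \<Rightarrow> nat \<Rightarrow> nat \<Rightarrow> distr" where
  "single_entry \<mu> n = (\<lambda>i. if i = n then \<mu> else 0)"

section \<open>The operator \<open>D_op\<close> is well defined\<close>

lemma has_vector_derivative_cis_mult:
  "((\<lambda>t. cis (x * t)) has_vector_derivative (\<i> * of_real x) * cis (x * t)) (at t)"
proof -
  have "((\<lambda>z. exp (\<i> * of_real x * z)) has_field_derivative
      \<i> * of_real x * exp (\<i> * of_real x * of_real t)) (at (of_real t))"
    by (auto intro!: derivative_eq_intros)
  from has_vector_derivative_real_field[OF this]
  show ?thesis by (simp add: cis_conv_exp mult.assoc)
qed

lemma smooth_circle_powi: "smooth_circle (\<lambda>z. z powi k)"
  and circle_deriv_powi:
    "circle_deriv n (\<lambda>z. z powi k) = (\<lambda>t. (\<i> * of_int k) ^ n * cis (of_int k * t))"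
proof -
  define F where "F = (\<lambda>n t. (\<i> * of_int k) ^ n * cis (of_int k * t))"
  have 1: "F 0 t = cis t powi k" for t by (simp add: F_def cis_power_int)
  have 2: "(F n has_vector_derivative F (Suc n) t) (at t)" for n t
    unfolding F_def
    using has_vector_derivative_mult_right[OF has_vector_derivative_cis_mult[of "of_int k" t],
        of "(\<i> * of_int k) ^ n"]
    by (simp add: mult_ac)
  show "smooth_circle (\<lambda>z. z powi k)"
    by (rule smooth_circleI(1)[of F]) (use 1 2 in auto)
  have "circle_deriv n (\<lambda>z. z powi k) = F n"
    by (rule smooth_circleI(2)[of F]) (use 1 2 in auto)
  then show "circle_deriv n (\<lambda>z. z powi k) = (\<lambda>t. (\<i> * of_int k) ^ n * cis (of_int k * t))"
    by (simp add: F_def)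
qed

lemma circle_deriv_periodic:
  assumes "smooth_circle f"
  shows "circle_deriv n f (t + 2 * pi) = circle_deriv n f t"
proof (induction n arbitrary: t)
  case 0
  show ?case by (simp add: cis.ctr)
next
  case (Suc n)
  have "(circle_deriv n f has_vector_derivative circle_deriv (Suc n) f (t + 2 * pi)) (at (t + 2 * pi))"
    by (rule smooth_circle_has_deriv[OF assms])
  then have "((circle_deriv n f \<circ> (\<lambda>t. t + 2 * pi)) has_vector_derivative
      1 *\<^sub>R circle_deriv (Suc n) f (t + 2 * pi)) (at t)"
    by (intro vector_diff_chain_at) (auto intro!: derivative_eq_intros)
  moreover have "circle_deriv n f \<circ> (\<lambda>t. t + 2 * pi) = circle_deriv n f"
    by (auto simp: Suc)
  ultimately have "(circle_deriv n f has_vector_derivative circle_deriv (Suc n) f (t + 2 * pi)) (at t)"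
    by simp
  then show ?case
    using smooth_circle_has_deriv[OF assms, of n t] vector_derivative_unique_at by blast
qed

lemma circle_deriv_continuous:
  assumes "smooth_circle f"
  shows "continuous_on S (circle_deriv n f)"
  using smooth_circle_has_deriv[OF assms]
  by (meson continuous_at_imp_continuous_on has_vector_derivative_continuous)

lemma cis_Arg_norm1: "cmod z = 1 \<Longrightarrow> cis (Arg z) = z"
  by (subst cis_Arg) (auto simp: sgn_eq)

lemma smooth_circle_continuous:
  assumes "smooth_circle f"
  shows "continuous_on (sphere 0 1) f"
proof -
  have "continuous (at w within sphere 0 1) f" if w: "w \<in> sphere 0 1" for w
  proof -
    have w1: "cmod w = 1" using w by simp
    define t0 where "t0 = Arg w"
    have t0: "cis t0 = w" unfolding t0_def by (rule cis_Arg_norm1[OF w1])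
    define g where "g = (\<lambda>z. circle_deriv 0 f (Arg (z / w) + t0))"
    have "isCont (circle_deriv 0 f) (Arg (w / w) + t0)"
      using has_vector_derivative_continuous smooth_circle_has_deriv[OF assms] by blast
    moreover have "isCont (\<lambda>z. Arg (z / w) + t0) w"
    proof -
      have "isCont (Arg \<circ> (\<lambda>z. z / w)) w"
        using w1 by (intro continuous_at_compose continuous_intros continuous_at_Arg) auto
      then show ?thesis by (auto intro!: continuous_intros simp: o_def)
    qed
    ultimately have "isCont (circle_deriv 0 f \<circ> (\<lambda>z. Arg (z / w) + t0)) w"
      by (intro continuous_at_compose) auto
    then have gc: "continuous (at w within sphere 0 1) g"
      unfolding g_def o_def using continuous_at_imp_continuous_at_within by blast
    have eq: "g z = f z" if "z \<in> sphere 0 1" for z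
    proof -
      have "cmod (z / w) = 1" using that w1 by (simp add: norm_divide)
      then have "cis (Arg (z / w)) = z / w"
        by (rule cis_Arg_norm1)
      then have "cis (Arg (z / w) + t0) = z"
        using t0 w1 by (auto simp: cis_mult[symmetric])
      then show ?thesis by (simp add: g_def)
    qed
    show ?thesis
      using continuous_transform_within[OF gc, of 1 f] eq w by auto
  qed
  then show ?thesis by (simp add: continuous_on_eq_continuous_within)
qed

text \<open>
  Uniqueness: a distribution is determined by its Fourier coefficients, because trigonometric
  polynomials are dense in the smooth functions. Existence: the sum of
  \<open>\<bar>k\<bar> * fourier \<mu> k * coef 0 f (-k)\<close> over all \<open>k\<close> converges, where \<open>coef 0 f\<close> are the
  Fourier coefficients of \<open>f\<close>.
\<close>

inductive trig :: "(complex \<Rightarrow> complex) \<Rightarrow> bool" where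
  mono: "trig (\<lambda>z. c * z powi k)"
| add: "trig p \<Longrightarrow> trig q \<Longrightarrow> trig (\<lambda>z. p z + q z)"

lemma trig_const: "trig (\<lambda>z. c)"
  using trig.mono[of c 0] by simp

lemma trig_cmult: "trig p \<Longrightarrow> trig (\<lambda>z. c * p z)"
proof (induction rule: trig.induct)
  case (mono d k)
  show ?case using trig.mono[of "c * d" k] by (simp add: mult.assoc)
next
  case (add p q)
  then show ?case using trig.add by (fastforce simp: distrib_left)
qed

lemma trig_smooth: "trig p \<Longrightarrow> smooth_circle p"
proof (induction rule: trig.induct)
  case (mono c k)
  show ?case
    using smooth_circle_lincomb(1)[OF smooth_circle_powi[of k] smooth_circle_powi[of k], of c 0]
    by simp
next
  case (add p q)
  then show ?case using smooth_circle_lincomb(1)[of p q 1 1] by simp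
qed

definition trig_on :: "(complex \<Rightarrow> complex) \<Rightarrow> bool" where
  "trig_on h \<longleftrightarrow> (\<exists>p. trig p \<and> (\<forall>z\<in>sphere 0 1. h z = p z))"

lemma trig_on_cong: "trig_on g \<Longrightarrow> (\<And>z. f z = g z) \<Longrightarrow> trig_on f"
  by (simp add: trig_on_def)

lemma trig_on_add: "trig_on f \<Longrightarrow> trig_on g \<Longrightarrow> trig_on (\<lambda>z. f z + g z)"
  unfolding trig_on_def by (metis trig.add)

lemma trig_on_cmult: "trig_on f \<Longrightarrow> trig_on (\<lambda>z. c * f z)"
  unfolding trig_on_def by (metis trig_cmult)

lemma trig_on_const: "trig_on (\<lambda>z. c)"
  unfolding trig_on_def by (metis trig_const)

lemma trig_on_powi_mult: "trig q \<Longrightarrow> trig_on (\<lambda>z. c * z powi k * q z)"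
proof (induction rule: trig.induct)
  case (mono d l)
  have "c * z powi k * (d * z powi l) = c * d * z powi (k + l)" if "z \<in> sphere 0 1" for z
  proof -
    have "z \<noteq> 0" using that by auto
    then show ?thesis by (simp add: power_int_add)
  qed
  then show ?case unfolding trig_on_def using trig.mono by blast
next
  case (add p q)
  then show ?case using trig_on_add[OF add.IH] by (simp add: distrib_left)
qed

lemma trig_on_mult:
  assumes "trig_on f" "trig_on g"
  shows "trig_on (\<lambda>z. f z * g z)"
proof -
  obtain p q where pq: "trig p" "trig q" "\<And>z. z \<in> sphere 0 1 \<Longrightarrow> f z = p z"
      "\<And>z. z \<in> sphere 0 1 \<Longrightarrow> g z = q z"
    using assms unfolding trig_on_def by blast
  from pq(1) have "trig_on (\<lambda>z. p z * q z)"
  proof (induction rule: trig.induct)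
    case (mono c k)
    show ?case by (rule trig_on_powi_mult) (rule pq)
  next
    case (add p1 p2)
    then show ?case using trig_on_add[OF add.IH] by (simp add: distrib_right)
  qed
  then show ?thesis using pq unfolding trig_on_def by auto
qed

lemma trig_on_Re: "trig_on (\<lambda>z. of_real (Re z))" and trig_on_Im: "trig_on (\<lambda>z. of_real (Im z))"
proof -
  have inv: "z powi (-1) = cnj z" if "z \<in> sphere 0 1" for z
    using that by (simp add: power_int_minus inverse_complex_def complex_eq_iff cmod_power2[symmetric])
  have "trig (\<lambda>z. 1/2 * z powi 1 + 1/2 * z powi (-1))"
    by (intro trig.intros)
  moreover have "of_real (Re z) = 1/2 * z powi 1 + 1/2 * z powi (-1)" if "z \<in> sphere 0 1" for z
    using inv[OF that] by (simp add: complex_eq_iff)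
  ultimately show "trig_on (\<lambda>z. of_real (Re z))"
    unfolding trig_on_def by blast
  have "trig (\<lambda>z. - \<i>/2 * z powi 1 + \<i>/2 * z powi (-1))"
    by (intro trig.intros)
  moreover have "of_real (Im z) = - \<i>/2 * z powi 1 + \<i>/2 * z powi (-1)" if "z \<in> sphere 0 1" for z
    using inv[OF that] by (simp add: complex_eq_iff)
  ultimately show "trig_on (\<lambda>z. of_real (Im z))"
    unfolding trig_on_def by blast
qed

lemma trig_on_real_polynomial:
  fixes h :: "complex \<Rightarrow> real"
  assumes "real_polynomial_function h"
  shows "trig_on (\<lambda>z. of_real (h z))"
  using assms
proof (induction rule: real_polynomial_function.induct)
  case (linear f)
  then interpret bounded_linear f .
  have "complex_of_real (f z) = of_real (f 1) * of_real (Re z) + of_real (f \<i>) * complex_of_real (Im z)" for z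
  proof -
    have "f z = f (Re z *\<^sub>R 1 + Im z *\<^sub>R \<i>)"
      by (intro arg_cong[where f = f]) (simp add: complex_eq_iff)
    then show ?thesis by (simp add: add scale mult.commute)
  qed
  note eq = this
  have t: "trig_on (\<lambda>z. of_real (f 1) * of_real (Re z) + of_real (f \<i>) * complex_of_real (Im z))"
    by (intro trig_on_add trig_on_cmult trig_on_Re trig_on_Im)
  show ?case by (rule trig_on_cong[OF t]) (rule eq)
next
  case (const c)
  show ?case by (rule trig_on_const)
next
  case (add f g)
  then show ?case using trig_on_add[OF add.IH] by simp
next
  case (mult f g)
  then show ?case using trig_on_mult[OF mult.IH] by simp
qed

lemma trig_dense_uniform:
  assumes "smooth_circle f" "e > 0"
  shows "\<exists>p. trig p \<and> (\<forall>z\<in>sphere 0 1. cmod (f z - p z) \<le> e)"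
proof -
  obtain g where g: "polynomial_function g" "\<And>z. z \<in> sphere 0 1 \<Longrightarrow> cmod (f z - g z) < e"
    using Stone_Weierstrass_polynomial_function[OF compact_sphere
        smooth_circle_continuous[OF assms(1)] assms(2)] by blast
  have "real_polynomial_function (Re \<circ> g)" "real_polynomial_function (Im \<circ> g)"
    using g(1) bounded_linear_Re bounded_linear_Im unfolding polynomial_function_def by blast+
  then have "trig_on (\<lambda>z. of_real ((Re \<circ> g) z) + \<i> * of_real ((Im \<circ> g) z))"
    by (intro trig_on_add trig_on_cmult trig_on_real_polynomial)
  moreover have "of_real ((Re \<circ> g) z) + \<i> * of_real ((Im \<circ> g) z) = g z" for z
    by (simp add: complex_eq_iff)
  ultimately have "trig_on g" by simp
  then show ?thesis using g(2) unfolding trig_on_def by (metis less_imp_le)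
qed

lemma trig_antideriv:
  "trig p \<Longrightarrow> \<exists>a q. trig q \<and> (\<forall>t. circle_deriv 1 q t = p (cis t) - a)"
proof (induction rule: trig.induct)
  case (mono c k)
  show ?case
  proof (cases "k = 0")
    case True
    have "circle_deriv 1 (\<lambda>z. 0) t = 0" for t by (simp add: circle_deriv_def)
    then show ?thesis using True trig_const[of 0] by (intro exI[of _ c] exI[of _ "\<lambda>z. 0"]) auto
  next
    case False
    have "circle_deriv 1 (\<lambda>z. c / (\<i> * of_int k) * z powi k) t = c * cis t powi k" for t
      using smooth_circle_lincomb(2)[OF smooth_circle_powi[of k] smooth_circle_powi[of k],
          of 1 "c / (\<i> * of_int k)" 0] False
      by (simp add: circle_deriv_powi cis_power_int)
    then show ?thesis
      by (intro exI[of _ 0] exI[of _ "\<lambda>z. c / (\<i> * of_int k) * z powi k"] conjI trig.mono) simp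
  qed
next
  case (add p1 p2)
  then obtain a1 q1 a2 q2 where q: "trig q1" "\<forall>t. circle_deriv 1 q1 t = p1 (cis t) - a1"
      "trig q2" "\<forall>t. circle_deriv 1 q2 t = p2 (cis t) - a2"
    by blast
  have "circle_deriv 1 (\<lambda>z. q1 z + q2 z) t = p1 (cis t) + p2 (cis t) - (a1 + a2)" for t
    using smooth_circle_lincomb(2)[OF trig_smooth[OF q(1)] trig_smooth[OF q(3)], of 1 1 1] q
    by simp
  then show ?case
    by (intro exI[of _ "a1 + a2"] exI[of _ "\<lambda>z. q1 z + q2 z"] conjI trig.add q) simp
qed

lemma circle_deriv_shift:
  assumes "circle_deriv 0 g = circle_deriv 1 f"
  shows "circle_deriv n g = circle_deriv (Suc n) f"
  using assms by (induction n) (simp_all add: circle_deriv_Suc)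

lemma mvt_bound:
  fixes h :: "real \<Rightarrow> complex"
  assumes "\<And>t. (h has_vector_derivative h' t) (at t)" "\<And>t. cmod (h' t) \<le> B" "a \<le> b"
  shows "cmod (h b - h a) \<le> B * (b - a)"
proof -
  have "norm (h b - h a) \<le> B * norm (b - a)"
    by (rule differentiable_bound[of UNIV h "\<lambda>t x. x *\<^sub>R h' t"])
       (use assms in \<open>auto simp: has_vector_derivative_def onorm_scaleR_left onorm_id\<close>)
  then show ?thesis using assms(3) by simp
qed

lemma trig_dense:
  assumes "smooth_circle f" "e > 0"
  shows "\<exists>p. trig p \<and> (\<forall>n\<le>N. \<forall>t. cmod (circle_deriv n f t - circle_deriv n p t) \<le> e)"
  using assms
proof (induction N arbitrary: f e)
  case 0
  then show ?case using trig_dense_uniform[of f e] by fastforce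
next
  case (Suc N)
  define d where "d = e / 16"
  have d: "d > 0" using Suc.prems d_def by simp
  define g where "g = (\<lambda>z. circle_deriv 1 f (Arg z))"
  have gt: "g (cis t) = circle_deriv 1 f t" for t
  proof -
    have per: "circle_deriv 1 f (s + of_int k * (2 * pi)) = circle_deriv 1 f s" for s k
    proof (induction k rule: int_induct[of _ 0])
      case (step1 i)
      then show ?case using circle_deriv_periodic[OF Suc.prems(1), of 1 "s + of_int i * (2 * pi)"]
        by (simp add: algebra_simps)
    next
      case (step2 i)
      then show ?case using circle_deriv_periodic[OF Suc.prems(1), of 1 "s + of_int (i - 1) * (2 * pi)"]
        by (simp add: algebra_simps)
    qed simp
    have "cis (Arg (cis t)) = cis t" by (simp add: cis_Arg_norm1)
    then have "sin (Arg (cis t)) = sin t \<and> cos (Arg (cis t)) = cos t"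
      by (simp add: complex_eq_iff)
    then obtain k :: int where "Arg (cis t) = t + of_int k * (2 * pi)"
      unfolding sin_cos_eq_iff by (auto simp: mult_ac)
    then have "g (cis t) = circle_deriv 1 f (t + of_int k * (2 * pi))"
      by (simp only: g_def)
    then show ?thesis by (simp only: per)
  qed
  have g0: "circle_deriv 0 g = circle_deriv 1 f" by (simp add: gt)
  have gn: "circle_deriv n g = circle_deriv (Suc n) f" for n
    by (rule circle_deriv_shift[OF g0])
  have gs: "smooth_circle g"
    using Suc.prems(1) by (simp add: smooth_circle_def gn)
  obtain p where p: "trig p" "\<And>n t. n \<le> N \<Longrightarrow> cmod (circle_deriv n g t - circle_deriv n p t) \<le> d"
    using Suc.IH[OF gs d] by blast
  obtain a q where q: "trig q" "\<And>t. circle_deriv 1 q t = p (cis t) - a"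
    using trig_antideriv[OF p(1)] by blast
  have ds: "(circle_deriv 0 f has_vector_derivative circle_deriv 1 f t) (at t)"
    "(circle_deriv 0 q has_vector_derivative circle_deriv 1 q t) (at t)" for t
    using smooth_circle_has_deriv[OF Suc.prems(1), of 0 t]
      smooth_circle_has_deriv[OF trig_smooth[OF q(1)], of 0 t] by simp_all
  have a: "cmod a \<le> d"
  proof -
    define h where "h = (\<lambda>t. circle_deriv 0 q t + t *\<^sub>R a - circle_deriv 0 f t)"
    have "(h has_vector_derivative (p (cis t) - circle_deriv 1 f t)) (at t)" for t
      unfolding h_def using ds[of t] q(2)[of t]
      by (auto intro!: derivative_eq_intros simp del: circle_deriv_0)
    moreover have "cmod (p (cis t) - circle_deriv 1 f t) \<le> d" for t
      using p(2)[of 0 t] by (simp add: gt norm_minus_commute)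
    ultimately have "cmod (h (2 * pi) - h 0) \<le> d * (2 * pi - 0)"
      by (intro mvt_bound[of h "\<lambda>t. p (cis t) - circle_deriv 1 f t"]) auto
    moreover have "h (2 * pi) - h 0 = (2 * pi) *\<^sub>R a"
      by (simp add: h_def)
    ultimately show ?thesis by (simp add: norm_mult)
  qed
  define b where "b = f 1 - q 1"
  define r where "r = (\<lambda>z. q z + b)"
  have r: "trig r" unfolding r_def by (intro trig.add q trig_const)
  have cb: "circle_deriv (Suc n) (\<lambda>z. b) t = 0" for n t
  proof -
    have "circle_deriv (Suc n) (\<lambda>z. b) = (\<lambda>t. 0)"
      by (induction n) (simp_all add: circle_deriv_Suc)
    then show ?thesis by simp
  qed
  have rn: "circle_deriv (Suc n) r = circle_deriv (Suc n) q" for n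
    using smooth_circle_lincomb(2)[OF trig_smooth[OF q(1)] trig_smooth[OF trig_const[of b]], of "Suc n" 1 1]
    unfolding r_def by (simp add: cb)
  have q1: "circle_deriv 0 (\<lambda>z. p z - a) = circle_deriv 1 q" by (rule ext) (simp only: circle_deriv_0 q(2))
  have s1: "cmod (circle_deriv (Suc n) f t - circle_deriv (Suc n) r t) \<le> 2 * d" if "n \<le> N" for n t
  proof -
    have "circle_deriv (Suc n) r t = circle_deriv n (\<lambda>z. p z - a) t"
      using rn circle_deriv_shift[OF q1, of n] by simp
    also have "\<dots> = circle_deriv n p t - circle_deriv n (\<lambda>z. a) t"
      using smooth_circle_lincomb(2)[OF trig_smooth[OF p(1)] trig_smooth[OF trig_const[of a]], of n 1 "-1"]
      by simp
    finally have e: "circle_deriv (Suc n) f t - circle_deriv (Suc n) r t =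
        (circle_deriv n g t - circle_deriv n p t) + circle_deriv n (\<lambda>z. a) t"
      by (simp add: gn)
    have "circle_deriv (Suc k) (\<lambda>z. a) = (\<lambda>t. 0)" for k
      by (induction k) (simp_all add: circle_deriv_Suc)
    then have "cmod (circle_deriv n (\<lambda>z. a) t) \<le> d"
      using a d by (cases n) auto
    then show ?thesis
      unfolding e using p(2)[OF that, of t] by (intro norm_triangle_le) simp
  qed
  have s0: "cmod (circle_deriv 0 f t - circle_deriv 0 r t) \<le> e" for t
  proof -
    define h where "h = (\<lambda>t. circle_deriv 0 f t - circle_deriv 0 r t)"
    have hd: "(h has_vector_derivative (circle_deriv (Suc 0) f t - circle_deriv (Suc 0) r t)) (at t)" for t
      unfolding h_def
      by (intro has_vector_derivative_diff smooth_circle_has_deriv Suc.prems trig_smooth r)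
    have *: "cmod (h u - h 0) \<le> 2 * d * (u - 0)" if "u \<ge> 0" for u
      by (rule mvt_bound[OF hd]) (use s1[of 0] that in auto)
    define u where "u = Arg2pi (cis t)"
    have u: "0 \<le> u" "u < 2 * pi"
      using Arg2pi[of "cis t"] by (auto simp: u_def)
    have cu: "cis u = cis t"
      using Arg2pi_eq[of "cis t"] by (simp add: u_def cis_conv_exp)
    have "h 0 = 0" by (simp add: h_def r_def b_def)
    then have "cmod (h u) \<le> 2 * d * u" using *[OF u(1)] by simp
    also have "\<dots> \<le> 2 * d * 8"
      using u d pi_less_4 by (intro mult_left_mono) auto
    also have "\<dots> = e" by (simp add: d_def)
    finally show ?thesis using cu by (simp add: h_def)
  qed
  have "cmod (circle_deriv n f t - circle_deriv n r t) \<le> e" if "n \<le> Suc N" for n t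
  proof (cases n)
    case 0
    then show ?thesis using s0 by simp
  next
    case (Suc k)
    then have "cmod (circle_deriv n f t - circle_deriv n r t) \<le> 2 * d" using s1[of k t] that by simp
    then show ?thesis using Suc.prems(2) by (simp add: d_def)
  qed
  then show ?case using r by blast
qed

lemma dapply_lincomb:
  assumes "smooth_circle f" "smooth_circle g"
  shows "dapply \<mu> (\<lambda>z. a * f z + b * g z) = a * dapply \<mu> f + b * dapply \<mu> g"
  using dapply[of \<mu>] assms by blast

lemma dapply_bound:
  "\<exists>N C. \<forall>f B. smooth_circle f \<longrightarrow> (\<forall>n\<le>N. \<forall>t. cmod (circle_deriv n f t) \<le> B) \<longrightarrow>
     cmod (dapply \<mu> f) \<le> C * B"
  using dapply[of \<mu>] by blast

lemma fourier_inject: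
  assumes "\<And>k. fourier \<mu> k = fourier \<nu> k"
  shows "\<mu> = \<nu>"
proof -
  define \<rho> where "\<rho> = \<mu> - \<nu>"
  have ap: "dapply \<rho> f = dapply \<mu> f - dapply \<nu> f" for f
    unfolding \<rho>_def by transfer simp
  have mono0: "dapply \<rho> (\<lambda>z. z powi k) = 0" for k
    using assms[of "- k"] by (simp add: ap fourier_def)
  have trig0: "dapply \<rho> p = 0" if "trig p" for p
    using that
  proof (induction rule: trig.induct)
    case (mono c k)
    show ?case
      using dapply_lincomb[OF smooth_circle_powi[of k] smooth_circle_powi[of k], of \<rho> c 0] mono0
      by simp
  next
    case (add p q)
    then show ?case using dapply_lincomb[OF trig_smooth trig_smooth, of p q \<rho> 1 1] by simp
  qed
  obtain N C where NC: "\<And>f B. smooth_circle f \<Longrightarrow>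
      (\<And>n t. n \<le> N \<Longrightarrow> cmod (circle_deriv n f t) \<le> B) \<Longrightarrow> cmod (dapply \<rho> f) \<le> C * B"
    using dapply_bound[of \<rho>] by blast
  have "dapply \<mu> f = dapply \<nu> f" if f: "smooth_circle f" for f
  proof -
    have "cmod (dapply \<rho> f) \<le> 0 + e" if e: "e > 0" for e
    proof -
      define d where "d = e / (\<bar>C\<bar> + 1)"
      have d: "d > 0" using e by (simp add: d_def)
      obtain p where p: "trig p"
          "\<And>n t. n \<le> N \<Longrightarrow> cmod (circle_deriv n f t - circle_deriv n p t) \<le> d"
        using trig_dense[OF f d] by blast
      note sm = trig_smooth[OF p(1)]
      have "cmod (dapply \<rho> (\<lambda>z. 1 * f z + (-1) * p z)) \<le> C * d"
        using p(2) smooth_circle_lincomb(2)[OF f sm, of _ 1 "-1"]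
        by (intro NC smooth_circle_lincomb(1)[OF f sm]) simp
      also have "dapply \<rho> (\<lambda>z. 1 * f z + (-1) * p z) = dapply \<rho> f"
        using dapply_lincomb[OF f sm, of \<rho> 1 "-1"] trig0[OF p(1)] by simp
      also have "C * d \<le> (\<bar>C\<bar> + 1) * d" using d by (intro mult_right_mono) auto
      also have "\<dots> = e"
      proof -
        have "\<bar>C\<bar> + 1 \<noteq> 0" using abs_ge_zero[of C] by linarith
        then show ?thesis by (simp add: d_def)
      qed
      finally show ?thesis by simp
    qed
    then have "cmod (dapply \<rho> f) \<le> 0" by (rule field_le_epsilon)
    then show ?thesis by (simp add: ap)
  qed
  then show ?thesis by (rule distr_eqI)
qed


lemma fourier_growth:
  "\<exists>N C. 0 \<le> C \<and> (\<forall>k. cmod (fourier \<mu> k) \<le> C * (1 + \<bar>real_of_int k\<bar>) ^ N)"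
proof -
  obtain N C where NC: "\<And>f B. smooth_circle f \<Longrightarrow>
      (\<And>n t. n \<le> N \<Longrightarrow> cmod (circle_deriv n f t) \<le> B) \<Longrightarrow> cmod (dapply \<mu> f) \<le> C * B"
    using dapply_bound[of \<mu>] by blast
  have "cmod (fourier \<mu> k) \<le> \<bar>C\<bar> * (1 + \<bar>real_of_int k\<bar>) ^ N" for k
  proof -
    have "cmod (fourier \<mu> k) \<le> C * (1 + \<bar>real_of_int k\<bar>) ^ N"
      unfolding fourier_def
    proof (intro NC smooth_circle_powi)
      fix n t assume "n \<le> N"
      have "cmod (circle_deriv n (\<lambda>z. z powi - k) t) = \<bar>real_of_int k\<bar> ^ n"
        by (simp add: circle_deriv_powi norm_mult norm_power)
      also have "\<dots> \<le> (1 + \<bar>real_of_int k\<bar>) ^ n" by (intro power_mono) auto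
      also have "\<dots> \<le> (1 + \<bar>real_of_int k\<bar>) ^ N" using \<open>n \<le> N\<close> by (intro power_increasing) auto
      finally show "cmod (circle_deriv n (\<lambda>z. z powi - k) t) \<le> (1 + \<bar>real_of_int k\<bar>) ^ N" .
    qed
    also have "\<dots> \<le> \<bar>C\<bar> * (1 + \<bar>real_of_int k\<bar>) ^ N" by (intro mult_right_mono) auto
    finally show ?thesis .
  qed
  then show ?thesis by (intro exI[of _ N] exI[of _ "\<bar>C\<bar>"]) auto
qed

definition coef :: "nat \<Rightarrow> (complex \<Rightarrow> complex) \<Rightarrow> int \<Rightarrow> complex" where
  "coef n f k = integral {0..2 * pi} (\<lambda>t. circle_deriv n f t * cis (of_int (- k) * t)) / of_real (2 * pi)"

lemma continuous_on_cis_mult: "continuous_on S (\<lambda>t. cis (x * t))"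
  by (intro continuous_intros)

lemma coef_integrable:
  assumes "smooth_circle f"
  shows "(\<lambda>t. circle_deriv n f t * cis (x * t)) integrable_on {a..b}"
  by (intro integrable_continuous_real continuous_on_mult circle_deriv_continuous assms
      continuous_on_cis_mult)

lemma coef_lincomb:
  assumes "smooth_circle f" "smooth_circle g"
  shows "coef 0 (\<lambda>z. a * f z + b * g z) k = a * coef 0 f k + b * coef 0 g k"
proof -
  note i = coef_integrable[OF assms(1), of 0 "of_int (- k)"] coef_integrable[OF assms(2), of 0 "of_int (- k)"]
  have "integral {0..2 * pi} (\<lambda>t. (a * f (cis t) + b * g (cis t)) * cis (of_int (- k) * t)) =
      integral {0..2 * pi} (\<lambda>t. a * (f (cis t) * cis (of_int (- k) * t)) + b * (g (cis t) * cis (of_int (- k) * t)))"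
    by (simp add: algebra_simps)
  also have "\<dots> = a * integral {0..2 * pi} (\<lambda>t. f (cis t) * cis (of_int (- k) * t)) +
      b * integral {0..2 * pi} (\<lambda>t. g (cis t) * cis (of_int (- k) * t))"
    using i by (subst integral_add) (auto intro!: integrable_on_mult_right)
  finally show ?thesis
    by (simp add: coef_def add_divide_distrib)
qed

lemma cis_int_2pi: "cis (of_int k * (2 * pi)) = 1"
  using cos_int_2pin[of k] sin_int_2pin[of k] by (simp add: complex_eq_iff mult.commute)

lemma coef_Suc:
  assumes "smooth_circle f"
  shows "coef (Suc n) f k = \<i> * of_int k * coef n f k"
proof -
  define x where "x = real_of_int (- k)"
  have d: "((\<lambda>t. circle_deriv n f t * cis (x * t)) has_vector_derivative
      (circle_deriv n f t * ((\<i> * of_real x) * cis (x * t)) + circle_deriv (Suc n) f t * cis (x * t))) (at t)" for t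
    by (intro has_vector_derivative_mult smooth_circle_has_deriv assms has_vector_derivative_cis_mult)
  have "((\<lambda>t. circle_deriv n f t * ((\<i> * of_real x) * cis (x * t)) + circle_deriv (Suc n) f t * cis (x * t))
      has_integral (circle_deriv n f (2 * pi) * cis (x * (2 * pi)) - circle_deriv n f 0 * cis (x * 0))) {0..2 * pi}"
    by (rule fundamental_theorem_of_calculus, simp) (rule has_vector_derivative_at_within[OF d])
  moreover have "circle_deriv n f (2 * pi) = circle_deriv n f 0"
    using circle_deriv_periodic[OF assms, of n 0] by simp
  moreover have "cis (x * (2 * pi)) = 1" unfolding x_def by (rule cis_int_2pi)
  ultimately have "integral {0..2 * pi} (\<lambda>t. (\<i> * of_real x) * (circle_deriv n f t * cis (x * t))
      + circle_deriv (Suc n) f t * cis (x * t)) = 0"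
    by (simp add: integral_unique mult_ac)
  then have "(\<i> * of_real x) * integral {0..2 * pi} (\<lambda>t. circle_deriv n f t * cis (x * t))
      + integral {0..2 * pi} (\<lambda>t. circle_deriv (Suc n) f t * cis (x * t)) = 0"
    by (subst (asm) integral_add)
       (auto intro!: integrable_on_mult_right coef_integrable[OF assms] simp del: circle_deriv_0)
  then have "integral {0..2 * pi} (\<lambda>t. circle_deriv (Suc n) f t * cis (x * t)) =
      \<i> * of_int k * integral {0..2 * pi} (\<lambda>t. circle_deriv n f t * cis (x * t))"
    by (simp add: x_def add_eq_0_iff)
  then show ?thesis by (simp add: coef_def x_def)
qed

lemma coef_power:
  assumes "smooth_circle f"
  shows "coef n f k = (\<i> * of_int k) ^ n * coef 0 f k"
  by (induction n) (simp_all add: coef_Suc[OF assms] mult_ac)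

lemma coef_bound:
  assumes "smooth_circle f" "\<And>t. cmod (circle_deriv n f t) \<le> B"
  shows "\<bar>real_of_int k\<bar> ^ n * cmod (coef 0 f k) \<le> B"
proof -
  have "cmod (integral {0..2 * pi} (\<lambda>t. circle_deriv n f t * cis (of_int (- k) * t))) \<le> B * (2 * pi - 0)"
    by (intro integral_bound continuous_on_mult circle_deriv_continuous assms(1) continuous_on_cis_mult)
       (use assms(2) in \<open>auto simp: norm_mult\<close>)
  then have "cmod (coef n f k) \<le> B"
    unfolding coef_def norm_divide norm_of_real
    by (subst pos_divide_le_eq) (simp_all del: circle_deriv_0)
  then show ?thesis
    unfolding coef_power[OF assms(1), of n] by (simp add: norm_mult norm_power)
qed

lemma coef_powi: "coef 0 (\<lambda>z. z powi l) k = (if k = l then 1 else 0)"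
proof (cases "k = l")
  case True
  have "cis t powi l * cis (of_int (- l) * t) = 1" for t
    by (simp add: cis_power_int cis_mult)
  then show ?thesis using True by (simp add: coef_def scaleR_conv_of_real)
next
  case False
  have "coef 1 (\<lambda>z. z powi l) k = \<i> * of_int l * coef 0 (\<lambda>z. z powi l) k"
  proof -
    have "integral {0..2 * pi} (\<lambda>t. \<i> * of_int l * cis (of_int l * t) * cis (of_int (- k) * t)) =
        \<i> * of_int l * integral {0..2 * pi} (\<lambda>t. cis (of_int l * t) * cis (of_int (- k) * t))"
      by (simp only: mult.assoc integral_mult_right)
    then show ?thesis by (simp add: coef_def circle_deriv_powi cis_power_int del: circle_deriv_0)
  qed
  moreover have "coef 1 (\<lambda>z. z powi l) k = \<i> * of_int k * coef 0 (\<lambda>z. z powi l) k"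
    using coef_Suc[OF smooth_circle_powi[of l], of 0 k] by simp
  ultimately show ?thesis using False by auto
qed

lemma D_exists: "\<exists>\<mu>'. \<forall>k. fourier \<mu>' k = of_int \<bar>k\<bar> * fourier \<mu> k"
proof -
  obtain N C where C: "0 \<le> C" and NC: "\<And>k. cmod (fourier \<mu> k) \<le> C * (1 + \<bar>real_of_int k\<bar>) ^ N"
    using fourier_growth by blast
  define T where "T = (\<lambda>f j. of_nat j * (fourier \<mu> (int j) * coef 0 f (- int j)
      + fourier \<mu> (- int j) * coef 0 f (int j)))"
  define L where "L = (\<lambda>f. if smooth_circle f then \<Sum>j. T f j else 0)"
  define K where "K = 2 * (C * 2 ^ N)"
  have T_bound: "cmod (T f j) \<le> K * B * (1 / real j ^ 2)"
    if f: "smooth_circle f" and B: "\<And>t. cmod (circle_deriv (N + 3) f t) \<le> B" for f B j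
  proof (cases "j = 0")
    case True
    then show ?thesis by (simp add: T_def)
  next
    case False
    then have j: "real j \<ge> 1" by simp
    have 1: "cmod (fourier \<mu> k * coef 0 f l) \<le> C * 2 ^ N * B / real j ^ 3"
      if "\<bar>k\<bar> = int j" "\<bar>l\<bar> = int j" for k l
    proof -
      have k: "\<bar>real_of_int k\<bar> = real j" and l: "\<bar>real_of_int l\<bar> = real j"
        using that by linarith+
      have "real j ^ (N + 3) * cmod (coef 0 f l) \<le> B"
        using coef_bound[OF f B, of l] l by simp
      then have c: "real j ^ N * cmod (coef 0 f l) \<le> B / real j ^ 3"
        using j by (simp add: field_simps power_add)
      have "cmod (fourier \<mu> k) \<le> C * (1 + real j) ^ N" using NC[of k] k by simp
      also have "\<dots> \<le> C * (2 * real j) ^ N"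
        using j C by (intro mult_left_mono power_mono) auto
      finally have "cmod (fourier \<mu> k) \<le> C * 2 ^ N * real j ^ N"
        by (simp add: power_mult_distrib mult.assoc)
      then have "cmod (fourier \<mu> k) * cmod (coef 0 f l) \<le> C * 2 ^ N * real j ^ N * cmod (coef 0 f l)"
        by (intro mult_right_mono) auto
      also have "\<dots> = C * 2 ^ N * (real j ^ N * cmod (coef 0 f l))" by simp
      also have "\<dots> \<le> C * 2 ^ N * (B / real j ^ 3)"
        using c C by (intro mult_left_mono) auto
      finally show ?thesis by (simp add: norm_mult)
    qed
    have "cmod (T f j) = real j * cmod (fourier \<mu> (int j) * coef 0 f (- int j)
        + fourier \<mu> (- int j) * coef 0 f (int j))"
      by (simp add: T_def norm_mult)
    also have "\<dots> \<le> real j * (C * 2 ^ N * B / real j ^ 3 + C * 2 ^ N * B / real j ^ 3)"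
      using 1[of "int j" "- int j"] 1[of "- int j" "int j"]
      by (intro mult_left_mono norm_triangle_le add_mono) auto
    also have "\<dots> = K * B * (1 / real j ^ 2)"
      using j by (simp add: K_def field_simps power2_eq_square power3_eq_cube)
    finally show ?thesis .
  qed
  have sum2: "summable (\<lambda>j. 1 / real j ^ 2)"
    using inverse_power_summable[of 2, where 'a = real] by (simp add: divide_inverse)
  have T_summable: "summable (T f)" if f: "smooth_circle f" for f
  proof -
    have "compact (circle_deriv (N + 3) f ` {0..2 * pi})"
      by (intro compact_continuous_image circle_deriv_continuous f) auto
    then have "bounded (circle_deriv (N + 3) f ` {0..2 * pi})" by (rule compact_imp_bounded)
    then obtain B where "\<forall>x\<in>circle_deriv (N + 3) f ` {0..2 * pi}. cmod x \<le> B"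
      unfolding bounded_iff by blast
    then have B: "cmod (circle_deriv (N + 3) f t) \<le> B" if "t \<in> {0..2 * pi}" for t
      using that by blast
    have "cmod (circle_deriv (N + 3) f t) \<le> B" for t
    proof -
      have per: "circle_deriv (N + 3) f (s + of_int k * (2 * pi)) = circle_deriv (N + 3) f s" for s k
      proof (induction k rule: int_induct[of _ 0])
        case (step1 i)
        then show ?case using circle_deriv_periodic[OF f, of "N + 3" "s + of_int i * (2 * pi)"]
          by (simp add: algebra_simps)
      next
        case (step2 i)
        then show ?case using circle_deriv_periodic[OF f, of "N + 3" "s + of_int (i - 1) * (2 * pi)"]
          by (simp add: algebra_simps)
      qed simp
      define k where "k = \<lfloor>t / (2 * pi)\<rfloor>"
      have "of_int k \<le> t / (2 * pi)" "t / (2 * pi) \<le> of_int k + 1"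
        unfolding k_def by linarith+
      then have "t - of_int k * (2 * pi) \<in> {0..2 * pi}"
        by (simp add: field_simps)
      from B[OF this] per[of "t - of_int k * (2 * pi)" k] show ?thesis by simp
    qed
    then show ?thesis
      by (intro summable_comparison_test'[OF summable_mult[OF sum2, of "K * B"], of 0] T_bound f)
  qed
  have "L \<in> {L. (\<forall>f. \<not> smooth_circle f \<longrightarrow> L f = 0) \<and>
    (\<forall>f g a b. smooth_circle f \<longrightarrow> smooth_circle g \<longrightarrow>
       L (\<lambda>z. a * f z + b * g z) = a * L f + b * L g) \<and>
    (\<exists>N C. \<forall>f B. smooth_circle f \<longrightarrow> (\<forall>n\<le>N. \<forall>t. cmod (circle_deriv n f t) \<le> B) \<longrightarrow>
       cmod (L f) \<le> C * B)}"
  proof (intro CollectI conjI allI impI)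
    fix f assume "\<not> smooth_circle f"
    then show "L f = 0" by (simp add: L_def)
  next
    fix f g a b assume fg: "smooth_circle f" "smooth_circle g"
    have "T (\<lambda>z. a * f z + b * g z) = (\<lambda>j. a * T f j + b * T g j)"
      by (simp add: T_def coef_lincomb[OF fg] algebra_simps)
    then show "L (\<lambda>z. a * f z + b * g z) = a * L f + b * L g"
      using fg T_summable
      by (simp add: L_def smooth_circle_lincomb(1) suminf_add[symmetric] suminf_mult summable_mult)
  next
    have "cmod (L f) \<le> (K * (\<Sum>j. 1 / real j ^ 2)) * B"
      if f: "smooth_circle f" and B: "\<forall>n\<le>N + 3. \<forall>t. cmod (circle_deriv n f t) \<le> B" for f B
    proof -
      have b: "cmod (T f j) \<le> K * B * (1 / real j ^ 2)" for j
        using B by (intro T_bound f) auto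
      have s: "summable (\<lambda>j. K * B * (1 / real j ^ 2))" by (rule summable_mult[OF sum2])
      have "cmod (\<Sum>j. T f j) \<le> (\<Sum>j. K * B * (1 / real j ^ 2))"
        by (rule norm_suminf_le[OF b s])
      also have "\<dots> = K * B * (\<Sum>j. 1 / real j ^ 2)" by (rule suminf_mult[OF sum2])
      finally show ?thesis using f by (simp add: L_def mult_ac)
    qed
    then show "\<exists>N C. \<forall>f B. smooth_circle f \<longrightarrow> (\<forall>n\<le>N. \<forall>t. cmod (circle_deriv n f t) \<le> B) \<longrightarrow>
       cmod (L f) \<le> C * B" by blast
  qed
  from Abs_distr_inverse[OF this] have L: "dapply (Abs_distr L) = L" .
  have F: "fourier (Abs_distr L) k = of_int \<bar>k\<bar> * fourier \<mu> k" for k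
  proof -
    have "T (\<lambda>z. z powi - k) j = (if j = nat \<bar>k\<bar> then of_int \<bar>k\<bar> * fourier \<mu> k else 0)" for j
      by (auto simp: T_def coef_powi abs_if)
    then have "(\<Sum>j. T (\<lambda>z. z powi - k) j) = (\<Sum>j. if j = nat \<bar>k\<bar> then of_int \<bar>k\<bar> * fourier \<mu> k else 0)"
      by presburger
    also have "\<dots> = of_int \<bar>k\<bar> * fourier \<mu> k"
      using sums_single[of "nat \<bar>k\<bar>" "\<lambda>j. of_int \<bar>k\<bar> * fourier \<mu> k"] by (auto simp: sums_iff)
    finally have *: "(\<Sum>j. T (\<lambda>z. z powi - k) j) = of_int \<bar>k\<bar> * fourier \<mu> k" .
    have "fourier (Abs_distr L) k = L (\<lambda>z. z powi - k)"
      unfolding fourier_def L ..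
    also have "\<dots> = (\<Sum>j. T (\<lambda>z. z powi - k) j)"
      unfolding L_def by (simp only: smooth_circle_powi if_True)
    finally show ?thesis unfolding * .
  qed
  show ?thesis by (rule exI[of _ "Abs_distr L"]) (rule allI, rule F)
qed

lemma fourier_D_op: "fourier (D_op \<mu>) k = of_int \<bar>k\<bar> * fourier \<mu> k"
proof -
  have "\<exists>!\<mu>'. \<forall>k. fourier \<mu>' k = of_int \<bar>k\<bar> * fourier \<mu> k"
  proof (rule ex_ex1I)
    show "\<exists>\<mu>'. \<forall>k. fourier \<mu>' k = of_int \<bar>k\<bar> * fourier \<mu> k" by (rule D_exists)
    show "\<mu>1 = \<mu>2" if "\<forall>k. fourier \<mu>1 k = of_int \<bar>k\<bar> * fourier \<mu> k"
        "\<forall>k. fourier \<mu>2 k = of_int \<bar>k\<bar> * fourier \<mu> k" for \<mu>1 \<mu>2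
      by (rule fourier_inject) (simp only: that)
  qed
  from theI'[OF this] show ?thesis unfolding D_op_def by (rule spec)
qed

end

theory Submission
  imports Defs "HOL-Complex_Analysis.Cauchy_Integral_Formula"
begin

text \<open>
Write \<open>a\<close> for the Taylor coefficients of \<open>f\<close> and \<open>u\<close> for the Fourier coefficients of \<open>\<mu>\<close>. Everything
rests on the matrix of the weighted Dirichlet integral in the basis of monomials,
\<open>D_{\<mu>,n}(f) = \<Sum>k l. binom (min k l) n * a k * cnj (a l) * u (l - k)\<close> (\<open>dirichlet_eq_form\<close>).
For \<open>n = 0\<close> it is the Fourier expansion of \<open>\<bar>f\<bar>\<^sup>2\<close>. For \<open>n \<ge> 1\<close> rotation invariance of area measure
leaves, for each pair \<open>(k, l)\<close>, only one term of the Poisson extension, and the remaining radial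
integral is a Beta integral. The formula has three consequences.

The identity \<open>binom (j + 1) n = binom j n + binom j (n - 1)\<close> gives
\<open>D_{\<mu>,n}(z f) = D_{\<mu>,n}(f) + D_{\<mu>,n-1}(f)\<close>, with the last term absent for \<open>n = 0\<close>
(\<open>dirichlet_form_case_nat\<close>).

If \<open>\<bar>u j\<bar> \<le> c (1 + \<bar>j\<bar>)^s\<close> with \<open>s \<le> (m - 3)/2\<close> and \<open>n + s \<le> m - 2\<close>, then \<open>D_{\<mu>,n}(f)\<close> is bounded by a
multiple of \<open>W(f) = \<Sum>k. (1 + k)^(m-1) \<bar>a k\<bar>\<^sup>2\<close>: after rescaling by \<open>(1 + k)^((m-1)/2)\<close> the matrix is
dominated by \<open>1 / (1 + max k l)\<close>, which is bounded on square summable sequences by Hardy's inequality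
(\<open>gram_bound\<close>). Conditions (ii), (iii) and (iv) are growth conditions of this kind, because finite
measures have bounded Fourier coefficients and \<open>D^j\<close> multiplies the \<open>k\<close>-th one by \<open>\<bar>k\<bar>^j\<close>. The pair
consisting of \<open>\<mu>_{m-1}\<close> and \<open>n = m - 2\<close> satisfies it with \<open>s = 0\<close>, since \<open>P_{\<mu>_{m-1}} \<ge> 0\<close> bounds the
Fourier coefficients of \<open>\<mu>_{m-1}\<close>.

Conversely \<open>W(f)\<close> is bounded by a multiple of \<open>X + Y\<close>, where \<open>X = D_{\<nu>,0}(f)\<close> and
\<open>Y = D_{\<mu>_{m-1},m-1}(f)\<close> (\<open>weighted_sum_bound\<close>). Condition (v) bounds \<open>Y\<close> from below by
\<open>c \<Sum>k. binom k (m-1) \<bar>a k\<bar>\<^sup>2\<close>, which controls all large \<open>k\<close>; condition (i), applied repeatedly to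
the backward shifts of \<open>f\<close>, bounds each single coefficient by \<open>X\<close>.

Hence the squared norm of \<open>f\<close> is \<open>C X + T + (1 + C) Y\<close> with \<open>\<bar>T\<bar> \<le> S (X + Y)\<close>, so that for
\<open>C \<ge> S + 1\<close> it is comparable with \<open>X + Y\<close>. Passing from \<open>f\<close> to \<open>z f\<close> leaves \<open>X\<close> unchanged
and adds to \<open>Y\<close> the term \<open>D_{\<mu>_{m-1},m-2}(f)\<close>, again at most a multiple of \<open>X + Y\<close>
(\<open>allowable_of_form_bounds\<close>).
\<close>

unbundle no fps_syntax

section \<open>Rotations and radial moments of planar Lebesgue measure\<close>

text \<open>
Transports the change of variables theorems, which concern \<open>real^2\<close>, to the complex plane.
\<close>

lemma lborel_complex_eq_distr:
  "(lborel :: complex measure) = distr lborel borel (\<lambda>v::real^2. Complex (v$1) (v$2))"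
proof (rule lborel_eqI)
  have m: "(\<lambda>v::real^2. Complex (v$1) (v$2)) \<in> borel_measurable borel"
    by (intro borel_measurable_continuous_onI continuous_intros)
  fix l u :: complex assume le: "\<And>b. b \<in> Basis \<Longrightarrow> l \<bullet> b \<le> u \<bullet> b"
  have pre: "(\<lambda>v::real^2. Complex (v$1) (v$2)) -` box l u
      = box (vector [Re l, Im l]) (vector [Re u, Im u])"
    by (auto simp: box_def Basis_complex_def Basis_vec_def cart_eq_inner_axis[symmetric] forall_2 inner_axis)
  have "emeasure (distr lborel borel (\<lambda>v::real^2. Complex (v$1) (v$2))) (box l u)
      = emeasure lborel (box (vector [Re l, Im l] :: real^2) (vector [Re u, Im u]))"
    using m by (subst emeasure_distr) (auto simp: pre)
  also have "\<dots> = ennreal (\<Prod>b\<in>Basis. (u - l) \<bullet> b)"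
    using le[of 1] le[of \<i>]
    by (subst emeasure_lborel_box)
      (auto simp: Basis_complex_def Basis_vec_def inner_axis forall_2 axis_eq_axis 
         UNIV_2 cart_eq_inner_axis[symmetric])
  finally show "emeasure (distr lborel borel (\<lambda>v::real^2. Complex (v$1) (v$2))) (box l u)
      = ennreal (\<Prod>b\<in>Basis. (u - l) \<bullet> b)" .
qed simp

text \<open>
Multiplication by a unimodular number is an orthogonal map of \<open>real^2\<close>, and these preserve volume;
Lebesgue measure is determined by its values on boxes.
\<close>

lemma lborel_rotation_invariant:
  assumes w: "cmod w = 1"
  shows "distr lborel borel ((*) w) = (lborel :: complex measure)"
proof -
  define \<phi> where "\<phi> = (\<lambda>v::real^2. Complex (v$1) (v$2))"
  define \<psi> where "\<psi> = (\<lambda>z. vector [Re z, Im z] :: real^2)"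
  define T where "T = (\<lambda>w v. \<psi> (w * \<phi> v))"
  have inv [simp]: "\<phi> (\<psi> z) = z" "\<psi> (\<phi> v) = v" for z v
    by (auto simp: \<phi>_def \<psi>_def vec_eq_iff forall_2)
  have m: "\<phi> \<in> borel_measurable borel"
    unfolding \<phi>_def by (intro borel_measurable_continuous_onI continuous_intros)
  have norm_\<phi>: "cmod (\<phi> v) = norm v" for v
    by (simp add: \<phi>_def norm_vec_def L2_set_def UNIV_2 cmod_def)
  have lin: "linear (T w)" for w
    unfolding T_def \<phi>_def \<psi>_def
    by (rule linearI) (auto simp: vec_eq_iff forall_2 algebra_simps)
  have orth: "orthogonal_transformation (T w)" if "cmod w = 1" for w
    unfolding orthogonal_transformation
    using lin that norm_\<phi>[of "T w _"] by (auto simp: T_def norm_mult norm_\<phi> simp flip: norm_\<phi>)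
  have eq: "emeasure (distr lborel borel ((*) w)) (box l u) = emeasure lborel (box l u)" for l u :: complex
  proof -
    let ?B = "\<phi> -` box l u"
    have oB: "open ?B"
      by (rule open_vimage) (auto simp: \<phi>_def Complex_eq intro!: continuous_intros)
    have boxm: "?B = box (\<psi> l) (\<psi> u)"
      by (auto simp: \<phi>_def \<psi>_def box_def Basis_complex_def Basis_vec_def cart_eq_inner_axis[symmetric] forall_2 inner_axis)
    have pre: "\<phi> -` ((*) w -` box l u) = T (cnj w) ` ?B"
    proof -
      have 1: "w * cnj w = 1" using w by (simp add: complex_norm_square[symmetric])
      have ww: "cnj w * (w * z) = z" "w * (cnj w * z) = z" for z
        using 1 by (simp_all add: mult.assoc[symmetric] mult.commute)
      show ?thesis
      proof (intro set_eqI iffI)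
        fix v assume "v \<in> \<phi> -` ((*) w -` box l u)"
        then have "T w v \<in> ?B" by (simp add: T_def)
        moreover have "v = T (cnj w) (T w v)" by (simp add: T_def ww)
        ultimately show "v \<in> T (cnj w) ` ?B" by blast
      next
        fix v assume "v \<in> T (cnj w) ` ?B"
        then show "v \<in> \<phi> -` ((*) w -` box l u)" by (auto simp: T_def ww)
      qed
    qed
    have lm: "?B \<in> lmeasurable" unfolding boxm by simp
    have o: "orthogonal_transformation (T (cnj w))" using w by (intro orth) simp
    have "emeasure (distr lborel borel ((*) w)) (box l u) = emeasure (lborel :: complex measure) ((*) w -` box l u)"
      by (subst emeasure_distr) auto
    also have "\<dots> = emeasure (distr lborel borel \<phi>) ((*) w -` box l u)"
      by (simp add: \<phi>_def lborel_complex_eq_distr[symmetric])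
    also have "\<dots> = emeasure lborel (\<phi> -` ((*) w -` box l u))"
    proof -
      have "(*) w -` box l u \<in> sets borel"
        by (intro borel_open open_vimage) (auto intro!: continuous_intros)
      then show ?thesis using m by (subst emeasure_distr) auto
    qed
    also have "\<dots> = emeasure lebesgue (T (cnj w) ` ?B)"
    proof -
      have "open (\<phi> -` ((*) w -` box l u))"
        by (intro open_vimage) (auto simp: \<phi>_def Complex_eq intro!: continuous_intros)
      then show ?thesis unfolding pre by simp
    qed
    also have "\<dots> = emeasure lebesgue ?B"
      by (simp only: emeasure_eq_measure2[OF lm] measure_orthogonal_image[OF o lm]
          emeasure_eq_measure2[OF measurable_orthogonal_image[OF o lm]])
    also have "\<dots> = emeasure (distr lborel borel \<phi>) (box l u)"
      using m oB by (subst emeasure_distr) auto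
    finally show ?thesis by (simp add: \<phi>_def lborel_complex_eq_distr[symmetric])
  qed
  show ?thesis
    by (rule lborel_eqI[symmetric]) (auto simp: eq emeasure_lborel_box)
qed

text \<open>
The disc of radius \<open>s\<close> has area \<open>\<pi> s\<^sup>2\<close>, so under \<open>z \<mapsto> \<bar>z\<bar>\<^sup>2\<close> area measure becomes \<open>\<pi>\<close> times length. This
takes the place of polar coordinates for radial functions.
\<close>

lemma distr_cmod_squared_ball:
  assumes r: "0 < r"
  shows "distr (density lborel (indicator (ball (0::complex) r))) borel (\<lambda>z. (cmod z)\<^sup>2)
       = density lborel (\<lambda>t. ennreal (pi * indicator {0<..<r\<^sup>2} t))" (is "?M = ?N")
proof (rule measure_eqI_lessThan)
  have ind [measurable]: "indicator (ball (0::complex) r) \<in> borel_measurable borel" 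
    by (rule borel_measurable_indicator) simp
  have eM: "emeasure ?M {x<..} = ennreal (pi * max 0 (r\<^sup>2 - max 0 x))" for x
  proof -
    define S where "S = {z::complex. x < (cmod z)\<^sup>2} \<inter> ball 0 r"
    have ms: "{z::complex. x < (cmod z)\<^sup>2} \<in> sets borel" by measurable
    have "emeasure ?M {x<..}
        = emeasure (density lborel (indicator (ball (0::complex) r))) {z. x < (cmod z)\<^sup>2}"
      by (subst emeasure_distr) (auto simp: vimage_def)
    also have "\<dots> = (\<integral>\<^sup>+z. indicator (ball (0::complex) r) z * indicator {z. x < (cmod z)\<^sup>2} z \<partial>lborel)"
      using ms by (subst emeasure_density) auto
    also have "\<dots> = (\<integral>\<^sup>+z. indicator S z \<partial>lborel)"
      by (intro nn_integral_cong) (auto simp: S_def indicator_def)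
    also have "\<dots> = emeasure lborel S"
      using ms by (subst nn_integral_indicator) (auto simp: S_def)
    also have "\<dots> = ennreal (pi * max 0 (r\<^sup>2 - max 0 x))"
    proof -
      consider "x < 0" | "0 \<le> x" "x < r\<^sup>2" | "x \<ge> r\<^sup>2" by linarith
      then show ?thesis
      proof cases
        case 1
        then have "S = ball 0 r" using order_less_le_trans[OF 1 zero_le_power2] by (auto simp: S_def)
        then show ?thesis using 1 r by (simp add: emeasure_ball unit_ball_vol_2)
      next
        case 2
        define s where "s = sqrt x"
        have s: "0 \<le> s" "s\<^sup>2 = x" using 2 by (auto simp: s_def)
        have sr: "s < r" using 2 r by (simp add: s_def real_less_lsqrt)
        have "S = ball 0 r - cball 0 s"
          using s by (auto simp: S_def power_strict_mono s(2)[symmetric])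
            (metis linorder_not_le norm_ge_zero power_mono)
        moreover have "emeasure lborel (ball 0 r - cball (0::complex) s)
            = emeasure lborel (ball (0::complex) r) - emeasure lborel (cball (0::complex) s)"
          using sr s by (intro emeasure_Diff) (auto simp: emeasure_cball)
        ultimately show ?thesis using s sr r 2
          by (simp add: emeasure_ball emeasure_cball unit_ball_vol_2 ennreal_minus algebra_simps)
      next
        case 3
        have "(cmod z)\<^sup>2 < r\<^sup>2" if "cmod z < r" for z using that by (intro power_strict_mono) auto
        then have "S = {}" using 3 by (fastforce simp: S_def)
        moreover have "0 \<le> x" using 3 zero_le_power2[of r] by linarith
        ultimately show ?thesis using 3 by (auto simp: max_def)
      qed
    qed
    finally show ?thesis .
  qed
  show "emeasure ?M {x<..} < \<infinity>" for x by (simp add: eM)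
  show "emeasure ?M {x<..} = emeasure ?N {x<..}" for x
  proof -
    have "emeasure ?N {x<..} = (\<integral>\<^sup>+t. ennreal (pi * indicator {0<..<r\<^sup>2} t) * indicator {x<..} t \<partial>lborel)"
      by (subst emeasure_density) auto
    also have "\<dots> = (\<integral>\<^sup>+t. ennreal pi * indicator {max 0 x<..<r\<^sup>2} t \<partial>lborel)"
      by (intro nn_integral_cong) (auto simp: indicator_def)
    also have "\<dots> = ennreal pi * emeasure lborel {max 0 x<..<r\<^sup>2}"
      by (subst nn_integral_cmult_indicator) auto
    also have "\<dots> = ennreal (pi * max 0 (r\<^sup>2 - max 0 x))"
    proof (cases "max 0 x \<le> r\<^sup>2")
      case True
      then have "emeasure lborel {max 0 x<..<r\<^sup>2} = ennreal (r\<^sup>2 - max 0 x)"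
        by (rule emeasure_lborel_Ioo)
      then show ?thesis using True by (simp add: ennreal_mult)
    qed (auto simp: max_def)
    finally show ?thesis by (simp add: eM)
  qed
qed auto

lemma lborel_integral_radial_ball:
  fixes h :: "real \<Rightarrow> real"
  assumes r: "0 < r" and h [measurable]: "h \<in> borel_measurable borel"
  shows "(LINT z:ball (0::complex) r|lborel. h ((cmod z)\<^sup>2)) = pi * (LINT t:{0<..<r\<^sup>2}|lborel. h t)"
proof -
  have "(LINT z:ball (0::complex) r|lborel. h ((cmod z)\<^sup>2))
      = (LINT z|density lborel (\<lambda>z. ennreal (indicator (ball (0::complex) r) z)). h ((cmod z)\<^sup>2))"
    unfolding set_lebesgue_integral_def by (subst integral_density) (auto intro!: borel_measurable_indicator)
  also have "\<dots> = (LINT t|distr (density lborel (indicator (ball (0::complex) r))) borel (\<lambda>z. (cmod z)\<^sup>2). h t)"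
    by (subst integral_distr) (auto simp: ennreal_indicator)
  also have "\<dots> = (LINT t|lborel. (pi * indicator {0<..<r\<^sup>2} t) *\<^sub>R h t)"
    unfolding distr_cmod_squared_ball[OF r] by (subst integral_density) auto
  also have "\<dots> = pi * (LINT t:{0<..<r\<^sup>2}|lborel. h t)"
    unfolding set_lebesgue_integral_def by (simp add: mult.assoc)
  finally show ?thesis .
qed

text \<open>
Multiplying the variable by a unimodular \<open>w\<close> multiplies the integral by \<open>w^(j-l)\<close>, so it suffices to
choose \<open>w\<close> with \<open>w^(j-l) = -1\<close>.
\<close>

lemma disc_moment_off_diagonal:
  fixes h :: "real \<Rightarrow> real"
  assumes "j \<noteq> l" and h [measurable]: "h \<in> borel_measurable borel"
  shows "(LINT z:ball 0 r|lborel. z ^ j * cnj z ^ l * of_real (h (cmod z))) = 0"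
proof -
  \<comment> \<open>rotation by this angle multiplies \<open>z^j * cnj z^l\<close> by \<open>cis \<pi>\<close>\<close>
  define t where "t = pi / (real j - real l)"
  define w where "w = cis t"
  define F where "F = (\<lambda>z::complex. indicator (ball 0 r) z *\<^sub>R (z ^ j * cnj z ^ l * of_real (h (cmod z))))"
  have F [measurable]: "F \<in> borel_measurable borel"
  proof -
    have "(\<lambda>z. z ^ j * cnj z ^ l) \<in> borel_measurable (borel :: complex measure)"
      by (intro borel_measurable_continuous_onI continuous_intros)
    moreover have "(\<lambda>z::complex. h (cmod z)) \<in> borel_measurable borel" by measurable
    ultimately show ?thesis unfolding F_def
      by (intro borel_measurable_scaleR borel_measurable_indicator borel_measurable_of_real
          borel_measurable_times[of "\<lambda>z. z ^ j * cnj z ^ l"]) simp_all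
  qed
  have "real j * t + real l * (- t) = pi"
    using assms(1) unfolding t_def
    by (simp only: mult_minus_right add_uminus_conv_diff left_diff_distrib[symmetric]) simp
  then have "w ^ j * cnj w ^ l = -1"
    by (simp only: w_def cis_cnj Complex.DeMoivre cis_mult cis_pi)
  moreover have "(w * z) ^ j * cnj (w * z) ^ l = (w ^ j * cnj w ^ l) * (z ^ j * cnj z ^ l)" for z
    by (simp only: complex_cnj_mult power_mult_distrib mult_ac)
  ultimately have "(w * z) ^ j * cnj (w * z) ^ l = - (z ^ j * cnj z ^ l)" for z
    by simp
  moreover have "cmod (w * z) = cmod z" for z by (simp add: norm_mult w_def)
  ultimately have rot: "F (w * z) = - F z" for z
    unfolding F_def indicator_def by (simp only: mem_ball_0) simp
  have "(LINT z|lborel. F z) = (LINT z|distr lborel borel ((*) w). F z)"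
    by (subst lborel_rotation_invariant) (simp_all add: w_def)
  also have "\<dots> = (LINT z|lborel. F (w * z))"
    by (rule integral_distr) auto
  also have "\<dots> = - (LINT z|lborel. F z)"
    unfolding rot by (rule Bochner_Integration.integral_minus)
  finally have "(LINT z|lborel. F z) = 0" by simp
  then show ?thesis unfolding F_def set_lebesgue_integral_def .
qed

definition disc_moment :: "nat \<Rightarrow> real \<Rightarrow> nat \<Rightarrow> real" where
  "disc_moment n r j = (LINT z:ball (0::complex) r|lborel. (cmod z)\<^sup>2 ^ j * (1 - (cmod z)\<^sup>2) ^ (n - 1))"

lemma disc_moment_eq_integral:
  assumes r: "0 < r"
  shows "disc_moment n r j = pi * integral {0..r\<^sup>2} (\<lambda>t. t ^ j * (1 - t) ^ (n - 1))"
proof -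
  let ?h = "\<lambda>t::real. t ^ j * (1 - t) ^ (n - 1)"
  have "set_integrable lborel {0..r\<^sup>2} ?h"
    by (intro borel_integrable_atLeastAtMost' continuous_intros)
  then have "set_integrable lborel {0<..<r\<^sup>2} ?h"
    by (rule set_integrable_subset) auto
  then have "(LINT t:{0<..<r\<^sup>2}|lborel. ?h t) = integral {0<..<r\<^sup>2} ?h"
    by (rule set_borel_integral_eq_integral(2))
  also have "\<dots> = integral {0..r\<^sup>2} ?h"
    using integral_open_interval[of 0 "r\<^sup>2" ?h] by (simp only: box_real)
  finally have *: "(LINT t:{0<..<r\<^sup>2}|lborel. ?h t) = integral {0..r\<^sup>2} ?h" .
  have "disc_moment n r j = pi * (LINT t:{0<..<r\<^sup>2}|lborel. ?h t)"
    unfolding disc_moment_def by (rule lborel_integral_radial_ball[OF r]) measurable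
  then show ?thesis unfolding * .
qed

text \<open>
The substitution \<open>t = \<bar>z\<bar>\<^sup>2\<close> turns the full moment into the Beta integral \<open>B (j + 1) n\<close>.
\<close>

lemma disc_moment_one:
  assumes n: "n \<ge> 1"
  shows "disc_moment n 1 j = pi * fact j * fact (n - 1) / fact (j + n)"
proof -
  have "((\<lambda>t. t powr (real (Suc j) - 1) * (1 - t) powr (real n - 1)) has_integral Beta (Suc j) n) {0..1}"
    using n by (intro has_integral_Beta_real) auto
  moreover have "t powr (real (Suc j) - 1) * (1 - t) powr (real n - 1) = t ^ j * (1 - t) ^ (n - 1)"
    if "t \<in> {0..1} - {0,1}" for t
  proof -
    have "real (Suc j) - 1 = real j" "real n - 1 = real (n - 1)" using n by auto
    moreover have "t powr real j = t ^ j" "(1 - t) powr real (n - 1) = (1 - t) ^ (n - 1)"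
      using that by (auto intro!: powr_realpow)
    ultimately show ?thesis by (simp only:)
  qed
  ultimately have "((\<lambda>t. t ^ j * (1 - t) ^ (n - 1)) has_integral Beta (Suc j) n) {0..1::real}"
    by (intro has_integral_spike[of "{0,1}" "{0..1}" "\<lambda>t. t ^ j * (1 - t) ^ (n - 1)"
        "\<lambda>t. t powr (real (Suc j) - 1) * (1 - t) powr (real n - 1)"]) simp_all
  then have "integral {0..1} (\<lambda>t::real. t ^ j * (1 - t) ^ (n - 1)) = Beta (Suc j) n"
    by (rule integral_unique)
  also have "\<dots> = fact j * fact (n - 1) / fact (j + n)"
  proof -
    obtain q where q: "n = Suc q" using n by (cases n) auto
    have "Gamma (real (Suc j)) = fact j" "Gamma (real n) = fact q" "Gamma (real (Suc j) + real n) = fact (j + n)"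
      using Gamma_fact[of j, where 'a = real] Gamma_fact[of q, where 'a = real]
        Gamma_fact[of "j + n", where 'a = real]
      by (simp_all add: q add_ac)
    then show ?thesis by (simp add: Beta_def q)
  qed
  finally show ?thesis by (simp add: disc_moment_eq_integral)
qed

lemma disc_moment_bounds:
  assumes r: "0 < r" "r < 1"
  shows "0 \<le> disc_moment n r j" "disc_moment n r j \<le> disc_moment n 1 j"
proof -
  let ?h = "\<lambda>t::real. t ^ j * (1 - t) ^ (n - 1)"
  have r2: "r\<^sup>2 \<le> 1" using r by (simp add: power_le_one)
  have int: "?h integrable_on {a..b}" for a b
    by (intro integrable_continuous_real continuous_intros)
  have "0 \<le> integral {0..r\<^sup>2} ?h"
    using r2 by (intro integral_nonneg int) auto
  then show "0 \<le> disc_moment n r j" using r by (simp add: disc_moment_eq_integral)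
  have "integral {0..r\<^sup>2} ?h \<le> integral {0..1} ?h"
    using r2 by (intro integral_subset_le int) auto
  then show "disc_moment n r j \<le> disc_moment n 1 j" using r by (simp add: disc_moment_eq_integral)
qed

lemma disc_moment_tendsto: "((\<lambda>r. disc_moment n r j) \<longlongrightarrow> disc_moment n 1 j) (at_left 1)"
proof -
  let ?h = "\<lambda>t::real. t ^ j * (1 - t) ^ (n - 1)"
  have "?h integrable_on {0..1}"
    by (intro integrable_continuous_real continuous_intros)
  then have "continuous_on {0..1} (\<lambda>x. integral {0..x} ?h)"
    by (rule indefinite_integral_continuous_1)
  then have "continuous_on {0..1} (\<lambda>r. integral {0..r\<^sup>2} ?h)"
    by (rule continuous_on_compose2) (auto intro!: continuous_intros power_le_one)
  then have "((\<lambda>r. integral {0..r\<^sup>2} ?h) \<longlongrightarrow> integral {0..1\<^sup>2} ?h) (at 1 within {0..1})"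
    unfolding continuous_on_def by (rule bspec) simp
  then have "((\<lambda>r. integral {0..r\<^sup>2} ?h) \<longlongrightarrow> integral {0..1\<^sup>2} ?h) (at_left 1)"
    by (simp only: at_within_Icc_at_left[of 0 1, OF zero_less_one])
  then have "((\<lambda>r. pi * integral {0..r\<^sup>2} ?h) \<longlongrightarrow> pi * integral {0..1\<^sup>2} ?h) (at_left 1)"
    by (intro tendsto_intros)
  moreover have "\<forall>\<^sub>F r in at_left 1. pi * integral {0..r\<^sup>2} ?h = disc_moment n r j"
    using eventually_at_left_real[of 0 1] by (auto elim!: eventually_mono simp: disc_moment_eq_integral)
  ultimately show ?thesis
    unfolding disc_moment_eq_integral[OF zero_less_one] by (rule Lim_transform_eventually)
qed

lemma integrable_on_disc:
  fixes g :: "complex \<Rightarrow> complex"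
  assumes "continuous_on UNIV g"
  shows "set_integrable lborel (ball 0 r) g"
proof -
  have "set_integrable lborel (cball 0 r) g"
    unfolding set_integrable_def
    by (rule borel_integrable_compact) (use continuous_on_subset[OF assms] in simp_all)
  then show ?thesis by (rule set_integrable_subset) auto
qed

lemma disc_integral_monomial:
  "(LINT z:ball 0 r|lborel. z ^ j * cnj z ^ l * of_real ((1 - (cmod z)\<^sup>2) ^ (n - 1)))
   = (if j = l then of_real (disc_moment n r j) else 0)"
proof (cases "j = l")
  case True
  have "z ^ l * cnj z ^ l = of_real ((cmod z)\<^sup>2 ^ l)" for z
  proof -
    have "z ^ l * cnj z ^ l = (z * cnj z) ^ l" by (rule power_mult_distrib[symmetric])
    also have "\<dots> = (of_real ((cmod z)\<^sup>2)) ^ l" by (simp only: complex_norm_square)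
    finally show ?thesis by simp
  qed
  then have "(LINT z:ball 0 r|lborel. z ^ j * cnj z ^ l * of_real ((1 - (cmod z)\<^sup>2) ^ (n - 1)))
      = (LINT z:ball 0 r|lborel. complex_of_real ((cmod z)\<^sup>2 ^ l * (1 - (cmod z)\<^sup>2) ^ (n - 1)))"
    unfolding True by (simp only: of_real_mult)
  also have "\<dots> = of_real (disc_moment n r l)"
    unfolding disc_moment_def by (rule set_integral_complex_of_real)
  finally show ?thesis using True by simp
next
  case False
  then show ?thesis
    using disc_moment_off_diagonal[OF False, of "\<lambda>x. (1 - x\<^sup>2) ^ (n - 1)"] by simp
qed

section \<open>Taylor coefficients of smooth analytic functions\<close>

definition rapidly_decreasing :: "(nat \<Rightarrow> complex) \<Rightarrow> bool" where
  "rapidly_decreasing a \<longleftrightarrow> (\<forall>N. \<exists>B. \<forall>k. cmod (a k) * (1 + real k) ^ N \<le> B)"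

lemma summable_inverse_square_shifted: "summable (\<lambda>k. 1 / (1 + real k)\<^sup>2)"
proof -
  have "summable (\<lambda>k. inverse ((real (Suc k))\<^sup>2))"
    by (rule summable_Suc_iff[THEN iffD2, of "\<lambda>k. inverse ((real k)\<^sup>2)"])
      (rule inverse_power_summable, simp)
  then show ?thesis by (simp add: divide_inverse add.commute)
qed

lemma rapidly_decreasing_summable:
  assumes "rapidly_decreasing a"
  shows "summable (\<lambda>k. cmod (a k) * (1 + real k) ^ N)"
proof -
  obtain B where B: "\<And>k. cmod (a k) * (1 + real k) ^ (N + 2) \<le> B"
    using assms unfolding rapidly_decreasing_def by blast
  have "norm (cmod (a k) * (1 + real k) ^ N) \<le> B * (1 / (1 + real k)\<^sup>2)" for k
    using B[of k] by (simp add: power_add pos_le_divide_eq power2_eq_square mult_ac)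
  then show ?thesis
    by (intro summable_comparison_test'[OF summable_mult[OF summable_inverse_square_shifted]])
qed

lemma rapidly_decreasing_diffs:
  assumes "rapidly_decreasing a"
  shows "rapidly_decreasing (diffs a)"
  unfolding rapidly_decreasing_def
proof
  fix N
  obtain B where B: "\<And>k. cmod (a k) * (1 + real k) ^ (N + 1) \<le> B"
    using assms unfolding rapidly_decreasing_def by blast
  have "cmod (diffs a k) * (1 + real k) ^ N \<le> B" for k
  proof -
    have "cmod (diffs a k) * (1 + real k) ^ N = cmod (a (Suc k)) * (1 + real k) ^ (N + 1)"
      by (simp add: diffs_def norm_mult del: of_nat_Suc)
    also have "\<dots> \<le> cmod (a (Suc k)) * (1 + real (Suc k)) ^ (N + 1)"
      by (intro mult_left_mono power_mono) auto
    also have "\<dots> \<le> B" by (rule B)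
    finally show ?thesis .
  qed
  then show "\<exists>B. \<forall>k. cmod (diffs a k) * (1 + real k) ^ N \<le> B" by blast
qed

lemma rapidly_decreasing_funpow_diffs:
  "rapidly_decreasing a \<Longrightarrow> rapidly_decreasing ((diffs ^^ n) a)"
  by (induction n) (auto intro: rapidly_decreasing_diffs)

text \<open>
Makes polynomials available as test functions.
\<close>

lemma rapidly_decreasing_finite_support:
  assumes "\<And>k. k \<ge> N \<Longrightarrow> a k = 0"
  shows "rapidly_decreasing a"
  unfolding rapidly_decreasing_def
proof
  fix M
  have "cmod (a k) * (1 + real k) ^ M \<le> (\<Sum>j<N. cmod (a j) * (1 + real j) ^ M)" for k
  proof (cases "k < N")
    case True
    then show ?thesis by (intro member_le_sum) auto
  next
    case False
    then show ?thesis using assms[of k] by (auto intro!: sum_nonneg)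
  qed
  then show "\<exists>B. \<forall>k. cmod (a k) * (1 + real k) ^ M \<le> B" by blast
qed

text \<open>
The sequence \<open>case_nat 0 a\<close> is the forward shift of \<open>a\<close>: these are the coefficients of \<open>z f\<close>.
\<close>

lemma rapidly_decreasing_case_nat:
  assumes "rapidly_decreasing a"
  shows "rapidly_decreasing (case_nat 0 a)"
  unfolding rapidly_decreasing_def
proof
  fix N
  obtain B where B: "\<And>k. cmod (a k) * (1 + real k) ^ N \<le> B"
    using assms unfolding rapidly_decreasing_def by blast
  have B0: "0 \<le> B" by (rule order_trans[OF _ B[of 0]]) auto
  have "cmod (case_nat 0 a k) * (1 + real k) ^ N \<le> 2 ^ N * B" for k
  proof (cases k)
    case (Suc j)
    have "cmod (a j) * (1 + real (Suc j)) ^ N \<le> cmod (a j) * (2 * (1 + real j)) ^ N"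
      by (intro mult_left_mono power_mono) auto
    also have "\<dots> = 2 ^ N * (cmod (a j) * (1 + real j) ^ N)" unfolding power_mult_distrib by simp
    also have "\<dots> \<le> 2 ^ N * B" by (intro mult_left_mono B) auto
    finally show ?thesis by (simp add: Suc)
  qed (use B0 in auto)
  then show "\<exists>B. \<forall>k. cmod (case_nat 0 a k) * (1 + real k) ^ N \<le> B" by blast
qed

lemma funpow_diffs_eq: "(diffs ^^ n) a k = fact (k + n) / fact k * (a (k + n) :: complex)"
proof (induction n arbitrary: k)
  case (Suc n)
  have "(diffs ^^ Suc n) a k = of_nat (Suc k) * (fact (Suc k + n) / fact (Suc k) * a (Suc k + n))"
    by (simp add: diffs_def[of "(diffs ^^ n) a"] Suc del: of_nat_Suc fact_Suc)
  also have "\<dots> = (of_nat (Suc k) / fact (Suc k)) * (fact (Suc k + n) * a (Suc k + n))"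
    by simp
  also have "of_nat (Suc k) / fact (Suc k) = (1 / fact k :: complex)"
    by (simp add: fact_Suc del: of_nat_Suc)
  finally show ?case by simp
qed simp

lemma rapidly_decreasing_powser_summable:
  assumes "rapidly_decreasing a" "cmod z \<le> 1"
  shows "summable (\<lambda>k. a k * z ^ k)"
proof (rule summable_comparison_test')
  show "summable (\<lambda>k. cmod (a k))" using rapidly_decreasing_summable[OF assms(1), of 0] by simp
  show "norm (a k * z ^ k) \<le> cmod (a k)" for k
    using assms(2) by (simp add: norm_mult norm_power mult_left_le power_le_one)
qed

text \<open>
Describes the functions in \<open>D_a\<close> by their coefficients instead of their derivatives, so that passing
to \<open>M_z f\<close> is a mere shift.
\<close>

definition has_taylor :: "(complex \<Rightarrow> complex) \<Rightarrow> (nat \<Rightarrow> complex) \<Rightarrow> bool" where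
  "has_taylor f a \<longleftrightarrow> rapidly_decreasing a \<and> (\<forall>z\<in>cball 0 1. (\<lambda>k. a k * z ^ k) sums f z)"

lemma has_taylor_higher_deriv:
  assumes "has_taylor f a" "cmod z < 1"
  shows "(\<lambda>k. (diffs ^^ n) a k * z ^ k) sums (deriv ^^ n) f z"
proof -
  note ra = assms(1)[unfolded has_taylor_def, THEN conjunct1]
  have "(deriv ^^ n) f z = (\<Sum>k. (diffs ^^ n) a k * z ^ k)"
    using assms(2)
  proof (induction n arbitrary: z)
    case 0
    then show ?case using assms(1) by (simp add: has_taylor_def sums_iff)
  next
    case (Suc n)
    have "((\<lambda>z. \<Sum>k. (diffs ^^ n) a k * z ^ k) has_field_derivative
        (\<Sum>k. diffs ((diffs ^^ n) a) k * z ^ k)) (at z)"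
      by (rule termdiffs_strong'[of 1])
        (auto intro!: rapidly_decreasing_powser_summable rapidly_decreasing_funpow_diffs ra Suc.prems)
    moreover have "\<forall>\<^sub>F w in nhds z. w \<in> ball 0 1"
      using Suc.prems by (intro eventually_nhds_in_open) auto
    then have "\<forall>\<^sub>F w in nhds z. (\<Sum>k. (diffs ^^ n) a k * w ^ k) = (deriv ^^ n) f w"
      by eventually_elim (simp add: Suc.IH)
    ultimately have "((deriv ^^ n) f has_field_derivative (\<Sum>k. diffs ((diffs ^^ n) a) k * z ^ k)) (at z)"
      by (subst (asm) DERIV_cong_ev) auto
    then show ?case by (simp add: DERIV_imp_deriv)
  qed
  then show ?thesis
    using rapidly_decreasing_powser_summable[OF rapidly_decreasing_funpow_diffs[OF ra], of z n] assms(2)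
    by (simp add: sums_iff)
qed

lemma fact_mult_power_le_fact_add: "fact k * (1 + real k) ^ N \<le> fact (k + N)"
proof (induction N)
  case (Suc N)
  have "fact k * (1 + real k) ^ Suc N = (1 + real k) * (fact k * (1 + real k) ^ N)" by simp
  also have "\<dots> \<le> real (Suc (k + N)) * fact (k + N)"
    by (intro mult_mono Suc) auto
  finally show ?case by simp
qed simp

text \<open>
The derivative of order \<open>N\<close> is bounded on the disc, so by Cauchy's inequality its coefficients are
bounded; they are those of \<open>f\<close> up to a factor of order \<open>k^N\<close>.
\<close>

lemma D_a_rapidly_decreasing:
  assumes f: "f \<in> D_a"
  shows "rapidly_decreasing (taylor_coeff f)"
  unfolding rapidly_decreasing_def
proof
  fix N
  have hol: "f holomorphic_on ball 0 1" using f by (simp add: D_a_def)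
  obtain g where g: "continuous_on (cball 0 1) g" "\<And>z. z \<in> ball 0 1 \<Longrightarrow> g z = (deriv ^^ N) f z"
    using f unfolding D_a_def by blast
  have holN: "(deriv ^^ N) f holomorphic_on ball 0 1"
    by (intro holomorphic_higher_deriv hol) auto
  then have holg: "g holomorphic_on ball 0 1"
    using g(2) holomorphic_cong by blast
  have "bounded (g ` cball 0 1)"
    by (intro compact_imp_bounded compact_continuous_image g) auto
  then obtain B where B: "\<And>z. z \<in> cball 0 1 \<Longrightarrow> cmod (g z) \<le> B"
    unfolding bounded_iff by blast
  have co: "cmod (taylor_coeff f (k + N)) * (1 + real k) ^ N \<le> B" for k
  proof -
    have "(deriv ^^ k) g 0 = (deriv ^^ k) ((deriv ^^ N) f) 0"
      by (rule higher_deriv_transform_within_open[OF holg holN]) (auto simp: g(2))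
    moreover have "cmod ((deriv ^^ k) g 0) \<le> fact k * B / 1 ^ k"
      by (rule Cauchy_inequality[OF holg g(1)]) (auto intro: B)
    ultimately have "cmod ((deriv ^^ (k + N)) f 0) \<le> fact k * B" by (simp add: funpow_add)
    then have 1: "fact (k + N) * cmod (taylor_coeff f (k + N)) \<le> fact k * B"
      by (simp add: taylor_coeff_def norm_divide)
    have "fact k * (cmod (taylor_coeff f (k + N)) * (1 + real k) ^ N)
        = (fact k * (1 + real k) ^ N) * cmod (taylor_coeff f (k + N))" by simp
    also have "\<dots> \<le> fact (k + N) * cmod (taylor_coeff f (k + N))"
      by (intro mult_right_mono fact_mult_power_le_fact_add) auto
    also note 1
    finally show ?thesis by simp
  qed
  have B0: "0 \<le> B" using B[of 0] order_trans[OF norm_ge_zero[of "g 0"]] by simp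
  define K where "K = (1 + real N) ^ N * B + (\<Sum>j<N. cmod (taylor_coeff f j) * (1 + real j) ^ N)"
  have "cmod (taylor_coeff f j) * (1 + real j) ^ N \<le> K" for j
  proof (cases "j < N")
    case True
    then have "cmod (taylor_coeff f j) * (1 + real j) ^ N \<le> (\<Sum>j<N. cmod (taylor_coeff f j) * (1 + real j) ^ N)"
      by (intro member_le_sum) auto
    then show ?thesis using B0 by (simp add: K_def add_increasing)
  next
    case False
    \<comment> \<open>now \<open>1 + j \<le> (1 + N) (1 + k)\<close>, so the power of \<open>1 + k\<close> controls that of \<open>1 + j\<close>\<close>
    define k where "k = j - N"
    have j: "j = k + N" using False by (simp add: k_def)
    have "1 + real j \<le> (1 + real N) * (1 + real k)" by (simp add: j algebra_simps)
    then have "cmod (taylor_coeff f j) * (1 + real j) ^ N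
        \<le> cmod (taylor_coeff f j) * ((1 + real N) * (1 + real k)) ^ N"
      by (intro mult_left_mono power_mono) auto
    also have "\<dots> = (1 + real N) ^ N * (cmod (taylor_coeff f (k + N)) * (1 + real k) ^ N)"
      by (simp add: power_mult_distrib j)
    also have "\<dots> \<le> (1 + real N) ^ N * B" by (intro mult_left_mono co) auto
    also have "\<dots> \<le> K" by (simp add: K_def sum_nonneg)
    finally show ?thesis .
  qed
  then show "\<exists>B. \<forall>k. cmod (taylor_coeff f k) * (1 + real k) ^ N \<le> B" by blast
qed

text \<open>
On the open disc this is the Taylor expansion; both sides are continuous on the closed disc.
\<close>

lemma D_a_has_taylor:
  assumes f: "f \<in> D_a"
  shows "has_taylor f (taylor_coeff f)"
proof -
  define F where "F = (\<lambda>z. \<Sum>k. taylor_coeff f k * z ^ k)"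
  note ra = D_a_rapidly_decreasing[OF f]
  have hol: "f holomorphic_on ball 0 1" and cont: "continuous_on (cball 0 1) f"
    using f by (auto simp: D_a_def)
  have "uniform_limit (cball 0 1) (\<lambda>n z. \<Sum>k<n. taylor_coeff f k * z ^ k) F sequentially"
    unfolding F_def
  proof (rule Weierstrass_m_test)
    show "summable (\<lambda>k. cmod (taylor_coeff f k))" using rapidly_decreasing_summable[OF ra, of 0] by simp
    show "norm (taylor_coeff f k * z ^ k) \<le> cmod (taylor_coeff f k)" if "z \<in> cball 0 1" for k z
      using that by (simp add: norm_mult norm_power mult_left_le power_le_one)
  qed
  then have contF: "continuous_on (cball 0 1) F"
    by (rule uniform_limit_theorem[rotated]) (auto intro!: always_eventually continuous_intros)
  have eq: "F z - f z = 0" if "z \<in> ball 0 1" for z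
    using holomorphic_power_series[OF hol that] by (simp add: F_def taylor_coeff_def sums_iff)
  have "F z - f z = 0" if "z \<in> cball 0 1" for z
    by (rule continuous_constant_on_closure[of "ball 0 1"])
      (use that eq contF cont in \<open>auto intro!: continuous_intros\<close>)
  then show ?thesis
    using ra rapidly_decreasing_powser_summable[OF ra]
    by (auto simp: has_taylor_def F_def sums_iff)
qed

lemma has_taylor_M_z:
  assumes "has_taylor f a"
  shows "has_taylor (M_z f) (case_nat 0 a)"
  unfolding has_taylor_def
proof (intro conjI ballI)
  show "rapidly_decreasing (case_nat 0 a)"
    using assms rapidly_decreasing_case_nat by (auto simp: has_taylor_def)
  fix z :: complex assume "z \<in> cball 0 1"
  then have "(\<lambda>k. z * (a k * z ^ k)) sums (z * f z)"
    using assms by (intro sums_mult) (auto simp: has_taylor_def)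
  then have "(\<lambda>k. case_nat 0 a (Suc k) * z ^ Suc k) sums (z * f z)"
    by (simp add: mult_ac)
  from sums_Suc[OF this] show "(\<lambda>k. case_nat 0 a k * z ^ k) sums M_z f z"
    by (simp add: M_z_def)
qed

lemma polynomial_in_D_a: "(\<lambda>z. \<Sum>k<N. a k * z ^ k) \<in> D_a"
proof -
  have hol: "(\<lambda>z. \<Sum>k<N. a k * z ^ k) holomorphic_on UNIV"
    by (intro holomorphic_intros)
  have "continuous_on (cball 0 1) ((deriv ^^ n) (\<lambda>z. \<Sum>k<N. a k * z ^ k))" for n
    using holomorphic_higher_deriv[OF hol open_UNIV, of n] holomorphic_on_imp_continuous_on
      continuous_on_subset by blast
  then show ?thesis
    unfolding D_a_def using hol holomorphic_on_subset
    by (auto intro!: continuous_intros)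
qed

lemma has_taylor_polynomial:
  "has_taylor (\<lambda>z. \<Sum>k<N. a k * z ^ k) (\<lambda>k. if k < N then a k else 0)"
proof -
  have "(\<lambda>k. (if k < N then a k else 0) * z ^ k) sums (\<Sum>k<N. a k * z ^ k)" for z
  proof -
    have "(\<lambda>k. (if k < N then a k else 0) * z ^ k) sums (\<Sum>k<N. (if k < N then a k else 0) * z ^ k)"
      by (rule sums_finite) auto
    then show ?thesis by simp
  qed
  then show ?thesis
    unfolding has_taylor_def by (auto intro!: rapidly_decreasing_finite_support[of N])
qed

section \<open>Finite sections and their decomposition into shells\<close>

text \<open>
The form \<open>D_{\<mu>,n}\<close> with \<open>u = fourier \<mu>\<close> on the polynomial \<open>\<Sum>k<N. a k * z^k\<close>; compare
\<open>dirichlet_eq_form\<close>. A general symbol \<open>u\<close> is allowed so that multiples of the symbol of arc length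
can be subtracted.
\<close>

definition gram :: "(int \<Rightarrow> complex) \<Rightarrow> nat \<Rightarrow> (nat \<Rightarrow> complex) \<Rightarrow> nat \<Rightarrow> complex" where
  "gram u n a N = (\<Sum>k<N. \<Sum>l<N. of_nat (min k l choose n) * a k * cnj (a l) * u (int l - int k))"

text \<open>
The pairs with maximum \<open>i\<close>. In the integral over a disc of radius \<open>r\<close> the entry at \<open>(k, l)\<close> acquires a
factor that depends on \<open>r\<close> and \<open>max k l\<close> only, hence summation by shells reduces the limit
\<open>r \<rightarrow> 1\<close> to a single series.
\<close>

definition shell :: "nat \<Rightarrow> (nat \<times> nat) set" where
  "shell i = ({i} \<times> {..i}) \<union> ({..<i} \<times> {i})"

lemma finite_shell [simp]: "finite (shell i)" by (simp add: shell_def)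

lemma max_shell: "p \<in> shell i \<Longrightarrow> max (fst p) (snd p) = i" by (auto simp: shell_def)

lemma sum_square_shells:
  "(\<Sum>k<N. \<Sum>l<N. g k l) = (\<Sum>i<N. \<Sum>(k,l)\<in>shell i. g k l :: complex)"
proof (induction N)
  case (Suc N)
  have "(\<Sum>(k,l)\<in>shell N. g k l) = (\<Sum>l\<le>N. g N l) + (\<Sum>k<N. g k N)"
    unfolding shell_def
    by (subst sum.union_disjoint) (auto simp: sum.cartesian_product[symmetric])
  then show ?case
    by (simp add: sum.distrib Suc[symmetric] lessThan_Suc_atMost[symmetric])
qed simp

lemma shell_weight_bound:
  assumes G: "\<And>N. (\<Sum>l<N. cmod (a l)) \<le> G"
  shows "(\<Sum>(k,l)\<in>shell i. cmod (a k) * cmod (a l)) \<le> 2 * G * cmod (a i)"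
proof -
  have "(\<Sum>(k,l)\<in>shell i. cmod (a k) * cmod (a l))
      = cmod (a i) * (\<Sum>l<Suc i. cmod (a l)) + cmod (a i) * (\<Sum>k<i. cmod (a k))"
    unfolding shell_def
    by (subst sum.union_disjoint)
      (auto simp: sum.cartesian_product[symmetric] sum_distrib_left mult_ac lessThan_Suc_atMost[symmetric]
        simp del: sum.lessThan_Suc)
  also have "\<dots> \<le> cmod (a i) * G + cmod (a i) * G"
    by (intro add_mono mult_left_mono G) auto
  finally show ?thesis by simp
qed

lemma shell_majorant:
  assumes a: "rapidly_decreasing a"
  obtains M where "summable M" "\<And>i. (\<Sum>(k,l)\<in>shell i. cmod (a k) * cmod (a l)) * (1 + real i) ^ N \<le> M i"
proof -
  define G where "G = (\<Sum>l. cmod (a l))"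
  have s: "summable (\<lambda>l. cmod (a l))" using rapidly_decreasing_summable[OF a, of 0] by simp
  have G: "(\<Sum>l<N. cmod (a l)) \<le> G" for N
    unfolding G_def by (intro sum_le_suminf s) auto
  have "summable (\<lambda>i. 2 * G * (cmod (a i) * (1 + real i) ^ N))"
    by (intro summable_mult rapidly_decreasing_summable a)
  moreover have "(\<Sum>(k,l)\<in>shell i. cmod (a k) * cmod (a l)) * (1 + real i) ^ N \<le> 2 * G * (cmod (a i) * (1 + real i) ^ N)" for i
    using mult_right_mono[OF shell_weight_bound[OF G, of i], of "(1 + real i) ^ N"] by (simp add: mult_ac)
  ultimately show ?thesis by (rule that)
qed

section \<open>The distribution applied to the squared modulus\<close>

lemma
  assumes "finite A" "\<And>x. x \<in> A \<Longrightarrow> smooth_circle (p x)"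
  shows smooth_circle_sum: "smooth_circle (\<lambda>z. \<Sum>x\<in>A. c x * p x z)"
    and circle_deriv_sum: "circle_deriv j (\<lambda>z. \<Sum>x\<in>A. c x * p x z) = (\<lambda>t. \<Sum>x\<in>A. c x * circle_deriv j (p x) t)"
    and dapply_sum: "dapply \<mu> (\<lambda>z. \<Sum>x\<in>A. c x * p x z) = (\<Sum>x\<in>A. c x * dapply \<mu> (p x))"
proof -
  have "smooth_circle (\<lambda>z. \<Sum>x\<in>A. c x * p x z) \<and>
    circle_deriv j (\<lambda>z. \<Sum>x\<in>A. c x * p x z) = (\<lambda>t. \<Sum>x\<in>A. c x * circle_deriv j (p x) t) \<and>
    dapply \<mu> (\<lambda>z. \<Sum>x\<in>A. c x * p x z) = (\<Sum>x\<in>A. c x * dapply \<mu> (p x))"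
    using assms
  proof (induction A)
    case empty
    have 0: "smooth_circle (\<lambda>z. 0)" using trig_smooth[OF trig_const[of 0]] .
    have "circle_deriv j (\<lambda>z. 0) = (\<lambda>t. 0)" using smooth_circle_lincomb(2)[OF 0 0, of j 0 0] by simp
    moreover have "dapply \<mu> (\<lambda>z. 0) = 0" using dapply_lincomb[OF 0 0, of \<mu> 0 0] by simp
    ultimately show ?case using 0 by simp
  next
    case (insert y A)
    then have y: "smooth_circle (p y)" and A: "smooth_circle (\<lambda>z. \<Sum>x\<in>A. c x * p x z)" by auto
    show ?case
      using smooth_circle_lincomb(1)[OF y A, of "c y" 1]
        smooth_circle_lincomb(2)[OF y A, of j "c y" 1] dapply_lincomb[OF y A, of \<mu> "c y" 1] insert
      by simp
  qed
  then show "smooth_circle (\<lambda>z. \<Sum>x\<in>A. c x * p x z)"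
    "circle_deriv j (\<lambda>z. \<Sum>x\<in>A. c x * p x z) = (\<lambda>t. \<Sum>x\<in>A. c x * circle_deriv j (p x) t)"
    "dapply \<mu> (\<lambda>z. \<Sum>x\<in>A. c x * p x z) = (\<Sum>x\<in>A. c x * dapply \<mu> (p x))" by blast+
qed

text \<open>
Differentiation of the series term by term; the majorants make every differentiated series converge
uniformly.
\<close>

lemma
  assumes p: "\<And>i. smooth_circle (p i)"
    and M: "\<And>j. summable (M j)" "\<And>j i t. cmod (circle_deriv j (p i) t) \<le> M j i"
    and h: "\<And>t. (\<lambda>i. p i (cis t)) sums h (cis t)"
  shows smooth_circle_series: "smooth_circle h"
    and circle_deriv_series: "circle_deriv j h = (\<lambda>t. \<Sum>i. circle_deriv j (p i) t)"
proof -
  define F where "F = (\<lambda>j t. \<Sum>i. circle_deriv j (p i) t)"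
  have sm: "summable (\<lambda>i. circle_deriv j (p i) t)" for j t
    by (rule summable_comparison_test'[OF M(1)]) (rule M(2))
  have F0: "F 0 t = h (cis t)" for t
    using h[of t] by (simp add: F_def sums_iff)
  have FS: "(F j has_vector_derivative F (Suc j) t) (at t)" for j t
  proof -
    have lim: "uniform_limit UNIV (\<lambda>n t. \<Sum>i<n. circle_deriv (Suc j) (p i) t) (F (Suc j)) sequentially"
      unfolding F_def by (rule Weierstrass_m_test[OF M(2) M(1)])
    have "\<exists>g. \<forall>x\<in>UNIV. (\<lambda>i. circle_deriv j (p i) x) sums g x \<and>
        (g has_derivative (\<lambda>h. h *\<^sub>R F (Suc j) x)) (at x within UNIV)"
    proof (rule has_derivative_series[where f' = "\<lambda>i x h. h *\<^sub>R circle_deriv (Suc j) (p i) x"])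
      show "(circle_deriv j (p i) has_derivative (\<lambda>h. h *\<^sub>R circle_deriv (Suc j) (p i) x)) (at x within UNIV)" for i x
        using smooth_circle_has_deriv[OF p, of j i x] by (simp add: has_vector_derivative_def)
      show "\<forall>\<^sub>F n in sequentially. \<forall>x\<in>UNIV. \<forall>h. norm ((\<Sum>i<n. h *\<^sub>R circle_deriv (Suc j) (p i) x) - h *\<^sub>R F (Suc j) x) \<le> e * norm h"
        if e: "e > 0" for e
        using uniform_limitD[OF lim e]
      proof eventually_elim
        case (elim n)
        show ?case
        proof (intro ballI allI)
          fix x h
          have "norm (h *\<^sub>R ((\<Sum>i<n. circle_deriv (Suc j) (p i) x) - F (Suc j) x)) \<le> norm h * e"
            unfolding norm_scaleR real_norm_def using elim by (intro mult_left_mono) (auto simp: dist_norm less_imp_le)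
          then show "norm ((\<Sum>i<n. h *\<^sub>R circle_deriv (Suc j) (p i) x) - h *\<^sub>R F (Suc j) x) \<le> e * norm h"
            by (simp add: scaleR_sum_right scaleR_diff_right mult.commute)
        qed
      qed
      show "(\<lambda>i. circle_deriv j (p i) 0) sums F j 0" unfolding F_def by (rule summable_sums[OF sm])
    qed auto
    then obtain g where g: "\<And>x. (\<lambda>i. circle_deriv j (p i) x) sums g x"
      "\<And>x. (g has_derivative (\<lambda>h. h *\<^sub>R F (Suc j) x)) (at x)" by auto
    have "g = F j" using g(1) by (auto simp: F_def sums_iff)
    then show ?thesis using g(2) by (simp add: has_vector_derivative_def)
  qed
  show "smooth_circle h" by (rule smooth_circleI(1)[OF F0 FS])
  show "circle_deriv j h = (\<lambda>t. \<Sum>i. circle_deriv j (p i) t)"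
    using smooth_circleI(2)[OF F0 FS, of j] by (simp add: F_def)
qed

text \<open>
The remainders of the series tend to \<open>0\<close> together with all their derivatives, uniformly on the
circle, and a distribution is bounded by finitely many of these suprema.
\<close>

lemma dapply_series:
  assumes p: "\<And>i. smooth_circle (p i)"
    and M: "\<And>j. summable (M j)" "\<And>j i t. cmod (circle_deriv j (p i) t) \<le> M j i"
    and h: "\<And>t. (\<lambda>i. p i (cis t)) sums h (cis t)"
  shows "(\<lambda>i. dapply \<mu> (p i)) sums dapply \<mu> h"
proof -
  define P where "P = (\<lambda>N z. \<Sum>i<N. p i z)"
  define R where "R = (\<lambda>N z. h z - P N z)"
  have smP: "smooth_circle (P N)" and dP: "dapply \<mu> (P N) = (\<Sum>i<N. dapply \<mu> (p i))" for N
    using smooth_circle_sum[of "{..<N}" p "\<lambda>_. 1"] dapply_sum[of "{..<N}" p \<mu> "\<lambda>_. 1"] p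
    by (simp_all add: P_def)
  have smh: "smooth_circle h" by (rule smooth_circle_series[OF p M h])
  obtain L C where LC: "\<And>f B. smooth_circle f \<Longrightarrow>
      (\<And>n t. n \<le> L \<Longrightarrow> cmod (circle_deriv n f t) \<le> B) \<Longrightarrow> cmod (dapply \<mu> f) \<le> C * B"
    using dapply_bound[of \<mu>] by blast
  have M0: "0 \<le> M j i" for j i by (rule order_trans[OF norm_ge_zero M(2)[of j i 0]])
  define T where "T = (\<lambda>N. \<Sum>j\<le>L. \<Sum>i. M j (i + N))"
  have sh: "summable (\<lambda>i. M j (i + N))" for j N using M(1) by (subst summable_iff_shift)
  have R: "smooth_circle (R N)" "cmod (circle_deriv j (R N) t) \<le> (\<Sum>i. M j (i + N))" for N j t
  proof -
    have hs: "(\<lambda>i. p (i + N) (cis t)) sums R N (cis t)" for t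
      unfolding R_def P_def by (rule sums_split_initial_segment[OF h])
    note R = smooth_circle_series[of "\<lambda>i. p (i + N)" "\<lambda>j i. M j (i + N)", OF p sh M(2) hs]
      circle_deriv_series[of "\<lambda>i. p (i + N)" "\<lambda>j i. M j (i + N)", OF p sh M(2) hs]
    show "smooth_circle (R N)" by (rule R)
    show "cmod (circle_deriv j (R N) t) \<le> (\<Sum>i. M j (i + N))"
      unfolding R(2) by (rule norm_suminf_le[OF M(2) sh])
  qed
  have "cmod (circle_deriv j (R N) t) \<le> T N" if "j \<le> L" for j N t
  proof -
    note R(2)[of j N t]
    also have "(\<Sum>i. M j (i + N)) \<le> T N"
      unfolding T_def using that by (intro member_le_sum) (auto intro!: suminf_nonneg sh M0)
    finally show ?thesis .
  qed
  then have bd: "cmod (dapply \<mu> (R N)) \<le> C * T N" for N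
    by (intro LC R(1))
  have "(\<lambda>N. \<Sum>i. M j (i + N)) \<longlonglongrightarrow> 0" for j
  proof -
    have "(\<lambda>N. (\<Sum>i. M j i) - (\<Sum>i<N. M j i)) \<longlonglongrightarrow> (\<Sum>i. M j i) - (\<Sum>i. M j i)"
      by (intro tendsto_intros summable_LIMSEQ M)
    then show ?thesis by (simp add: suminf_minus_initial_segment[OF M(1)])
  qed
  then have "(\<lambda>N. C * T N) \<longlonglongrightarrow> C * (\<Sum>j\<le>L. 0)"
    unfolding T_def by (intro tendsto_intros)
  then have "(\<lambda>N. dapply \<mu> (R N)) \<longlonglongrightarrow> 0"
    by (intro Lim_null_comparison[of "\<lambda>N. dapply \<mu> (R N)" "\<lambda>N. C * T N"] always_eventually allI bd) simp
  moreover have "dapply \<mu> (R N) = dapply \<mu> h - (\<Sum>i<N. dapply \<mu> (p i))" for N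
    using dapply_lincomb[OF smh smP, of \<mu> 1 "-1"] by (simp add: R_def dP)
  ultimately have "(\<lambda>N. dapply \<mu> h - (dapply \<mu> h - (\<Sum>i<N. dapply \<mu> (p i)))) \<longlonglongrightarrow> dapply \<mu> h - 0"
    by (intro tendsto_intros) simp
  then show ?thesis by (simp add: sums_def)
qed

lemma cis_power_mult_cnj: "cis t ^ k * cnj (cis t) ^ l = cis t powi (int k - int l)"
  by (simp add: cis_cnj Complex.DeMoivre cis_power_int cis_mult algebra_simps)

text \<open>
Expanding \<open>\<bar>f\<bar>\<^sup>2\<close> on the circle by shells gives a series of trigonometric polynomials whose derivatives
of every order are absolutely and uniformly summable.
\<close>

lemma
  assumes f: "has_taylor f a"
  shows smooth_circle_cmod_square: "smooth_circle (\<lambda>z. of_real ((cmod (f z))\<^sup>2))"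
    and dapply_cmod_square: "gram (fourier \<mu>) 0 a \<longlonglongrightarrow> dapply \<mu> (\<lambda>z. of_real ((cmod (f z))\<^sup>2))"
proof -
  have ra: "rapidly_decreasing a" using f by (simp add: has_taylor_def)
  define p where "p = (\<lambda>i z. \<Sum>x\<in>shell i. (a (fst x) * cnj (a (snd x))) * z powi (int (fst x) - int (snd x)))"
  have smp: "smooth_circle (p i)" for i
    unfolding p_def by (intro smooth_circle_sum smooth_circle_powi) auto
  have "\<exists>M. summable M \<and> (\<forall>i t. cmod (circle_deriv j (p i) t) \<le> M i)" for j
  proof -
    obtain M where M: "summable M" "\<And>i. (\<Sum>(k,l)\<in>shell i. cmod (a k) * cmod (a l)) * (1 + real i) ^ j \<le> M i"
      using shell_majorant[OF ra] by blast
    have "cmod (circle_deriv j (p i) t) \<le> M i" for i t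
    proof -
      have "cmod (circle_deriv j (p i) t)
          = cmod (\<Sum>x\<in>shell i. (a (fst x) * cnj (a (snd x))) *
              ((\<i> * of_int (int (fst x) - int (snd x))) ^ j * cis (of_int (int (fst x) - int (snd x)) * t)))"
        unfolding p_def by (subst circle_deriv_sum) (auto simp: smooth_circle_powi circle_deriv_powi)
      also have "\<dots> \<le> (\<Sum>x\<in>shell i. (cmod (a (fst x)) * cmod (a (snd x))) * (1 + real i) ^ j)"
      proof (rule sum_norm_le)
        fix x assume "x \<in> shell i"
        then have "max (fst x) (snd x) = i" by (rule max_shell)
        then have "cmod (of_int (int (fst x) - int (snd x))) \<le> 1 + real i"
          unfolding norm_of_int by linarith
        then have "cmod (of_int (int (fst x) - int (snd x))) ^ j \<le> (1 + real i) ^ j"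
          by (intro power_mono) auto
        then show "cmod ((a (fst x) * cnj (a (snd x))) *
              ((\<i> * of_int (int (fst x) - int (snd x))) ^ j * cis (of_int (int (fst x) - int (snd x)) * t)))
            \<le> (cmod (a (fst x)) * cmod (a (snd x))) * (1 + real i) ^ j"
          by (simp add: norm_mult norm_power mult_left_mono)
      qed
      also have "\<dots> \<le> M i"
        using M(2)[of i] by (simp add: sum_distrib_right case_prod_beta)
      finally show ?thesis .
    qed
    then show ?thesis using M(1) by blast
  qed
  then obtain M where M: "\<And>j. summable (M j)" "\<And>j i t. cmod (circle_deriv j (p i) t) \<le> M j i"
    by metis
  have h: "(\<lambda>i. p i (cis t)) sums of_real ((cmod (f (cis t)))\<^sup>2)" for t
  proof -
    define s where "s = (\<lambda>N. \<Sum>k<N. a k * cis t ^ k)"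
    have "s \<longlonglongrightarrow> f (cis t)"
      using f by (auto simp: has_taylor_def sums_def s_def)
    then have "(\<lambda>N. s N * cnj (s N)) \<longlonglongrightarrow> f (cis t) * cnj (f (cis t))"
      by (intro tendsto_intros)
    moreover have "s N * cnj (s N) = (\<Sum>i<N. p i (cis t))" for N
    proof -
      have "s N * cnj (s N) = (\<Sum>k<N. \<Sum>l<N. (a k * cnj (a l)) * (cis t ^ k * cnj (cis t) ^ l))"
        by (simp add: s_def sum_product mult_ac)
      then show ?thesis
        unfolding cis_power_mult_cnj sum_square_shells p_def by (simp add: case_prod_beta)
    qed
    ultimately show ?thesis unfolding sums_def complex_norm_square by simp
  qed
  show "smooth_circle (\<lambda>z. of_real ((cmod (f z))\<^sup>2))"
    by (rule smooth_circle_series[OF smp M h])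
  have "(\<lambda>i. dapply \<mu> (p i)) sums dapply \<mu> (\<lambda>z. of_real ((cmod (f z))\<^sup>2))"
    by (rule dapply_series[OF smp M h])
  moreover have "(\<Sum>i<N. dapply \<mu> (p i)) = gram (fourier \<mu>) 0 a N" for N
  proof -
    have "dapply \<mu> (p i) = (\<Sum>(k,l)\<in>shell i. of_nat (min k l choose 0) * a k * cnj (a l) * fourier \<mu> (int l - int k))" for i
      unfolding p_def by (subst dapply_sum) (auto simp: smooth_circle_powi fourier_def case_prod_beta)
    then show ?thesis unfolding gram_def sum_square_shells by simp
  qed
  ultimately show "gram (fourier \<mu>) 0 a \<longlonglongrightarrow> dapply \<mu> (\<lambda>z. of_real ((cmod (f z))\<^sup>2))"
    by (simp add: sums_def)
qed

section \<open>Convergence of the Dirichlet forms\<close>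

definition poly_growth :: "(int \<Rightarrow> complex) \<Rightarrow> bool" where
  "poly_growth u \<longleftrightarrow> (\<exists>N C. 0 \<le> C \<and> (\<forall>k. cmod (u k) \<le> C * (1 + \<bar>real_of_int k\<bar>) ^ N))"

lemma poly_growth_fourier: "poly_growth (fourier \<mu>)"
  unfolding poly_growth_def by (rule fourier_growth)

definition gram_shell :: "(int \<Rightarrow> complex) \<Rightarrow> nat \<Rightarrow> (nat \<Rightarrow> complex) \<Rightarrow> nat \<Rightarrow> complex" where
  "gram_shell u n a i = (\<Sum>(k,l)\<in>shell i. of_nat (min k l choose n) * a k * cnj (a l) * u (int l - int k))"

lemma gram_eq_sum_shells: "gram u n a N = (\<Sum>i<N. gram_shell u n a i)"
  unfolding gram_def gram_shell_def by (rule sum_square_shells)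

lemma binomial_le_power_real: "real (l choose n) \<le> (1 + real l) ^ n"
proof -
  have "(l choose n) * 1 \<le> (l choose n) * fact n" by (intro mult_left_mono) auto
  also have "\<dots> \<le> l ^ n" by (rule binomial_fact_pow)
  finally have "real (l choose n) \<le> real l ^ n" by (simp flip: of_nat_power)
  also have "\<dots> \<le> (1 + real l) ^ n" by (intro power_mono) auto
  finally show ?thesis .
qed

text \<open>
Polynomial growth of \<open>u\<close> and of the binomial coefficient is absorbed by the rapid decrease of \<open>a\<close>.
\<close>

lemma gram_shell_abs_summable:
  assumes u: "poly_growth u" and a: "rapidly_decreasing a"
  shows "summable (\<lambda>i. cmod (gram_shell u n a i))"
proof -
  obtain N C where C: "0 \<le> C" and NC: "\<And>k. cmod (u k) \<le> C * (1 + \<bar>real_of_int k\<bar>) ^ N"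
    using u unfolding poly_growth_def by blast
  obtain M where M: "summable M"
    "\<And>i. (\<Sum>(k,l)\<in>shell i. cmod (a k) * cmod (a l)) * (1 + real i) ^ (n + N) \<le> M i"
    using shell_majorant[OF a] by blast
  have "cmod (gram_shell u n a i) \<le> C * M i" for i
  proof -
    have "cmod (gram_shell u n a i)
        \<le> (\<Sum>x\<in>shell i. C * ((cmod (a (fst x)) * cmod (a (snd x))) * (1 + real i) ^ (n + N)))"
      unfolding gram_shell_def case_prod_beta
    proof (rule sum_norm_le)
      fix x assume "x \<in> shell i"
      then have m: "max (fst x) (snd x) = i" by (rule max_shell)
      have "real (min (fst x) (snd x) choose n) \<le> (1 + real (min (fst x) (snd x))) ^ n"
        by (rule binomial_le_power_real)
      also have "\<dots> \<le> (1 + real i) ^ n" using m by (intro power_mono) auto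
      finally have 1: "real (min (fst x) (snd x) choose n) \<le> (1 + real i) ^ n" .
      have "cmod (u (int (snd x) - int (fst x))) \<le> C * (1 + \<bar>real_of_int (int (snd x) - int (fst x))\<bar>) ^ N"
        by (rule NC)
      also have "\<dots> \<le> C * (1 + real i) ^ N"
        using m C by (intro mult_left_mono power_mono) auto
      finally have 2: "cmod (u (int (snd x) - int (fst x))) \<le> C * (1 + real i) ^ N" .
      have "real (min (fst x) (snd x) choose n) * cmod (u (int (snd x) - int (fst x)))
          \<le> (1 + real i) ^ n * (C * (1 + real i) ^ N)"
        by (rule mult_mono[OF 1 2]) auto
      then have "(cmod (a (fst x)) * cmod (a (snd x))) *
          (real (min (fst x) (snd x) choose n) * cmod (u (int (snd x) - int (fst x))))
          \<le> (cmod (a (fst x)) * cmod (a (snd x))) * ((1 + real i) ^ n * (C * (1 + real i) ^ N))"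
        by (rule mult_left_mono) auto
      then show "cmod (of_nat (min (fst x) (snd x) choose n) * a (fst x) * cnj (a (snd x)) *
            u (int (snd x) - int (fst x)))
          \<le> C * ((cmod (a (fst x)) * cmod (a (snd x))) * (1 + real i) ^ (n + N))"
        by (simp add: norm_mult power_add mult_ac)
    qed
    also have "\<dots> = C * ((\<Sum>(k,l)\<in>shell i. cmod (a k) * cmod (a l)) * (1 + real i) ^ (n + N))"
      by (simp add: sum_distrib_left sum_distrib_right case_prod_beta)
    also have "\<dots> \<le> C * M i" by (intro mult_left_mono M C)
    finally show ?thesis .
  qed
  then show ?thesis
    by (intro summable_comparison_test'[OF summable_mult[OF M(1), of C]]) auto
qed

definition dirichlet_form :: "(int \<Rightarrow> complex) \<Rightarrow> nat \<Rightarrow> (nat \<Rightarrow> complex) \<Rightarrow> complex" where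
  "dirichlet_form u n a = lim (gram u n a)"

lemma
  assumes "poly_growth u" "rapidly_decreasing a"
  shows gram_tendsto: "gram u n a \<longlonglongrightarrow> dirichlet_form u n a"
    and dirichlet_form_eq_suminf: "dirichlet_form u n a = (\<Sum>i. gram_shell u n a i)"
proof -
  have "summable (gram_shell u n a)"
    by (rule summable_norm_cancel[OF gram_shell_abs_summable[OF assms]])
  then have "gram u n a \<longlonglongrightarrow> (\<Sum>i. gram_shell u n a i)"
    unfolding gram_eq_sum_shells[abs_def] by (rule summable_LIMSEQ)
  then show "gram u n a \<longlonglongrightarrow> dirichlet_form u n a" "dirichlet_form u n a = (\<Sum>i. gram_shell u n a i)"
    by (simp_all add: dirichlet_form_def limI)
qed

section \<open>Dirichlet integrals over smaller discs\<close>

text \<open>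
By induction on \<open>N\<close>: formal differentiation of a power series preserves convergence inside the disc
and multiplies the coefficients by a factor of order \<open>k\<close>.
\<close>

lemma summable_power_times_geometric:
  assumes "0 \<le> r" "r < (1::real)"
  shows "summable (\<lambda>k. (1 + real k) ^ N * r ^ k)"
proof -
  have "summable (\<lambda>k. (1 + real k) ^ N * x ^ k)" if "norm x < 1" for x
    using that
  proof (induction N arbitrary: x)
    case 0
    then show ?case by (simp add: summable_geometric)
  next
    case (Suc N)
    have "summable (\<lambda>k. diffs (\<lambda>k. (1 + real k) ^ N) k * norm x ^ k)"
      using Suc by (intro termdiff_converges[of _ 1]) auto
    then show ?case
    proof (rule summable_comparison_test')
      fix k
      have "norm ((1 + real k) ^ Suc N * x ^ k) = (1 + real k) * (1 + real k) ^ N * norm x ^ k"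
        by (simp add: abs_mult power_abs)
      also have "\<dots> \<le> (1 + real k) * (1 + real (Suc k)) ^ N * norm x ^ k"
        by (intro mult_left_mono mult_right_mono power_mono) auto
      also have "\<dots> = diffs (\<lambda>k. (1 + real k) ^ N) k * norm x ^ k"
        by (simp add: diffs_def add.commute)
      finally show "norm ((1 + real k) ^ Suc N * x ^ k) \<le> diffs (\<lambda>k. (1 + real k) ^ N) k * norm x ^ k" .
    qed
  qed
  then show ?thesis using assms by simp
qed

definition poisson_series :: "(int \<Rightarrow> complex) \<Rightarrow> complex \<Rightarrow> complex" where
  "poisson_series u z = (\<Sum>k. u (int k) * z ^ k) + (\<Sum>k. u (- int (Suc k)) * cnj z ^ Suc k)"

lemma poisson_eq_series: "poisson \<mu> = poisson_series (fourier \<mu>)"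
  by (simp add: fun_eq_iff poisson_def poisson_series_def)

definition poisson_partial :: "(int \<Rightarrow> complex) \<Rightarrow> nat \<Rightarrow> complex \<Rightarrow> complex" where
  "poisson_partial u N z = (\<Sum>k<N. u (int k) * z ^ k) + (\<Sum>k<N. u (- int (Suc k)) * cnj z ^ Suc k)"

lemma poisson_partial_alt:
  "poisson_partial u N z = (\<Sum>j\<in>{- int N..<int N}. u j * (z ^ nat j * cnj z ^ nat (- j)))"
proof (induction N)
  case (Suc N)
  have "{- int (Suc N)..<int (Suc N)} = insert (- int (Suc N)) (insert (int N) {- int N..<int N})"
    by auto
  then have "(\<Sum>j\<in>{- int (Suc N)..<int (Suc N)}. u j * (z ^ nat j * cnj z ^ nat (- j)))
      = u (- int (Suc N)) * cnj z ^ Suc N + (u (int N) * z ^ N + poisson_partial u N z)"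
    by (simp add: Suc[symmetric] del: of_nat_Suc power_Suc)
  then show ?case by (simp add: poisson_partial_def algebra_simps del: of_nat_Suc power_Suc)
qed (simp add: poisson_partial_def)

lemma
  assumes u: "poly_growth u" and r: "0 \<le> r" "r < 1"
  shows poisson_partial_tendsto: "cmod z \<le> r \<Longrightarrow> (\<lambda>N. poisson_partial u N z) \<longlonglongrightarrow> poisson_series u z"
    and poisson_partial_bounded: "\<exists>H. \<forall>N z. cmod z \<le> r \<longrightarrow> cmod (poisson_partial u N z) \<le> H"
proof -
  obtain D C where C: "0 \<le> C" and NC: "\<And>k. cmod (u k) \<le> C * (1 + \<bar>real_of_int k\<bar>) ^ D"
    using u unfolding poly_growth_def by blast
  define M where "M = (\<lambda>k. C * ((1 + real k) ^ D * r ^ k))"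
  have M: "summable M" unfolding M_def by (intro summable_mult summable_power_times_geometric r)
  have M0: "0 \<le> M k" for k using C r by (simp add: M_def)
  have b1: "norm (u (int k) * z ^ k) \<le> M k" if "cmod z \<le> r" for k z
  proof -
    have "cmod (u (int k)) * cmod z ^ k \<le> (C * (1 + real k) ^ D) * r ^ k"
      using NC[of "int k"] that C r by (intro mult_mono power_mono) auto
    then show ?thesis by (simp add: M_def norm_mult norm_power mult_ac)
  qed
  have b2: "norm (u (- int (Suc k)) * cnj z ^ Suc k) \<le> M (Suc k)" if "cmod z \<le> r" for k z
  proof -
    have "cmod (u (- int (Suc k))) * cmod z ^ Suc k \<le> (C * (1 + real (Suc k)) ^ D) * r ^ Suc k"
      using NC[of "- int (Suc k)"] that C r by (intro mult_mono power_mono) auto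
    then show ?thesis by (simp add: M_def norm_mult norm_power mult_ac)
  qed
  have MS: "summable (\<lambda>k. M (Suc k))" using M by (subst summable_Suc_iff)
  show "(\<lambda>N. poisson_partial u N z) \<longlonglongrightarrow> poisson_series u z" if "cmod z \<le> r"
    unfolding poisson_partial_def poisson_series_def
    by (intro tendsto_add summable_LIMSEQ summable_comparison_test'[OF M b1[OF that]]
        summable_comparison_test'[OF MS b2[OF that]])
  have "cmod (poisson_partial u N z) \<le> suminf M + (\<Sum>k. M (Suc k))" if "cmod z \<le> r" for N z
  proof -
    have "cmod (\<Sum>k<N. u (int k) * z ^ k) \<le> (\<Sum>k<N. M k)" by (intro sum_norm_le b1 that)
    also have "\<dots> \<le> suminf M" by (intro sum_le_suminf M) (auto simp: M0)
    finally have 1: "cmod (\<Sum>k<N. u (int k) * z ^ k) \<le> suminf M" .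
    have "cmod (\<Sum>k<N. u (- int (Suc k)) * cnj z ^ Suc k) \<le> (\<Sum>k<N. M (Suc k))"
      by (intro sum_norm_le b2 that)
    also have "\<dots> \<le> (\<Sum>k. M (Suc k))" by (intro sum_le_suminf MS) (auto simp: M0)
    finally show ?thesis unfolding poisson_partial_def using 1 by (intro norm_triangle_le) linarith
  qed
  then show "\<exists>H. \<forall>N z. cmod z \<le> r \<longrightarrow> cmod (poisson_partial u N z) \<le> H" by blast
qed

lemma set_integral_lincomb:
  fixes g :: "'x \<Rightarrow> 'b \<Rightarrow> complex"
  assumes "\<And>x. x \<in> A \<Longrightarrow> set_integrable M S (g x)"
  shows "(LINT z:S|M. \<Sum>x\<in>A. c x * g x z) = (\<Sum>x\<in>A. c x * (LINT z:S|M. g x z))"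
proof -
  have "(LINT z:S|M. \<Sum>x\<in>A. c x * g x z) = (LINT z|M. (\<Sum>x\<in>A. c x * (indicator S z *\<^sub>R g x z)))"
    unfolding set_lebesgue_integral_def by (simp add: scaleR_sum_right)
  also have "\<dots> = (\<Sum>x\<in>A. (LINT z|M. c x * (indicator S z *\<^sub>R g x z)))"
    using assms unfolding set_integrable_def
    by (intro Bochner_Integration.integral_sum integrable_mult_right) auto
  also have "\<dots> = (\<Sum>x\<in>A. c x * (LINT z|M. indicator S z *\<^sub>R g x z))"
    using assms unfolding set_integrable_def
    by (intro sum.cong refl Bochner_Integration.integral_mult_right) auto
  finally show ?thesis by (simp add: set_lebesgue_integral_def)
qed

text \<open>
After expansion of the three finite sums, orthogonality of the monomials selects \<open>j = l - k\<close> among the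
terms of the Poisson extension. With \<open>k, l < N\<close> this index lies in the truncation range.
\<close>

lemma truncated_energy_integral:
  "(LINT z:ball 0 r|lborel. of_real ((cmod (\<Sum>k<N. b k * z ^ k))\<^sup>2) * poisson_partial u N z
      * of_real ((1 - (cmod z)\<^sup>2) ^ (n - 1)))
   = (\<Sum>k<N. \<Sum>l<N. b k * cnj (b l) * u (int l - int k) * of_real (disc_moment n r (max k l)))"
proof -
  define J where "J = {- int N..<int N}"
  define A where "A = ({..<N} \<times> {..<N}) \<times> J"
  define c where "c = (\<lambda>((k,l),j). b k * cnj (b l) * u j)"
  define g where "g = (\<lambda>((k,l),j) z. z ^ (k + nat j) * cnj z ^ (l + nat (- j)) * complex_of_real ((1 - (cmod z)\<^sup>2) ^ (n - 1)))"
  have "of_real ((cmod (\<Sum>k<N. b k * z ^ k))\<^sup>2) * poisson_partial u N z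
      * of_real ((1 - (cmod z)\<^sup>2) ^ (n - 1)) = (\<Sum>x\<in>A. c x * g x z)" for z
  proof -
    let ?w = "complex_of_real ((1 - (cmod z)\<^sup>2) ^ (n - 1))"
    have "of_real ((cmod (\<Sum>k<N. b k * z ^ k))\<^sup>2) * poisson_partial u N z * ?w
       = (\<Sum>k<N. \<Sum>l<N. (b k * z ^ k) * cnj (b l * z ^ l)) *
         (\<Sum>j\<in>J. u j * (z ^ nat j * cnj z ^ nat (- j))) * ?w"
      unfolding complex_norm_square poisson_partial_alt J_def by (simp add: sum_product)
    also have "\<dots> = (\<Sum>k<N. \<Sum>l<N. \<Sum>j\<in>J. ((b k * z ^ k) * cnj (b l * z ^ l)) *
         (u j * (z ^ nat j * cnj z ^ nat (- j))) * ?w)"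
      by (simp only: sum_distrib_right) (simp only: sum_distrib_left sum_distrib_right)
    also have "\<dots> = (\<Sum>k<N. \<Sum>l<N. \<Sum>j\<in>J. c ((k,l),j) * g ((k,l),j) z)"
      by (simp add: c_def g_def power_add mult_ac)
    finally show ?thesis
      unfolding A_def by (simp only: sum.cartesian_product')
  qed
  then have "(LINT z:ball 0 r|lborel. of_real ((cmod (\<Sum>k<N. b k * z ^ k))\<^sup>2) * poisson_partial u N z
      * of_real ((1 - (cmod z)\<^sup>2) ^ (n - 1))) = (LINT z:ball 0 r|lborel. \<Sum>x\<in>A. c x * g x z)"
    by (simp only:)
  also have "\<dots> = (\<Sum>x\<in>A. c x * (LINT z:ball 0 r|lborel. g x z))"
    by (rule set_integral_lincomb, rule integrable_on_disc)
      (auto simp: g_def case_prod_beta intro!: continuous_intros)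
  also have "\<dots> = (\<Sum>k<N. \<Sum>l<N. \<Sum>j\<in>J. c ((k,l),j) *
      (if k + nat j = l + nat (- j) then of_real (disc_moment n r (k + nat j)) else 0))"
    unfolding A_def sum.cartesian_product' g_def prod.case disc_integral_monomial ..
  also have "\<dots> = (\<Sum>k<N. \<Sum>l<N. b k * cnj (b l) * u (int l - int k) * of_real (disc_moment n r (max k l)))"
  proof (intro sum.cong refl)
    fix k l assume kl: "k \<in> {..<N}" "l \<in> {..<N}"
    have "(\<Sum>j\<in>J. c ((k,l),j) * (if k + nat j = l + nat (- j) then of_real (disc_moment n r (k + nat j)) else 0))
       = (\<Sum>j\<in>J. if j = int l - int k then c ((k,l),j) * of_real (disc_moment n r (k + nat j)) else 0)"
      by (intro sum.cong) auto
    also have "\<dots> = c ((k,l),int l - int k) * of_real (disc_moment n r (k + nat (int l - int k)))"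
      using kl by (subst sum.delta) (auto simp: J_def)
    also have "k + nat (int l - int k) = max k l" by auto
    finally show "(\<Sum>j\<in>J. c ((k,l),j) * (if k + nat j = l + nat (- j) then of_real (disc_moment n r (k + nat j)) else 0))
       = b k * cnj (b l) * u (int l - int k) * of_real (disc_moment n r (max k l))"
      by (simp add: c_def)
  qed
  finally show ?thesis .
qed

definition disc_energy :: "(int \<Rightarrow> complex) \<Rightarrow> nat \<Rightarrow> (complex \<Rightarrow> complex) \<Rightarrow> real \<Rightarrow> complex" where
  "disc_energy u n f r = (LINT z:ball 0 r|lborel.
     of_real ((cmod ((deriv ^^ n) f z))\<^sup>2) * poisson_series u z * of_real ((1 - (cmod z)\<^sup>2) ^ (n - 1)))"

text \<open>
On a disc of radius \<open>r < 1\<close> the partial sums of \<open>f^(n)\<close> and of the Poisson extension are uniformly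
bounded, so the truncated integrals converge by dominated convergence.
\<close>

lemma truncated_energy_tendsto:
  fixes n :: nat
  assumes u: "poly_growth u" and f: "has_taylor f a" and r: "0 < r" "r < 1"
  defines "b \<equiv> (diffs ^^ n) a"
  shows "(\<lambda>N. \<Sum>k<N. \<Sum>l<N. b k * cnj (b l) * u (int l - int k) * of_real (disc_moment n r (max k l)))
     \<longlonglongrightarrow> disc_energy u n f r"
proof -
  have rb: "rapidly_decreasing b"
    using f unfolding b_def has_taylor_def by (blast intro: rapidly_decreasing_funpow_diffs)
  define G where "G = (\<Sum>k. cmod (b k))"
  have sb: "summable (\<lambda>k. cmod (b k))" using rapidly_decreasing_summable[OF rb, of 0] by simp
  obtain H where H: "\<And>N z. cmod z \<le> r \<Longrightarrow> cmod (poisson_partial u N z) \<le> H"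
    using poisson_partial_bounded[OF u less_imp_le[OF r(1)] r(2)] by blast
  let ?w = "\<lambda>z. complex_of_real ((1 - (cmod z)\<^sup>2) ^ (n - 1))"
  define s where "s = (\<lambda>N z. indicator (ball 0 r) z *\<^sub>R
    (of_real ((cmod (\<Sum>k<N. b k * z ^ k))\<^sup>2) * poisson_partial u N z * ?w z))"
  define S where "S = (\<lambda>z. indicator (ball 0 r) z *\<^sub>R
    (of_real ((cmod ((deriv ^^ n) f z))\<^sup>2) * poisson_series u z * ?w z))"
  have lim: "(\<lambda>N. s N z) \<longlonglongrightarrow> S z" for z
  proof (cases "z \<in> ball 0 r")
    case True
    then have "(\<lambda>N. \<Sum>k<N. b k * z ^ k) \<longlonglongrightarrow> (deriv ^^ n) f z"
      using has_taylor_higher_deriv[OF f, of z n] r by (simp add: b_def sums_def)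
    moreover have "(\<lambda>N. poisson_partial u N z) \<longlonglongrightarrow> poisson_series u z"
      using True r by (intro poisson_partial_tendsto[OF u less_imp_le[OF r(1)] r(2)]) auto
    ultimately show ?thesis unfolding s_def S_def by (intro tendsto_intros)
  qed (simp add: s_def S_def)
  have ms: "s N \<in> borel_measurable lborel" for N
  proof -
    have "(\<lambda>z. of_real ((cmod (\<Sum>k<N. b k * z ^ k))\<^sup>2) * poisson_partial u N z * ?w z) \<in> borel_measurable lborel"
      unfolding poisson_partial_def
      by (simp, intro borel_measurable_continuous_onI continuous_intros)
    then show ?thesis unfolding s_def by (intro borel_measurable_scaleR borel_measurable_indicator) auto
  qed
  have mS: "S \<in> borel_measurable lborel"
    by (rule borel_measurable_LIMSEQ_metric[OF ms lim])
  have bound: "norm (s N z) \<le> indicator (ball 0 r) z *\<^sub>R (G\<^sup>2 * H)" for N z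
  proof (cases "z \<in> ball 0 r")
    case True
    then have z: "cmod z \<le> r" "cmod z \<le> 1" using r by auto
    have "cmod (\<Sum>k<N. b k * z ^ k) \<le> (\<Sum>k<N. cmod (b k))"
      using z by (intro sum_norm_le) (simp add: norm_mult norm_power mult_left_le power_le_one)
    also have "\<dots> \<le> G" unfolding G_def by (intro sum_le_suminf sb) auto
    finally have "(cmod (\<Sum>k<N. b k * z ^ k))\<^sup>2 \<le> G\<^sup>2" by (intro power_mono) auto
    moreover have H': "cmod (poisson_partial u N z) \<le> H" by (rule H[OF z(1)])
    moreover have "0 \<le> H" by (rule order_trans[OF norm_ge_zero H'])
    moreover have "cmod (?w z) \<le> 1"
    proof -
      have "(cmod z)\<^sup>2 \<le> 1" using z by (intro power_le_one) auto
      then show ?thesis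
        unfolding norm_of_real power_abs by (intro power_le_one) auto
    qed
    ultimately have "(cmod (\<Sum>k<N. b k * z ^ k))\<^sup>2 * cmod (poisson_partial u N z) * cmod (?w z) \<le> G\<^sup>2 * H * 1"
      by (intro mult_mono) auto
    then show ?thesis using True by (simp add: s_def norm_mult norm_power)
  qed (simp add: s_def)
  have int: "integrable lborel (\<lambda>z::complex. indicator (ball 0 r) z *\<^sub>R (G\<^sup>2 * H))"
    using r by (intro integrable_scaleR_left integrable_indicator) (auto simp: emeasure_ball)
  have "(\<lambda>N. LINT z|lborel. s N z) \<longlonglongrightarrow> (LINT z|lborel. S z)"
    by (rule integral_dominated_convergence[OF mS ms int]) (use lim bound in auto)
  then show ?thesis
    unfolding s_def S_def set_lebesgue_integral_def[symmetric] truncated_energy_integral disc_energy_def .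
qed

section \<open>The matrix of a weighted Dirichlet integral\<close>

lemma sum_lessThan_shift_vanishing:
  fixes g :: "nat \<Rightarrow> 'b::comm_monoid_add"
  assumes "\<And>k. k < n \<Longrightarrow> g k = 0"
  shows "(\<Sum>k<N + n. g k) = (\<Sum>k<N. g (k + n))"
proof (induction N)
  case 0
  then show ?case using assms by simp
qed simp

text \<open>
Here the binomial coefficient arises: of the factorials coming from \<open>f^(n)\<close> and from the Beta
integral, those of the larger index cancel.
\<close>

lemma disc_moment_binomial:
  assumes n: "n \<ge> 1"
  shows "fact n * fact (n - 1) * pi / disc_moment n 1 (max k l) * real (min (k + n) (l + n) choose n)
     = (fact (k + n) / fact k) * (fact (l + n) / fact l)"
proof -
  have b: "real (m + n choose n) = fact (m + n) / (fact n * fact m)" for m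
    using binomial_fact[of n "m + n", where 'a = real] by simp
  have mm: "min (k + n) (l + n) = min k l + n" by simp
  have "fact n * fact (n - 1) * pi / disc_moment n 1 (max k l) * real (min k l + n choose n)
      = (fact (max k l + n) / fact (max k l)) * (fact (min k l + n) / fact (min k l))"
    unfolding disc_moment_one[OF n] b by (simp add: field_simps)
  also have "\<dots> = (fact (k + n) / fact k) * (fact (l + n) / fact l)"
    by (cases "k \<le> l") (simp_all add: max_def min_def mult.commute)
  finally show ?thesis unfolding mm .
qed

lemma disc_moment_one_pos: "n \<ge> 1 \<Longrightarrow> 0 < disc_moment n 1 j"
  by (simp add: disc_moment_one)

text \<open>
The share of the disc of radius \<open>r\<close> in the moment belonging to a pair with maximum \<open>i\<close>. The shift by
\<open>n\<close> comes from the \<open>n\<close> derivatives; for \<open>i < n\<close> the truncated difference is \<open>0\<close>, and the shell vanishes.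
\<close>

definition radial_weight :: "nat \<Rightarrow> real \<Rightarrow> nat \<Rightarrow> real" where
  "radial_weight n r i = disc_moment n r (i - n) / disc_moment n 1 (i - n)"

lemma
  assumes "n \<ge> 1"
  shows radial_weight_bound: "0 < r \<Longrightarrow> r < 1 \<Longrightarrow> \<bar>radial_weight n r i\<bar> \<le> 1"
    and radial_weight_tendsto: "((\<lambda>r. radial_weight n r i) \<longlongrightarrow> 1) (at_left 1)"
proof -
  note p = disc_moment_one_pos[OF assms, of "i - n"]
  show "\<bar>radial_weight n r i\<bar> \<le> 1" if "0 < r" "r < 1"
    using disc_moment_bounds[OF that, of n "i - n"] p by (simp add: radial_weight_def)
  have "((\<lambda>r. disc_moment n r (i - n) / disc_moment n 1 (i - n)) \<longlongrightarrow>
      disc_moment n 1 (i - n) / disc_moment n 1 (i - n)) (at_left 1)"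
    using p by (intro tendsto_intros disc_moment_tendsto) auto
  then show "((\<lambda>r. radial_weight n r i) \<longlongrightarrow> 1) (at_left 1)"
    using p by (simp add: radial_weight_def)
qed

lemma truncated_energy_eq_shells:
  assumes n: "n \<ge> 1"
  shows "(\<Sum>k<N. \<Sum>l<N. (diffs ^^ n) a k * cnj ((diffs ^^ n) a l) * u (int l - int k) * of_real (disc_moment n r (max k l)))
    = of_real (fact n * fact (n - 1) * pi) * (\<Sum>i<N + n. of_real (radial_weight n r i) * gram_shell u n a i)"
proof -
  define g where "g = (\<lambda>k l. of_real (radial_weight n r (max k l)) *
    (of_nat (min k l choose n) * a k * cnj (a l) * u (int l - int k)))"
  have "of_real (radial_weight n r i) * gram_shell u n a i = (\<Sum>(k,l)\<in>shell i. g k l)" for i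
    unfolding gram_shell_def g_def sum_distrib_left
    by (intro sum.cong) (auto dest!: max_shell)
  then have "(\<Sum>i<N + n. of_real (radial_weight n r i) * gram_shell u n a i) = (\<Sum>k<N + n. \<Sum>l<N + n. g k l)"
    by (simp add: sum_square_shells)
  also have "\<dots> = (\<Sum>k<N. \<Sum>l<N + n. g (k + n) l)"
    by (rule sum_lessThan_shift_vanishing) (simp add: g_def binomial_eq_0)
  also have "\<dots> = (\<Sum>k<N. \<Sum>l<N. g (k + n) (l + n))"
    by (intro sum.cong refl sum_lessThan_shift_vanishing) (simp add: g_def binomial_eq_0)
  finally have 1: "(\<Sum>i<N + n. of_real (radial_weight n r i) * gram_shell u n a i)
      = (\<Sum>k<N. \<Sum>l<N. g (k + n) (l + n))" .
  have 2: "(diffs ^^ n) a k * cnj ((diffs ^^ n) a l) * u (int l - int k) * of_real (disc_moment n r (max k l))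
     = of_real (fact n * fact (n - 1) * pi) * g (k + n) (l + n)" for k l
  proof -
    have "(diffs ^^ n) a k * cnj ((diffs ^^ n) a l) * u (int l - int k) * of_real (disc_moment n r (max k l))
       = of_real ((fact (k + n) / fact k) * (fact (l + n) / fact l) * disc_moment n r (max k l)) *
         (a (k + n) * cnj (a (l + n)) * u (int l - int k))"
      unfolding funpow_diffs_eq by simp
    also have "(fact (k + n) / fact k) * (fact (l + n) / fact l) * disc_moment n r (max k l)
       = fact n * fact (n - 1) * pi * radial_weight n r (max (k + n) (l + n)) * real (min (k + n) (l + n) choose n)"
    proof -
      have "max (k + n) (l + n) - n = max k l" by simp
      then show ?thesis
        unfolding disc_moment_binomial[OF n, symmetric] radial_weight_def by simp
    qed
    finally show ?thesis by (simp add: g_def mult_ac)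
  qed
  show ?thesis unfolding 1 2 by (simp add: sum_distrib_left)
qed

lemma disc_energy_eq_series:
  assumes n: "n \<ge> 1" and u: "poly_growth u" and f: "has_taylor f a" and r: "0 < r" "r < 1"
  shows "of_real (1 / (fact n * fact (n - 1) * pi)) * disc_energy u n f r
     = (\<Sum>i. of_real (radial_weight n r i) * gram_shell u n a i)"
proof -
  have ra: "rapidly_decreasing a" using f by (simp add: has_taylor_def)
  define K where "K = complex_of_real (fact n * fact (n - 1) * pi)"
  have K0: "K \<noteq> 0" by (simp add: K_def)
  have s: "summable (\<lambda>i. of_real (radial_weight n r i) * gram_shell u n a i)"
  proof (rule summable_comparison_test'[OF gram_shell_abs_summable[OF u ra]])
    show "norm (of_real (radial_weight n r i) * gram_shell u n a i) \<le> cmod (gram_shell u n a i)" for i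
      using radial_weight_bound[OF n r, of i] by (simp add: norm_mult mult_left_le_one_le)
  qed
  have "(\<lambda>N. \<Sum>i<N + n. of_real (radial_weight n r i) * gram_shell u n a i)
      \<longlonglongrightarrow> (\<Sum>i. of_real (radial_weight n r i) * gram_shell u n a i)"
    by (rule LIMSEQ_ignore_initial_segment[OF summable_LIMSEQ[OF s]])
  then have "(\<lambda>N. K * (\<Sum>i<N + n. of_real (radial_weight n r i) * gram_shell u n a i))
      \<longlonglongrightarrow> K * (\<Sum>i. of_real (radial_weight n r i) * gram_shell u n a i)"
    by (intro tendsto_intros)
  moreover have "(\<lambda>N. K * (\<Sum>i<N + n. of_real (radial_weight n r i) * gram_shell u n a i))
      \<longlonglongrightarrow> disc_energy u n f r"
    using truncated_energy_tendsto[OF u f r, of n] unfolding truncated_energy_eq_shells[OF n] K_def .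
  ultimately have "disc_energy u n f r = K * (\<Sum>i. of_real (radial_weight n r i) * gram_shell u n a i)"
    using LIMSEQ_unique by blast
  moreover have "of_real (1 / (fact n * fact (n - 1) * pi)) = 1 / K" by (simp add: K_def)
  ultimately show ?thesis using K0 by simp
qed

text \<open>
The weights of the shells are bounded by \<open>1\<close> and tend to \<open>1\<close>, and the shells are absolutely summable,
so Tannery's theorem applies.
\<close>

lemma disc_energy_tendsto:
  assumes n: "n \<ge> 1" and u: "poly_growth u" and f: "has_taylor f a"
  shows "((\<lambda>r. of_real (1 / (fact n * fact (n - 1) * pi)) * disc_energy u n f r)
     \<longlongrightarrow> dirichlet_form u n a) (at_left 1)"
proof -
  have ra: "rapidly_decreasing a" using f by (simp add: has_taylor_def)
  have ev: "\<forall>\<^sub>F r in at_left 1. 0 < r \<and> r < (1::real)"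
    using eventually_at_left_real[of 0 1] by (auto elim!: eventually_mono)
  have "((\<lambda>r. \<Sum>i. of_real (radial_weight n r i) * gram_shell u n a i)
     \<longlongrightarrow> (\<Sum>i. of_real 1 * gram_shell u n a i)) (at_left 1)"
  proof (rule tannerys_theorem[THEN conjunct2, THEN conjunct2])
    show "((\<lambda>r. of_real (radial_weight n r i) * gram_shell u n a i)
        \<longlongrightarrow> of_real 1 * gram_shell u n a i) (at_left 1)" for i
      by (intro tendsto_intros radial_weight_tendsto n)
    show "summable (\<lambda>i. cmod (gram_shell u n a i))" by (rule gram_shell_abs_summable[OF u ra])
    have "\<forall>\<^sub>F x in (at_top :: nat filter) \<times>\<^sub>F at_left (1::real). 0 < snd x \<and> snd x < 1"
      using eventually_prod2[of "at_top :: nat filter" "\<lambda>r. 0 < r \<and> r < 1" "at_left (1::real)"] ev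
      by (simp add: case_prod_unfold trivial_limit_sequentially)
    then show "\<forall>\<^sub>F (i, r) in at_top \<times>\<^sub>F at_left 1.
        norm (of_real (radial_weight n r i) * gram_shell u n a i) \<le> cmod (gram_shell u n a i)"
      by eventually_elim
        (use radial_weight_bound[OF n] in \<open>auto simp: norm_mult intro!: mult_left_le_one_le\<close>)
  qed auto
  then have "((\<lambda>r. \<Sum>i. of_real (radial_weight n r i) * gram_shell u n a i)
     \<longlongrightarrow> dirichlet_form u n a) (at_left 1)"
    by (simp add: dirichlet_form_eq_suminf[OF u ra])
  then show ?thesis
  proof (rule Lim_transform_eventually)
    show "\<forall>\<^sub>F r in at_left 1. (\<Sum>i. of_real (radial_weight n r i) * gram_shell u n a i)
       = of_real (1 / (fact n * fact (n - 1) * pi)) * disc_energy u n f r"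
      using ev by eventually_elim (simp only: disc_energy_eq_series[OF n u f])
  qed
qed

text \<open>
For \<open>n = 0\<close> this is the expansion of \<open>\<bar>f\<bar>\<^sup>2\<close> on the circle, for \<open>n \<ge> 1\<close> the limit of the integrals over
smaller discs.
\<close>

lemma dirichlet_eq_form:
  assumes f: "has_taylor f a"
  shows "dirichlet \<mu> n f = dirichlet_form (fourier \<mu>) n a"
proof (cases "n = 0")
  case True
  have "gram (fourier \<mu>) 0 a \<longlonglongrightarrow> dirichlet \<mu> 0 f"
    using dapply_cmod_square[OF f] by (simp add: dirichlet_def)
  then show ?thesis using True by (simp add: dirichlet_form_def limI)
next
  case False
  then have "((\<lambda>r. of_real (1 / (fact n * fact (n - 1) * pi)) * disc_energy (fourier \<mu>) n f r)
     \<longlongrightarrow> dirichlet_form (fourier \<mu>) n a) (at_left 1)"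
    by (intro disc_energy_tendsto poly_growth_fourier f) auto
  then show ?thesis
    using False unfolding dirichlet_def poisson_eq_series disc_energy_def
    by (simp add: tendsto_Lim trivial_limit_at_left_real)
qed

section \<open>Positivity and linearity of the forms\<close>

lemma has_taylor_suminf:
  "rapidly_decreasing a \<Longrightarrow> has_taylor (\<lambda>z. \<Sum>k. a k * z ^ k) a"
  unfolding has_taylor_def using rapidly_decreasing_powser_summable by (auto intro: summable_sums)

text \<open>
The integrals whose limit is the form have a nonnegative integrand.
\<close>

lemma dirichlet_form_nonneg:
  assumes n: "n \<ge> 1" and u: "poly_growth u" and a: "rapidly_decreasing a"
    and pos: "\<And>z. z \<in> ball 0 1 \<Longrightarrow> 0 \<le> poisson_series u z"
  shows "0 \<le> dirichlet_form u n a"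
proof -
  define f where "f = (\<lambda>z. \<Sum>k. a k * z ^ k)"
  define E where "E = (\<lambda>r. of_real (1 / (fact n * fact (n - 1) * pi)) * disc_energy u n f r)"
  have lim: "(E \<longlongrightarrow> dirichlet_form u n a) (at_left 1)"
    unfolding E_def f_def by (intro disc_energy_tendsto n u has_taylor_suminf a)
  have nonneg: "Re (E r) \<ge> 0 \<and> Im (E r) = 0" if r: "0 < r" "r < 1" for r
  proof -
    define h where "h = (\<lambda>z. (cmod ((deriv ^^ n) f z))\<^sup>2 * Re (poisson_series u z) * (1 - (cmod z)\<^sup>2) ^ (n - 1))"
    have "disc_energy u n f r = (LINT z:ball 0 r|lborel. complex_of_real (h z))"
      unfolding disc_energy_def
    proof (rule set_lebesgue_integral_cong)
      show "\<forall>z. z \<in> ball 0 r \<longrightarrow> of_real ((cmod ((deriv ^^ n) f z))\<^sup>2) * poisson_series u z *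
          of_real ((1 - (cmod z)\<^sup>2) ^ (n - 1)) = complex_of_real (h z)"
      proof (intro allI impI)
        fix z :: complex assume "z \<in> ball 0 r"
        then have "0 \<le> poisson_series u z" using r by (intro pos) auto
        then have "poisson_series u z = of_real (Re (poisson_series u z))"
          by (simp add: less_eq_complex_def complex_eq_iff)
        then show "of_real ((cmod ((deriv ^^ n) f z))\<^sup>2) * poisson_series u z *
          of_real ((1 - (cmod z)\<^sup>2) ^ (n - 1)) = complex_of_real (h z)"
          by (metis h_def of_real_mult)
      qed
    qed auto
    also have "\<dots> = of_real (LINT z:ball 0 r|lborel. h z)" by (rule set_integral_complex_of_real)
    finally have e: "disc_energy u n f r = of_real (LINT z:ball 0 r|lborel. h z)" .
    have "0 \<le> h z" if "z \<in> ball 0 r" for z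
    proof -
      have "0 \<le> Re (poisson_series u z)" using pos[of z] that r by (auto simp: less_eq_complex_def)
      moreover have "(cmod z)\<^sup>2 \<le> 1" using that r by (intro power_le_one) auto
      ultimately show ?thesis unfolding h_def by (intro mult_nonneg_nonneg) auto
    qed
    then have "0 \<le> (LINT z:ball 0 r|lborel. h z)"
      unfolding set_lebesgue_integral_def by (intro integral_nonneg_AE) (auto simp: indicator_def)
    moreover have "E r = of_real ((1 / (fact n * fact (n - 1) * pi)) * (LINT z:ball 0 r|lborel. h z))"
      unfolding E_def e by simp
    moreover have "0 \<le> 1 / (fact n * fact (n - 1) * pi)" by simp
    ultimately show ?thesis by (simp only: Re_complex_of_real Im_complex_of_real mult_nonneg_nonneg simp_thms)
  qed
  have ev: "\<forall>\<^sub>F r in at_left 1. 0 < r \<and> r < (1::real)"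
    using eventually_at_left_real[of 0 1] by (auto elim!: eventually_mono)
  have "0 \<le> Re (dirichlet_form u n a)"
  proof (rule tendsto_lowerbound[OF tendsto_Re[OF lim]])
    show "\<forall>\<^sub>F r in at_left 1. 0 \<le> Re (E r)" using ev by eventually_elim (use nonneg in auto)
  qed auto
  moreover have "((\<lambda>r::real. 0) \<longlongrightarrow> Im (dirichlet_form u n a)) (at_left 1)"
  proof (rule Lim_transform_eventually[OF tendsto_Im[OF lim]])
    show "\<forall>\<^sub>F r in at_left 1. Im (E r) = 0" using ev by eventually_elim (use nonneg in auto)
  qed
  then have "Im (dirichlet_form u n a) = 0"
    using tendsto_unique[OF trivial_limit_at_left_real _ tendsto_const] by blast
  ultimately show ?thesis by (simp add: less_eq_complex_def)
qed

lemma gram_lincomb: "gram (\<lambda>k. x * u k + y * v k) n a N = x * gram u n a N + y * gram v n a N"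
  by (simp add: gram_def sum_distrib_left sum.distrib[symmetric] algebra_simps)

lemma poly_growth_lincomb:
  assumes "poly_growth u" "poly_growth v"
  shows "poly_growth (\<lambda>k. x * u k + y * v k)"
proof -
  obtain N C where C: "0 \<le> C" "\<And>k. cmod (u k) \<le> C * (1 + \<bar>real_of_int k\<bar>) ^ N"
    using assms(1) unfolding poly_growth_def by blast
  obtain M D where D: "0 \<le> D" "\<And>k. cmod (v k) \<le> D * (1 + \<bar>real_of_int k\<bar>) ^ M"
    using assms(2) unfolding poly_growth_def by blast
  have "cmod (x * u k + y * v k) \<le> (cmod x * C + cmod y * D) * (1 + \<bar>real_of_int k\<bar>) ^ (N + M)" for k
  proof -
    let ?b = "1 + \<bar>real_of_int k\<bar>"
    have "cmod (u k) \<le> C * ?b ^ (N + M)"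
      using C(2)[of k] mult_left_mono[OF power_increasing[of N "N + M" ?b] C(1)] by simp
    moreover have "cmod (v k) \<le> D * ?b ^ (N + M)"
      using D(2)[of k] mult_left_mono[OF power_increasing[of M "N + M" ?b] D(1)] by simp
    ultimately have "cmod x * cmod (u k) + cmod y * cmod (v k)
        \<le> cmod x * (C * ?b ^ (N + M)) + cmod y * (D * ?b ^ (N + M))"
      by (intro add_mono mult_left_mono) auto
    then show ?thesis
      using norm_triangle_ineq[of "x * u k" "y * v k"] by (simp add: norm_mult algebra_simps)
  qed
  moreover have "0 \<le> cmod x * C + cmod y * D" using C(1) D(1) by simp
  ultimately show ?thesis unfolding poly_growth_def by blast
qed

lemma dirichlet_form_lincomb:
  assumes "poly_growth u" "poly_growth v" "rapidly_decreasing a"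
  shows "dirichlet_form (\<lambda>k. x * u k + y * v k) n a = x * dirichlet_form u n a + y * dirichlet_form v n a"
proof -
  have "(\<lambda>N. x * gram u n a N + y * gram v n a N) \<longlonglongrightarrow> x * dirichlet_form u n a + y * dirichlet_form v n a"
    by (intro tendsto_intros gram_tendsto assms)
  moreover have "(\<lambda>N. x * gram u n a N + y * gram v n a N) \<longlonglongrightarrow> dirichlet_form (\<lambda>k. x * u k + y * v k) n a"
    using gram_tendsto[OF poly_growth_lincomb[OF assms(1,2)] assms(3), of x y n]
    unfolding gram_lincomb[abs_def] .
  ultimately show ?thesis using LIMSEQ_unique by blast
qed

section \<open>The action of the shift on the forms\<close>

lemma gram_case_nat:
  "gram u 0 (case_nat 0 a) (Suc N) = gram u 0 a N"
  "gram u (Suc n) (case_nat 0 a) (Suc N) = gram u (Suc n) a N + gram u n a N"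
  unfolding gram_def sum.lessThan_Suc_shift
  by (simp_all add: sum.distrib[symmetric] algebra_simps)

text \<open>
Pascal's identity for \<open>binom (min k l + 1) (n + 1)\<close>.
\<close>

lemma dirichlet_form_case_nat:
  assumes u: "poly_growth u" and a: "rapidly_decreasing a"
  shows "dirichlet_form u 0 (case_nat 0 a) = dirichlet_form u 0 a"
    and "dirichlet_form u (Suc n) (case_nat 0 a) = dirichlet_form u (Suc n) a + dirichlet_form u n a"
proof -
  have l: "(\<lambda>N. gram u n (case_nat 0 a) (Suc N)) \<longlonglongrightarrow> dirichlet_form u n (case_nat 0 a)" for n
    by (rule LIMSEQ_Suc[OF gram_tendsto[OF u rapidly_decreasing_case_nat[OF a]]])
  show "dirichlet_form u 0 (case_nat 0 a) = dirichlet_form u 0 a"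
    using LIMSEQ_unique[OF l[of 0, unfolded gram_case_nat] gram_tendsto[OF u a]] .
  show "dirichlet_form u (Suc n) (case_nat 0 a) = dirichlet_form u (Suc n) a + dirichlet_form u n a"
    using LIMSEQ_unique[OF l[of "Suc n", unfolded gram_case_nat]
        tendsto_add[OF gram_tendsto[OF u a] gram_tendsto[OF u a]]] .
qed

section \<open>Upper bounds by a weighted square sum\<close>

text \<open>
With \<open>\<alpha> i\<close> the mean of \<open>x 0, ..., x i\<close>, the quantities \<open>2 * \<alpha> i * x i - (\<alpha> i)\<^sup>2\<close> dominate the increments
of a nonnegative telescoping sum, whence \<open>\<Sum>\<alpha>\<^sup>2 \<le> 2 \<Sum>\<alpha> x\<close>. Together with
\<open>\<alpha> x \<le> \<alpha>\<^sup>2/4 + x\<^sup>2\<close> this is the elementary proof of Hardy's inequality.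
\<close>

lemma hardy_inequality_sum:
  fixes x :: "nat \<Rightarrow> real"
  shows "(\<Sum>i<N. x i * (\<Sum>l\<le>i. x l) / (1 + real i)) \<le> 2 * (\<Sum>i<N. (x i)\<^sup>2)"
proof -
  define \<alpha> where "\<alpha> = (\<lambda>i. (\<Sum>l\<le>i. x l) / (1 + real i))"
  have tele: "real N * ((\<Sum>l<N. x l) / real N)\<^sup>2 \<le> (\<Sum>i<N. 2 * (\<alpha> i * x i) - (\<alpha> i)\<^sup>2)" for N
  proof (induction N)
    case (Suc N)
    \<comment> \<open>the previous mean; for \<open>N = 0\<close> division by zero makes it \<open>0\<close>, and its weight \<open>real N\<close> vanishes\<close>
    define \<beta> where "\<beta> = (\<Sum>l<N. x l) / real N"
    have S: "(\<Sum>l<N. x l) = real N * \<beta>" by (cases "N = 0") (auto simp: \<beta>_def)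
    have "\<alpha> N = (real N * \<beta> + x N) / (1 + real N)"
      by (simp add: \<alpha>_def lessThan_Suc_atMost[symmetric] S)
    then have xN: "x N = (1 + real N) * \<alpha> N - real N * \<beta>"
      by (simp add: field_simps)
    have "(\<Sum>l<Suc N. x l) / real (Suc N) = \<alpha> N"
      by (simp only: \<alpha>_def lessThan_Suc_atMost of_nat_Suc)
    then have "real (Suc N) * ((\<Sum>l<Suc N. x l) / real (Suc N))\<^sup>2 = (1 + real N) * (\<alpha> N)\<^sup>2" by simp
    also have "\<dots> \<le> (1 + real N) * (\<alpha> N)\<^sup>2 + real N * (\<alpha> N - \<beta>)\<^sup>2" by simp
    also have "\<dots> = real N * \<beta>\<^sup>2 + (2 * (\<alpha> N * x N) - (\<alpha> N)\<^sup>2)"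
      unfolding xN by (simp add: algebra_simps power2_eq_square)
    also have "\<dots> \<le> (\<Sum>i<Suc N. 2 * (\<alpha> i * x i) - (\<alpha> i)\<^sup>2)"
      using Suc unfolding \<beta>_def by simp
    finally show ?case .
  qed simp
  have "0 \<le> real N * ((\<Sum>l<N. x l) / real N)\<^sup>2" by simp
  also note tele
  finally have 1: "(\<Sum>i<N. (\<alpha> i)\<^sup>2) \<le> 2 * (\<Sum>i<N. \<alpha> i * x i)"
    by (simp add: sum_subtractf sum_distrib_left)
  have "\<alpha> i * x i \<le> (\<alpha> i)\<^sup>2 / 4 + (x i)\<^sup>2" for i
    using zero_le_power2[of "\<alpha> i / 2 - x i"] by (simp add: power2_eq_square algebra_simps)
  then have "(\<Sum>i<N. \<alpha> i * x i) \<le> (\<Sum>i<N. (\<alpha> i)\<^sup>2 / 4 + (x i)\<^sup>2)" by (rule sum_mono)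
  also have "\<dots> = (\<Sum>i<N. (\<alpha> i)\<^sup>2) / 4 + (\<Sum>i<N. (x i)\<^sup>2)"
    by (simp add: sum.distrib sum_divide_distrib)
  finally have "(\<Sum>i<N. \<alpha> i * x i) \<le> 2 * (\<Sum>i<N. (x i)\<^sup>2)" using 1 by simp
  then show ?thesis by (simp add: \<alpha>_def mult.commute)
qed

text \<open>
After division by powers the claim is \<open>(1 + l)^(n - q/2) \<le> (1 + i)^(q/2 - 1 - s)\<close>. The first
condition on \<open>s\<close> makes the right exponent nonnegative, the second one makes it at least the left
exponent.
\<close>

lemma kernel_bound:
  fixes s :: real and l i n q :: nat
  assumes s: "2 * s + 2 \<le> real q" "real n + s + 1 \<le> real q" and li: "l \<le> i"
  shows "(1 + real l) ^ n * (1 + real i) powr s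
    \<le> (1 + real l) powr (real q / 2) * (1 + real i) powr (real q / 2) / (1 + real i)"
proof -
  let ?p = "real q / 2"
  have "(1 + real l) powr (real n - ?p) \<le> (1 + real i) powr (?p - 1 - s)"
  proof (cases "real n \<le> ?p")
    case True
    have "(1 + real l) powr (real n - ?p) \<le> (1 + real l) powr 0"
      using True by (intro powr_mono) auto
    also have "\<dots> = (1 + real i) powr 0" by simp
    also have "\<dots> \<le> (1 + real i) powr (?p - 1 - s)"
      using s by (intro powr_mono) auto
    finally show ?thesis .
  next
    case False
    have "(1 + real l) powr (real n - ?p) \<le> (1 + real i) powr (real n - ?p)"
      using False li by (intro powr_mono2) auto
    also have "\<dots> \<le> (1 + real i) powr (?p - 1 - s)"
      using s by (intro powr_mono) auto
    finally show ?thesis .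
  qed
  then have "(1 + real l) powr ?p * (1 + real l) powr (real n - ?p) * (1 + real i) powr s
      \<le> (1 + real l) powr ?p * (1 + real i) powr (?p - 1 - s) * (1 + real i) powr s"
    by (intro mult_left_mono mult_right_mono) auto
  moreover have "(1 + real l) powr ?p * (1 + real l) powr (real n - ?p) = (1 + real l) ^ n"
    by (simp add: powr_add[symmetric] powr_realpow)
  moreover have "(1 + real i) powr (?p - 1 - s) * (1 + real i) powr s = (1 + real i) powr ?p / (1 + real i)"
  proof -
    have "(1 + real i) powr (?p - 1 - s) * (1 + real i) powr s = (1 + real i) powr (?p - 1)"
      by (subst powr_add[symmetric]) simp
    then show ?thesis by (simp add: powr_diff)
  qed
  ultimately show ?thesis by (simp add: mult.assoc)
qed

text \<open>
In terms of \<open>x k = (1 + k)^(q/2) \<bar>a k\<bar>\<close> the form is dominated by the kernel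
\<open>1 / (1 + max k l)\<close>, so Hardy's inequality applies shell by shell.
\<close>

lemma gram_bound:
  fixes s c :: real and n q :: nat
  assumes u: "\<And>j. cmod (u j) \<le> c * (1 + \<bar>real_of_int j\<bar>) powr s" and s0: "0 \<le> s"
    and s: "2 * s + 2 \<le> real q" "real n + s + 1 \<le> real q"
  shows "cmod (gram u n a N) \<le> 4 * c * (\<Sum>k<N. (1 + real k) ^ q * (cmod (a k))\<^sup>2)"
proof -
  have c: "0 \<le> c" using order_trans[OF norm_ge_zero u[of 0]] by simp
  define x where "x = (\<lambda>k. (1 + real k) powr (real q / 2) * cmod (a k))"
  have x0: "0 \<le> x k" for k by (simp add: x_def)
  have x2: "(x k)\<^sup>2 = (1 + real k) ^ q * (cmod (a k))\<^sup>2" for k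
  proof -
    have "((1 + real k) powr (real q / 2))\<^sup>2 = (1 + real k) ^ q"
      by (simp add: power2_eq_square powr_add[symmetric] powr_realpow)
    then show ?thesis by (simp add: x_def power_mult_distrib)
  qed
  have entry: "real (min k l choose n) * cmod (a k) * cmod (a l) * cmod (u (int l - int k))
      \<le> c * (x k * x l / (1 + real i))" if kl: "max k l = i" for k l i
  proof -
    define j where "j = min k l"
    have ji: "j \<le> i" using kl by (auto simp: j_def)
    have "cmod (u (int l - int k)) \<le> c * (1 + \<bar>real_of_int (int l - int k)\<bar>) powr s" by (rule u)
    also have "\<dots> \<le> c * (1 + real i) powr s"
      using kl s0 by (intro mult_left_mono powr_mono2 c) auto
    finally have "real (j choose n) * cmod (u (int l - int k)) \<le> (1 + real j) ^ n * (c * (1 + real i) powr s)"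
      by (intro mult_mono binomial_le_power_real) auto
    also have "\<dots> = c * ((1 + real j) ^ n * (1 + real i) powr s)" by simp
    also have "\<dots> \<le> c * ((1 + real j) powr (real q / 2) * (1 + real i) powr (real q / 2) / (1 + real i))"
      by (intro mult_left_mono kernel_bound s ji c)
    also have "(1 + real j) powr (real q / 2) * (1 + real i) powr (real q / 2)
        = (1 + real k) powr (real q / 2) * (1 + real l) powr (real q / 2)"
      using kl by (auto simp: j_def max_def min_def)
    finally have "real (j choose n) * cmod (u (int l - int k)) * (cmod (a k) * cmod (a l))
      \<le> c * ((1 + real k) powr (real q / 2) * (1 + real l) powr (real q / 2) / (1 + real i)) * (cmod (a k) * cmod (a l))"
      by (intro mult_right_mono) auto
    then show ?thesis by (simp add: x_def j_def mult_ac)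
  qed
  have shell: "cmod (gram_shell u n a i) \<le> 2 * c * (x i * (\<Sum>l\<le>i. x l) / (1 + real i))" for i
  proof -
    have "cmod (gram_shell u n a i) \<le> (\<Sum>(k,l)\<in>shell i. c * (x k * x l / (1 + real i)))"
      unfolding gram_shell_def
    proof (rule sum_norm_le)
      fix y assume "y \<in> shell i"
      then show "cmod (case y of (k,l) \<Rightarrow> of_nat (min k l choose n) * a k * cnj (a l) * u (int l - int k))
          \<le> (case y of (k,l) \<Rightarrow> c * (x k * x l / (1 + real i)))"
        using entry[OF max_shell] by (auto simp: norm_mult case_prod_beta)
    qed
    also have "\<dots> = c / (1 + real i) * (x i * (\<Sum>l\<le>i. x l) + x i * (\<Sum>k<i. x k))"
      unfolding shell_def
      by (subst sum.union_disjoint)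
        (auto simp: sum.cartesian_product[symmetric] sum_distrib_left algebra_simps add_divide_distrib)
    also have "\<dots> \<le> c / (1 + real i) * (x i * (\<Sum>l\<le>i. x l) + x i * (\<Sum>l\<le>i. x l))"
      using c by (intro mult_left_mono add_left_mono sum_mono2) (auto simp: x0)
    finally show ?thesis by (simp add: field_simps)
  qed
  have "cmod (gram u n a N) \<le> (\<Sum>i<N. 2 * c * (x i * (\<Sum>l\<le>i. x l) / (1 + real i)))"
    unfolding gram_eq_sum_shells by (intro sum_norm_le shell)
  also have "\<dots> = 2 * c * (\<Sum>i<N. x i * (\<Sum>l\<le>i. x l) / (1 + real i))" by (simp add: sum_distrib_left)
  also have "\<dots> \<le> 2 * c * (2 * (\<Sum>i<N. (x i)\<^sup>2))"
    using c by (intro mult_left_mono hardy_inequality_sum) auto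
  finally show ?thesis by (simp add: x2)
qed

section \<open>Bounded coefficients from a nonnegative Poisson extension\<close>

lemma gram_truncate:
  assumes "N \<le> M"
  shows "gram u n (\<lambda>k. if k < N then a k else 0) M = gram u n a N"
proof -
  have "gram u n (\<lambda>k. if k < N then a k else 0) M
     = (\<Sum>k<N. \<Sum>l<M. of_nat (min k l choose n) * a k * cnj (if l < N then a l else 0) * u (int l - int k))"
    unfolding gram_def using assms by (intro sum.mono_neutral_cong_right) auto
  also have "\<dots> = gram u n a N"
    unfolding gram_def using assms by (intro sum.cong refl sum.mono_neutral_cong_right) auto
  finally show ?thesis .
qed

text \<open>
Statements about forms of polynomials are thus statements about the finite sections.
\<close>

lemma dirichlet_form_truncate: "dirichlet_form u n (\<lambda>k. if k < N then a k else 0) = gram u n a N"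
  unfolding dirichlet_form_def
proof (rule limI, rule Lim_transform_eventually[OF tendsto_const])
  show "\<forall>\<^sub>F M in sequentially. gram u n a N = gram u n (\<lambda>k. if k < N then a k else 0) M"
    using eventually_ge_at_top[of N] by eventually_elim (simp add: gram_truncate)
qed

lemma gram_nonneg_of_form_nonneg:
  assumes "\<And>a. rapidly_decreasing a \<Longrightarrow> 0 \<le> dirichlet_form u n a"
  shows "0 \<le> gram u n a N"
  using assms[of "\<lambda>k. if k < N then a k else 0"] unfolding dirichlet_form_truncate
  by (simp add: rapidly_decreasing_finite_support[of N])

text \<open>
The form with \<open>n = 1\<close> is nonnegative. On \<open>x z^d + z^(2d)\<close> with \<open>\<bar>x\<bar> = 1\<close> it equals
\<open>d (3 u 0 + 2 Re (x u d))\<close>, and \<open>x\<close> can be chosen such that \<open>x * u d = - \<bar>u d\<bar>\<close>.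
\<close>

lemma poisson_nonneg_imp_coeff_bounded:
  assumes u: "poly_growth u" and herm: "\<And>k. u (- k) = cnj (u k)"
    and pos: "\<And>z. z \<in> ball 0 1 \<Longrightarrow> 0 \<le> poisson_series u z"
  shows "cmod (u k) \<le> 2 * cmod (u 0)"
proof -
  have *: "cmod (u (int d)) \<le> 2 * cmod (u 0)" if d: "d \<ge> 1" for d
  proof (cases "u (int d) = 0")
    case False
    \<comment> \<open>the unimodular number that rotates \<open>u d\<close> to the negative real axis\<close>
    define x where "x = - cnj (u (int d)) / of_real (cmod (u (int d)))"
    have x1: "x * cnj x = 1"
    proof -
      have "cmod x = 1" using False by (simp add: x_def norm_divide)
      then show ?thesis by (simp flip: complex_norm_square)
    qed
    have xu: "x * u (int d) = - of_real (cmod (u (int d)))"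
    proof -
      have "x * u (int d) = - (u (int d) * cnj (u (int d))) / of_real (cmod (u (int d)))"
        by (simp add: x_def)
      also have "\<dots> = - of_real (cmod (u (int d)))"
        using False unfolding complex_norm_square[symmetric] by (simp add: power2_eq_square)
      finally show ?thesis .
    qed
    define a where "a = (\<lambda>i. if i = d then x else if i = 2 * d then 1 else 0)"
    let ?g = "\<lambda>k l. of_nat (min k l choose 1) * a k * cnj (a l) * u (int l - int k)"
    have "0 \<le> gram u 1 a (Suc (2 * d))"
      by (rule gram_nonneg_of_form_nonneg, rule dirichlet_form_nonneg) (use u pos in auto)
    also have "gram u 1 a (Suc (2 * d)) = (\<Sum>k\<in>{d, 2 * d}. \<Sum>l\<in>{d, 2 * d}. ?g k l)"
    proof -
      have "gram u 1 a (Suc (2 * d)) = (\<Sum>k\<in>{d, 2 * d}. \<Sum>l<Suc (2 * d). ?g k l)"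
        unfolding gram_def by (intro sum.mono_neutral_right) (auto simp: a_def)
      also have "\<dots> = (\<Sum>k\<in>{d, 2 * d}. \<Sum>l\<in>{d, 2 * d}. ?g k l)"
        by (intro sum.cong refl sum.mono_neutral_right) (auto simp: a_def)
      finally show ?thesis .
    qed
    also have "\<dots> = of_nat d * (x * cnj x) * u 0 + of_nat d * (x * u (int d))
        + of_nat d * cnj (x * u (int d)) + of_nat (2 * d) * u 0"
      using d herm[of "int d"] by (simp add: a_def min_def mult_ac)
    also have "\<dots> = of_real (real d) * (3 * u 0 - 2 * of_real (cmod (u (int d))))"
      unfolding x1 xu by (simp add: algebra_simps)
    finally have "0 \<le> real d * (3 * Re (u 0) - 2 * cmod (u (int d)))"
      by (simp add: less_eq_complex_def)
    then have "2 * cmod (u (int d)) \<le> 3 * Re (u 0)"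
      using d by (simp add: zero_le_mult_iff)
    then show ?thesis using complex_Re_le_cmod[of "u 0"] norm_ge_zero[of "u 0"] by linarith
  qed simp
  consider "k = 0" | "k > 0" | "k < 0" by linarith
  then show ?thesis
  proof cases
    case 2
    then show ?thesis using *[of "nat k"] by simp
  next
    case 3
    then show ?thesis using *[of "nat (- k)"] herm[of k] by simp
  qed simp
qed

section \<open>Fourier coefficients of real distributions and of derivatives of measures\<close>

text \<open>
On the circle \<open>\<zeta>^k + \<zeta>^(-k)\<close> and \<open>\<i> (\<zeta>^k - \<zeta>^(-k))\<close> are real.
\<close>

lemma real_distr_fourier:
  assumes "real_distr \<mu>"
  shows "fourier \<mu> (- k) = cnj (fourier \<mu> k)"
proof -
  have pk: "\<zeta> powi k = cnj (\<zeta> powi (- k))" if "\<zeta> \<in> sphere 0 1" for \<zeta>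
  proof -
    have "cnj \<zeta> = inverse \<zeta>" using that by (simp add: inverse_complex_def complex_eq_iff cmod_power2[symmetric])
    moreover have "cnj (\<zeta> powi (- k)) = cnj \<zeta> powi (- k)" by (simp add: power_int_def)
    ultimately show ?thesis by (simp add: power_int_minus power_int_inverse)
  qed
  have rl: "1 * cnj w + 1 * w \<in> \<real>" "\<i> * cnj w + (- \<i>) * w \<in> \<real>" for w
    by (simp_all add: complex_is_Real_iff)
  have lin: "dapply \<mu> (\<lambda>z. x * z powi k + y * z powi (- k)) = x * fourier \<mu> (- k) + y * fourier \<mu> k" for x y
    using dapply_lincomb[OF smooth_circle_powi smooth_circle_powi, of \<mu> x k y "- k"] by (simp add: fourier_def)
  have "dapply \<mu> (\<lambda>z. 1 * z powi k + 1 * z powi (- k)) \<in> \<real>"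
  proof (rule assms[unfolded real_distr_def, rule_format])
    show "smooth_circle (\<lambda>z. 1 * z powi k + 1 * z powi (- k))"
      by (intro smooth_circle_lincomb smooth_circle_powi)
    show "1 * \<zeta> powi k + 1 * \<zeta> powi (- k) \<in> \<real>" if "\<zeta> \<in> sphere 0 1" for \<zeta> :: complex
      unfolding pk[OF that] by (rule rl)
  qed
  then have 1: "Im (fourier \<mu> (- k)) = - Im (fourier \<mu> k)"
    unfolding lin by (simp add: complex_is_Real_iff)
  have "dapply \<mu> (\<lambda>z. \<i> * z powi k + (- \<i>) * z powi (- k)) \<in> \<real>"
  proof (rule assms[unfolded real_distr_def, rule_format])
    show "smooth_circle (\<lambda>z. \<i> * z powi k + (- \<i>) * z powi (- k))"
      by (intro smooth_circle_lincomb smooth_circle_powi)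
    show "\<i> * \<zeta> powi k + (- \<i>) * \<zeta> powi (- k) \<in> \<real>" if "\<zeta> \<in> sphere 0 1" for \<zeta> :: complex
      unfolding pk[OF that] by (rule rl)
  qed
  then have 2: "Re (fourier \<mu> (- k)) = Re (fourier \<mu> k)"
    unfolding lin by (simp add: complex_is_Real_iff)
  show ?thesis using 1 2 by (simp add: complex_eq_iff)
qed

lemma dirichlet_form_real:
  assumes herm: "\<And>k. u (- k) = cnj (u k)" and u: "poly_growth u" and a: "rapidly_decreasing a"
  shows "Im (dirichlet_form u n a) = 0"
proof -
  have "cnj (gram u n a N) = gram u n a N" for N
  proof -
    have "cnj (gram u n a N) = (\<Sum>k<N. \<Sum>l<N. of_nat (min k l choose n) * cnj (a k) * a l * u (int k - int l))"
      unfolding gram_def by (simp add: herm[symmetric])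
    also have "\<dots> = (\<Sum>l<N. \<Sum>k<N. of_nat (min k l choose n) * cnj (a k) * a l * u (int k - int l))"
      by (rule sum.swap)
    also have "\<dots> = gram u n a N"
      unfolding gram_def by (simp add: min.commute mult_ac)
    finally show ?thesis .
  qed
  then have "Im (gram u n a N) = 0" for N by (metis complex_cnj_cancel_iff complex_is_Real_iff Reals_cnj_iff)
  then have "(\<lambda>N. 0) \<longlonglongrightarrow> Im (dirichlet_form u n a)"
    using tendsto_Im[OF gram_tendsto[OF u a, of n]] by simp
  then show ?thesis using LIMSEQ_unique tendsto_const by blast
qed

lemma fourier_arith:
  "fourier (\<mu> + \<nu>) k = fourier \<mu> k + fourier \<nu> k"
  "fourier 0 k = 0"
  "fourier (c *\<^sub>R \<mu>) k = of_real c * fourier \<mu> k"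
  by (simp_all add: fourier_def plus_distr.rep_eq zero_distr.rep_eq scaleR_distr.rep_eq)

lemma fourier_sum: "fourier (\<Sum>j\<in>A. \<mu> j) k = (\<Sum>j\<in>A. fourier (\<mu> j) k)"
  by (induction A rule: infinite_finite_induct) (simp_all add: fourier_arith)

lemma fourier_funpow_D_op: "fourier ((D_op ^^ j) \<mu>) k = of_int (\<bar>k\<bar> ^ j) * fourier \<mu> k"
  by (induction j) (simp_all add: fourier_D_op mult.assoc)

lemma circle_measure_powi_bound:
  assumes "pos_circle_measure M"
  shows "cmod (LINT \<zeta>|M. \<zeta> powi k) \<le> measure M (space M)"
proof -
  have sp: "space M = sphere 0 1"
    using assms sets_eq_imp_space_eq[of M "restrict_space borel (sphere 0 1)"]
    by (simp add: pos_circle_measure_def space_restrict_space)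
  have "cmod (LINT \<zeta>|M. \<zeta> powi k) \<le> (LINT \<zeta>|M. cmod (\<zeta> powi k))" by (rule integral_norm_bound)
  also have "\<dots> = (LINT \<zeta>|M. 1)"
    by (intro Bochner_Integration.integral_cong) (auto simp: sp norm_power_int)
  finally show ?thesis by simp
qed

lemma finite_measure_distr_fourier_bounded:
  assumes "finite_measure_distr \<mu>"
  shows "\<exists>c. \<forall>k. cmod (fourier \<mu> k) \<le> c"
proof -
  obtain M1 M2 M3 M4 where M: "pos_circle_measure M1" "pos_circle_measure M2"
      "pos_circle_measure M3" "pos_circle_measure M4"
    and rep: "\<And>f. smooth_circle f \<Longrightarrow> dapply \<mu> f = (LINT \<zeta>|M1. f \<zeta>) - (LINT \<zeta>|M2. f \<zeta>)
                       + \<i> * ((LINT \<zeta>|M3. f \<zeta>) - (LINT \<zeta>|M4. f \<zeta>))"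
    using assms unfolding finite_measure_distr_def by blast
  have "cmod (fourier \<mu> k) \<le> measure M1 (space M1) + measure M2 (space M2)
      + (measure M3 (space M3) + measure M4 (space M4))" for k
    unfolding fourier_def rep[OF smooth_circle_powi]
    by (rule order_trans[OF norm_triangle_ineq], rule add_mono)
      (auto simp: norm_mult intro!: order_trans[OF norm_triangle_ineq4] add_mono circle_measure_powi_bound M)
  then show ?thesis by blast
qed

lemma sum_D_op_fourier_bound:
  fixes J :: nat
  assumes "\<And>j. j \<le> J \<Longrightarrow> finite_measure_distr (\<kappa> j)"
  shows "\<exists>c. \<forall>k. cmod (fourier (\<Sum>j\<le>J. (D_op ^^ j) (\<kappa> j)) k) \<le> c * (1 + \<bar>real_of_int k\<bar>) powr real J"
proof -
  have "\<forall>j. \<exists>c. j \<le> J \<longrightarrow> (\<forall>k. cmod (fourier (\<kappa> j) k) \<le> c)"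
    using finite_measure_distr_fourier_bounded assms by blast
  then obtain c where c: "\<And>j k. j \<le> J \<Longrightarrow> cmod (fourier (\<kappa> j) k) \<le> c j" by metis
  have "cmod (fourier (\<Sum>j\<le>J. (D_op ^^ j) (\<kappa> j)) k) \<le> (\<Sum>j\<le>J. c j) * (1 + \<bar>real_of_int k\<bar>) powr real J" for k
  proof -
    have "cmod (fourier (\<Sum>j\<le>J. (D_op ^^ j) (\<kappa> j)) k) \<le> (\<Sum>j\<le>J. c j * (1 + \<bar>real_of_int k\<bar>) ^ J)"
      unfolding fourier_sum
    proof (rule sum_norm_le)
      fix j assume "j \<in> {..J}"
      then have j: "j \<le> J" by simp
      have "\<bar>real_of_int k\<bar> ^ j \<le> (1 + \<bar>real_of_int k\<bar>) ^ j" by (intro power_mono) auto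
      also have "\<dots> \<le> (1 + \<bar>real_of_int k\<bar>) ^ J" using j by (intro power_increasing) auto
      finally have "\<bar>real_of_int k\<bar> ^ j * cmod (fourier (\<kappa> j) k) \<le> (1 + \<bar>real_of_int k\<bar>) ^ J * c j"
        by (intro mult_mono c j) auto
      then show "cmod (fourier ((D_op ^^ j) (\<kappa> j)) k) \<le> c j * (1 + \<bar>real_of_int k\<bar>) ^ J"
        by (simp add: fourier_funpow_D_op norm_mult norm_power mult.commute)
    qed
    then show ?thesis by (simp add: sum_distrib_right powr_realpow)
  qed
  then show ?thesis by blast
qed

section \<open>Control of single Taylor coefficients\<close>

lemma positive_distr_gram_nonneg:
  assumes "positive_distr \<nu>"
  shows "0 \<le> gram (fourier \<nu>) 0 a N"
proof -
  define p where "p = (\<lambda>z. \<Sum>k<N. a k * z ^ k)"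
  have p: "has_taylor p (\<lambda>k. if k < N then a k else 0)"
    unfolding p_def by (rule has_taylor_polynomial)
  have "0 \<le> dapply \<nu> (\<lambda>z. of_real ((cmod (p z))\<^sup>2))"
    using assms[unfolded positive_distr_def, rule_format, OF smooth_circle_cmod_square[OF p]]
    by (simp add: less_eq_complex_def)
  then have "0 \<le> dirichlet \<nu> 0 p" by (simp add: dirichlet_def)
  then show ?thesis unfolding dirichlet_eq_form[OF p] dirichlet_form_truncate .
qed

lemma coefficient_zero_bound:
  assumes "\<forall>f\<in>D_a. of_real ((cmod (taylor_coeff f 0))\<^sup>2) \<le> of_real c0 * dirichlet \<nu> 0 f"
  shows "(cmod (a 0))\<^sup>2 \<le> c0 * Re (gram (fourier \<nu>) 0 a (Suc N))"
proof -
  define p where "p = (\<lambda>z. \<Sum>k<Suc N. a k * z ^ k)"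
  have p: "has_taylor p (\<lambda>k. if k < Suc N then a k else 0)"
    unfolding p_def by (rule has_taylor_polynomial)
  have "p \<in> D_a" unfolding p_def by (rule polynomial_in_D_a)
  then have "of_real ((cmod (taylor_coeff p 0))\<^sup>2) \<le> of_real c0 * dirichlet \<nu> 0 p"
    using assms by blast
  moreover have "taylor_coeff p 0 = a 0"
    unfolding taylor_coeff_def p_def sum.lessThan_Suc_shift by simp
  ultimately show ?thesis
    unfolding dirichlet_eq_form[OF p] dirichlet_form_truncate by (simp add: less_eq_complex_def)
qed

text \<open>
Removing the constant term and dividing by \<open>z\<close> does not change the integral of the squared modulus.
The constant term \<open>e\<close> itself is split off by the parallelogram law and positivity on \<open>a + e\<close>.
\<close>

lemma gram_zero_shift_bound:
  assumes "positive_distr \<nu>"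
  shows "Re (gram (fourier \<nu>) 0 (\<lambda>k. a (Suc k)) N)
     \<le> 2 * Re (gram (fourier \<nu>) 0 a (Suc N)) + 2 * (cmod (a 0))\<^sup>2 * Re (fourier \<nu> 0)"
proof -
  define e where "e = (\<lambda>k::nat. if k = 0 then a 0 else 0)"
  let ?G = "\<lambda>a. gram (fourier \<nu>) 0 a (Suc N)"
  have "(\<lambda>k. a k - e k) = case_nat 0 (\<lambda>k. a (Suc k))"
    by (auto simp: e_def fun_eq_iff split: nat.split)
  then have "?G (\<lambda>k. a k - e k) = gram (fourier \<nu>) 0 (\<lambda>k. a (Suc k)) N"
    by (simp add: gram_case_nat)
  moreover have "?G (\<lambda>k. a k - e k) + ?G (\<lambda>k. a k + e k) = 2 * ?G a + 2 * ?G e"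
    by (simp add: gram_def sum.distrib[symmetric] sum_distrib_left algebra_simps)
  moreover have "?G e = of_real ((cmod (a 0))\<^sup>2) * fourier \<nu> 0"
  proof -
    have "?G e = (\<Sum>k<Suc N. \<Sum>l<Suc N. if k = 0 \<and> l = 0 then a 0 * cnj (a 0) * fourier \<nu> 0 else 0)"
      unfolding gram_def by (intro sum.cong) (auto simp: e_def)
    also have "\<dots> = (\<Sum>k<Suc N. if k = 0 then (\<Sum>l<Suc N. if l = 0 then a 0 * cnj (a 0) * fourier \<nu> 0 else 0) else 0)"
      by (intro sum.cong) auto
    finally show ?thesis unfolding complex_norm_square by (simp del: sum.lessThan_Suc)
  qed
  moreover have "0 \<le> ?G (\<lambda>k. a k + e k)" by (rule positive_distr_gram_nonneg[OF assms])
  ultimately have "Re (gram (fourier \<nu>) 0 (\<lambda>k. a (Suc k)) N) + Re (?G (\<lambda>k. a k + e k))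
      = 2 * Re (?G a) + 2 * ((cmod (a 0))\<^sup>2 * Re (fourier \<nu> 0))"
    "0 \<le> Re (?G (\<lambda>k. a k + e k))"
    by (auto simp: complex_eq_iff less_eq_complex_def)
  then show ?thesis by simp
qed

text \<open>
The coefficient of order \<open>k\<close> is the constant coefficient of the \<open>k\<close>-th backward shift, and by
\<open>gram_zero_shift_bound\<close> each backward shift increases the form by at most a constant factor.
\<close>

lemma coefficient_bound:
  assumes pos: "positive_distr \<nu>" and c0: "c0 > 0"
    and h: "\<forall>f\<in>D_a. of_real ((cmod (taylor_coeff f 0))\<^sup>2) \<le> of_real c0 * dirichlet \<nu> 0 f"
  shows "k < N \<Longrightarrow> (cmod (a k))\<^sup>2 \<le> c0 * (2 + 2 * c0 * Re (fourier \<nu> 0)) ^ k * Re (gram (fourier \<nu>) 0 a N)"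
proof (induction k arbitrary: a N)
  case 0
  then show ?case using coefficient_zero_bound[OF h, of a "N - 1"] by simp
next
  case (Suc k)
  define L where "L = 2 + 2 * c0 * Re (fourier \<nu> 0)"
  obtain M where N: "N = Suc M" using Suc.prems by (cases N) auto
  have v0: "0 \<le> Re (fourier \<nu> 0)"
    using positive_distr_gram_nonneg[OF pos, of "\<lambda>_. 1" 1] by (simp add: gram_def less_eq_complex_def)
  have L0: "0 \<le> L" using v0 c0 by (simp add: L_def)
  have "Re (gram (fourier \<nu>) 0 (\<lambda>k. a (Suc k)) M)
     \<le> 2 * Re (gram (fourier \<nu>) 0 a N) + 2 * (cmod (a 0))\<^sup>2 * Re (fourier \<nu> 0)"
    unfolding N by (rule gram_zero_shift_bound[OF pos])
  also have "\<dots> \<le> 2 * Re (gram (fourier \<nu>) 0 a N) + 2 * (c0 * Re (gram (fourier \<nu>) 0 a N)) * Re (fourier \<nu> 0)"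
    using coefficient_zero_bound[OF h, of a M] v0 unfolding N
    by (intro add_left_mono mult_right_mono mult_left_mono) auto
  also have "\<dots> = L * Re (gram (fourier \<nu>) 0 a N)" by (simp add: L_def algebra_simps)
  finally have *: "Re (gram (fourier \<nu>) 0 (\<lambda>k. a (Suc k)) M) \<le> L * Re (gram (fourier \<nu>) 0 a N)" .
  have "(cmod (a (Suc k)))\<^sup>2 \<le> c0 * L ^ k * Re (gram (fourier \<nu>) 0 (\<lambda>k. a (Suc k)) M)"
    using Suc.IH[of M "\<lambda>k. a (Suc k)"] Suc.prems by (simp add: N L_def)
  also have "\<dots> \<le> c0 * L ^ k * (L * Re (gram (fourier \<nu>) 0 a N))"
    using c0 L0 by (intro mult_left_mono *) auto
  finally show ?case by (simp add: L_def mult_ac)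
qed

section \<open>The lower bound for the top term\<close>

text \<open>
The Fourier coefficients of normalised arc length, whose Poisson extension is constant.
\<close>

definition unit_symbol :: "int \<Rightarrow> complex" where
  "unit_symbol k = (if k = 0 then 1 else 0)"

lemma poly_growth_unit_symbol: "poly_growth unit_symbol"
  unfolding poly_growth_def unit_symbol_def by (intro exI[of _ 0] exI[of _ 1]) auto

lemma poisson_series_unit_symbol: "poisson_series unit_symbol z = 1"
proof -
  have "(\<Sum>k. unit_symbol (int k) * z ^ k) = (\<Sum>k\<in>{0}. unit_symbol (int k) * z ^ k)"
    by (rule suminf_finite) (auto simp: unit_symbol_def)
  then show ?thesis by (simp add: poisson_series_def unit_symbol_def)
qed

lemma poisson_series_lincomb:
  assumes "poly_growth u" "poly_growth v" "cmod z < 1"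
  shows "poisson_series (\<lambda>k. x * u k + y * v k) z = x * poisson_series u z + y * poisson_series v z"
proof -
  have lim: "(\<lambda>N. poisson_partial w N z) \<longlonglongrightarrow> poisson_series w z" if "poly_growth w" for w
    by (rule poisson_partial_tendsto[OF that _ assms(3)]) auto
  have "poisson_partial (\<lambda>k. x * u k + y * v k) N z = x * poisson_partial u N z + y * poisson_partial v N z" for N
    by (simp add: poisson_partial_def sum_distrib_left sum.distrib[symmetric] algebra_simps)
  then have "(\<lambda>N. x * poisson_partial u N z + y * poisson_partial v N z)
      \<longlonglongrightarrow> poisson_series (\<lambda>k. x * u k + y * v k) z"
    using lim[OF poly_growth_lincomb[OF assms(1,2), of x y]] by simp
  moreover have "(\<lambda>N. x * poisson_partial u N z + y * poisson_partial v N z)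
      \<longlonglongrightarrow> x * poisson_series u z + y * poisson_series v z"
    by (intro tendsto_intros lim assms)
  ultimately show ?thesis using LIMSEQ_unique by blast
qed

lemma gram_unit_symbol: "gram unit_symbol n a N = of_real (\<Sum>k<N. real (k choose n) * (cmod (a k))\<^sup>2)"
proof -
  have "gram unit_symbol n a N = (\<Sum>k<N. \<Sum>l<N. if k = l then of_nat (k choose n) * (a k * cnj (a k)) else 0)"
    unfolding gram_def by (intro sum.cong refl) (auto simp: unit_symbol_def)
  then show ?thesis by (simp add: complex_norm_square[symmetric])
qed

text \<open>
The symbol \<open>u - c * unit_symbol\<close> has a nonnegative Poisson extension, and the matrix of
\<open>unit_symbol\<close> is diagonal.
\<close>

lemma dirichlet_form_lower_bound:
  assumes n: "n \<ge> 1" and u: "poly_growth u" and a: "rapidly_decreasing a" and c: "c \<ge> 0"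
    and low: "\<And>z. z \<in> ball 0 1 \<Longrightarrow> of_real c \<le> poisson_series u z"
  shows "c * (\<Sum>k<N. real (k choose n) * (cmod (a k))\<^sup>2) \<le> Re (dirichlet_form u n a)"
proof -
  have "0 \<le> dirichlet_form (\<lambda>k. 1 * u k + (- of_real c) * unit_symbol k) n a"
  proof (rule dirichlet_form_nonneg[OF n poly_growth_lincomb[OF u poly_growth_unit_symbol] a])
    show "0 \<le> poisson_series (\<lambda>k. 1 * u k + (- of_real c) * unit_symbol k) z" if "z \<in> ball 0 1" for z
      using that low[OF that]
      by (subst poisson_series_lincomb[OF u poly_growth_unit_symbol]) (auto simp: poisson_series_unit_symbol)
  qed
  then have 1: "c * Re (dirichlet_form unit_symbol n a) \<le> Re (dirichlet_form u n a)"
    unfolding dirichlet_form_lincomb[OF u poly_growth_unit_symbol a] by (simp add: less_eq_complex_def)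
  have "(\<lambda>N. Re (gram unit_symbol n a N)) \<longlonglongrightarrow> Re (dirichlet_form unit_symbol n a)"
    by (intro tendsto_intros gram_tendsto poly_growth_unit_symbol a)
  then have "(\<lambda>N. \<Sum>k<N. real (k choose n) * (cmod (a k))\<^sup>2) \<longlonglongrightarrow> Re (dirichlet_form unit_symbol n a)"
    unfolding gram_unit_symbol Re_complex_of_real .
  moreover have "incseq (\<lambda>N. \<Sum>k<N. real (k choose n) * (cmod (a k))\<^sup>2)"
    by (rule incseq_SucI) simp
  ultimately have "(\<Sum>k<N. real (k choose n) * (cmod (a k))\<^sup>2) \<le> Re (dirichlet_form unit_symbol n a)"
    using incseq_le by blast
  then have "c * (\<Sum>k<N. real (k choose n) * (cmod (a k))\<^sup>2) \<le> c * Re (dirichlet_form unit_symbol n a)"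
    using c by (rule mult_left_mono)
  also note 1
  finally show ?thesis .
qed

text \<open>
From \<open>(k/q)^q \<le> binom k q\<close> and \<open>1 + k \<le> 2 k\<close>.
\<close>

lemma power_le_binomial:
  assumes "1 \<le> q" "q \<le> k"
  shows "(1 + real k) ^ q \<le> (2 * real q) ^ q * real (k choose q)"
proof -
  have "(1 + real k) ^ q \<le> (2 * real q * (real k / real q)) ^ q"
    using assms by (intro power_mono) auto
  also have "\<dots> = (2 * real q) ^ q * (real k / real q) ^ q" by (rule power_mult_distrib)
  also have "\<dots> \<le> (2 * real q) ^ q * real (k choose q)"
    using assms by (intro mult_left_mono binomial_ge_n_over_k_pow_k) auto
  finally show ?thesis .
qed

lemma positive_distr_form_nonneg:
  assumes "positive_distr \<nu>" "rapidly_decreasing a"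
  shows "0 \<le> Re (dirichlet_form (fourier \<nu>) 0 a)" "Im (dirichlet_form (fourier \<nu>) 0 a) = 0"
proof -
  have g: "0 \<le> Re (gram (fourier \<nu>) 0 a N)" "Im (gram (fourier \<nu>) 0 a N) = 0" for N
    using positive_distr_gram_nonneg[OF assms(1), of a N] by (auto simp: less_eq_complex_def)
  note lim = gram_tendsto[OF poly_growth_fourier assms(2), of \<nu> 0]
  show "0 \<le> Re (dirichlet_form (fourier \<nu>) 0 a)"
    by (rule LIMSEQ_le_const[OF tendsto_Re[OF lim]]) (use g in auto)
  show "Im (dirichlet_form (fourier \<nu>) 0 a) = 0"
    using LIMSEQ_unique[OF tendsto_Im[OF lim]] g by simp
qed

text \<open>
The coercivity estimate: single coefficients with \<open>k < q\<close> are bounded by the form of \<open>\<nu>\<close>, the others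
all at once by the form of order \<open>q\<close>.
\<close>

lemma weighted_sum_bound:
  assumes pos: "positive_distr \<nu>" and c0: "c0 > 0"
    and h: "\<forall>f\<in>D_a. of_real ((cmod (taylor_coeff f 0))\<^sup>2) \<le> of_real c0 * dirichlet \<nu> 0 f"
    and u: "poly_growth u" and q: "q \<ge> 1" and c: "c > 0"
    and low: "\<And>z. z \<in> ball 0 1 \<Longrightarrow> of_real c \<le> poisson_series u z"
  shows "\<exists>K\<ge>0. \<forall>a N. rapidly_decreasing a \<longrightarrow> (\<Sum>k<N. (1 + real k) ^ q * (cmod (a k))\<^sup>2)
     \<le> K * (Re (dirichlet_form (fourier \<nu>) 0 a) + Re (dirichlet_form u q a))"
proof -
  define L where "L = 2 + 2 * c0 * Re (fourier \<nu> 0)"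
  have v0: "0 \<le> Re (fourier \<nu> 0)"
    using positive_distr_gram_nonneg[OF pos, of "\<lambda>_. 1" 1] by (simp add: gram_def less_eq_complex_def)
  have L0: "0 \<le> L" using v0 c0 by (simp add: L_def)
  define K1 where "K1 = (\<Sum>k<q. real q ^ q * (c0 * L ^ k))"
  define K2 where "K2 = (2 * real q) ^ q / c"
  have K: "0 \<le> K1" "0 \<le> K2" using L0 c0 c by (auto simp: K1_def K2_def intro!: sum_nonneg)
  have "(\<Sum>k<N. (1 + real k) ^ q * (cmod (a k))\<^sup>2)
     \<le> (K1 + K2) * (Re (dirichlet_form (fourier \<nu>) 0 a) + Re (dirichlet_form u q a))"
    if a: "rapidly_decreasing a" for a N
  proof -
    define X where "X = Re (dirichlet_form (fourier \<nu>) 0 a)"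
    define Y where "Y = Re (dirichlet_form u q a)"
    have X0: "0 \<le> X" unfolding X_def by (rule positive_distr_form_nonneg[OF pos a])
    have Ylow: "c * (\<Sum>k<N. real (k choose q) * (cmod (a k))\<^sup>2) \<le> Y" for N
      unfolding Y_def using c by (intro dirichlet_form_lower_bound q u a low) auto
    have Y0: "0 \<le> Y" using Ylow[of 0] by simp
    have ak: "(cmod (a k))\<^sup>2 \<le> c0 * L ^ k * X" for k
    proof (rule LIMSEQ_le_const)
      show "(\<lambda>N. c0 * L ^ k * Re (gram (fourier \<nu>) 0 a N)) \<longlonglongrightarrow> c0 * L ^ k * X"
        unfolding X_def by (intro tendsto_intros gram_tendsto poly_growth_fourier a)
      show "\<exists>N. \<forall>n\<ge>N. (cmod (a k))\<^sup>2 \<le> c0 * L ^ k * Re (gram (fourier \<nu>) 0 a n)"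
        using coefficient_bound[OF pos c0 h, of k] unfolding L_def by (auto intro!: exI[of _ "Suc k"])
    qed
    define d where "d = (\<lambda>k. if k < q then real q ^ q * (c0 * L ^ k) * X else 0)"
    have d0: "0 \<le> d k" for k using L0 c0 X0 by (simp add: d_def)
    have entry: "(1 + real k) ^ q * (cmod (a k))\<^sup>2 \<le> d k + (2 * real q) ^ q * (real (k choose q) * (cmod (a k))\<^sup>2)" for k
    proof (cases "k < q")
      case True
      then have "(1 + real k) ^ q * (cmod (a k))\<^sup>2 \<le> real q ^ q * (c0 * L ^ k * X)"
        by (intro mult_mono power_mono ak) auto
      then show ?thesis using True by (simp add: d_def binomial_eq_0 mult_ac)
    next
      case False
      then have "(1 + real k) ^ q * (cmod (a k))\<^sup>2 \<le> ((2 * real q) ^ q * real (k choose q)) * (cmod (a k))\<^sup>2"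
        using q by (intro mult_right_mono power_le_binomial) auto
      then show ?thesis using False by (simp add: d_def mult.assoc)
    qed
    have "(\<Sum>k<N. (1 + real k) ^ q * (cmod (a k))\<^sup>2)
       \<le> (\<Sum>k<N. d k) + (2 * real q) ^ q * (\<Sum>k<N. real (k choose q) * (cmod (a k))\<^sup>2)"
      using sum_mono[of "{..<N}", OF entry] by (simp add: sum.distrib sum_distrib_left)
    also have "(\<Sum>k<N. d k) \<le> K1 * X"
    proof -
      have "(\<Sum>k<N. d k) \<le> (\<Sum>k<max N q. d k)" by (intro sum_mono2) (auto simp: d0)
      also have "\<dots> = (\<Sum>k<q. d k)" by (intro sum.mono_neutral_right) (auto simp: d_def)
      also have "\<dots> = K1 * X" by (simp add: d_def K1_def sum_distrib_right)
      finally show ?thesis .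
    qed
    also have "(2 * real q) ^ q * (\<Sum>k<N. real (k choose q) * (cmod (a k))\<^sup>2) \<le> K2 * Y"
    proof -
      have "(2 * real q) ^ q * (\<Sum>k<N. real (k choose q) * (cmod (a k))\<^sup>2)
         = K2 * (c * (\<Sum>k<N. real (k choose q) * (cmod (a k))\<^sup>2))" using c by (simp add: K2_def)
      also have "\<dots> \<le> K2 * Y" by (intro mult_left_mono Ylow K)
      finally show ?thesis .
    qed
    also have "K1 * X + K2 * Y \<le> (K1 + K2) * (X + Y)"
      using K X0 Y0 by (simp add: algebra_simps)
    finally show ?thesis by (simp add: X_def Y_def)
  qed
  then show ?thesis using K by (intro exI[of _ "K1 + K2"]) auto
qed

lemma dirichlet_form_bound:
  fixes s c :: real
  assumes w: "poly_growth w" and s0: "0 \<le> s"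
    and bd: "\<And>j. cmod (w j) \<le> c * (1 + \<bar>real_of_int j\<bar>) powr s"
    and s: "2 * s + 2 \<le> real q" "real n + s + 1 \<le> real q"
    and a: "rapidly_decreasing a"
    and W: "\<And>N. (\<Sum>k<N. (1 + real k) ^ q * (cmod (a k))\<^sup>2) \<le> W"
  shows "cmod (dirichlet_form w n a) \<le> 4 * c * W"
proof (rule LIMSEQ_le_const2)
  show "(\<lambda>N. cmod (gram w n a N)) \<longlonglongrightarrow> cmod (dirichlet_form w n a)"
    by (intro tendsto_intros gram_tendsto w a)
  have c: "0 \<le> c" using order_trans[OF norm_ge_zero bd[of 0]] by simp
  have "cmod (gram w n a N) \<le> 4 * c * W" for N
    by (rule order_trans[OF gram_bound[OF bd s0 s]], rule mult_left_mono) (use W c in auto)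
  then show "\<exists>N. \<forall>n'\<ge>N. cmod (gram w n a n') \<le> 4 * c * W" by blast
qed

section \<open>Allowability\<close>

lemma norm_sq_eq_forms:
  assumes m: "m = Suc q" and g: "has_taylor g b"
  shows "norm_sq m (\<lambda>n. single_entry (C *\<^sub>R \<nu>) 0 n + \<mu> n + single_entry (C *\<^sub>R \<mu> q) q n) g
     = of_real C * dirichlet_form (fourier \<nu>) 0 b + (\<Sum>n<q. dirichlet_form (fourier (\<mu> n)) n b)
       + of_real (1 + C) * dirichlet_form (fourier (\<mu> q)) q b"
proof -
  have b: "rapidly_decreasing b" using g by (simp add: has_taylor_def)
  let ?\<tau> = "\<lambda>n. single_entry (C *\<^sub>R \<nu>) 0 n + \<mu> n + single_entry (C *\<^sub>R \<mu> q) q n"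
  define x where "x = (\<lambda>n::nat. complex_of_real (if n = 0 then C else 0))"
  define y where "y = (\<lambda>n::nat. complex_of_real (if n = q then 1 + C else 1))"
  have "fourier (?\<tau> n) = (\<lambda>k. x n * fourier \<nu> k + y n * fourier (\<mu> n) k)" for n
    by (auto simp: fun_eq_iff single_entry_def fourier_arith x_def y_def algebra_simps)
  then have "dirichlet (?\<tau> n) n g = x n * dirichlet_form (fourier \<nu>) n b + y n * dirichlet_form (fourier (\<mu> n)) n b" for n
    unfolding dirichlet_eq_form[OF g]
    by (simp add: dirichlet_form_lincomb[OF poly_growth_fourier poly_growth_fourier b])
  then have "norm_sq m ?\<tau> g = (\<Sum>n<Suc q. x n * dirichlet_form (fourier \<nu>) n b)
      + (\<Sum>n<Suc q. y n * dirichlet_form (fourier (\<mu> n)) n b)"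
    unfolding norm_sq_def m by (simp add: sum.distrib)
  also have "(\<Sum>n<Suc q. x n * dirichlet_form (fourier \<nu>) n b) = of_real C * dirichlet_form (fourier \<nu>) 0 b"
    unfolding sum.lessThan_Suc_shift by (simp add: x_def)
  also have "(\<Sum>n<Suc q. y n * dirichlet_form (fourier (\<mu> n)) n b)
     = (\<Sum>n<q. dirichlet_form (fourier (\<mu> n)) n b) + of_real (1 + C) * dirichlet_form (fourier (\<mu> q)) q b"
    by (simp add: y_def)
  finally show ?thesis by (simp only: add.assoc)
qed

text \<open>
With \<open>X\<close> and \<open>Y\<close> the forms of \<open>\<nu>\<close> and of the top entry, every other term is at most a multiple of
\<open>X + Y\<close> and is absorbed by \<open>C * (X + Y)\<close> for large \<open>C\<close>. The growth of \<open>Y\<close> under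
\<open>M_z\<close> is at most a multiple of \<open>X + Y\<close> as well.
\<close>

lemma allowable_of_form_bounds:
  assumes m: "m = Suc (Suc p)"
    and real: "\<forall>n<m. real_distr (\<mu> n)"
    and pos: "positive_distr \<nu>"
    and top: "\<And>a. rapidly_decreasing a \<Longrightarrow> 0 \<le> Re (dirichlet_form (fourier (\<mu> (Suc p))) (Suc p) a)"
    and B: "\<And>n. n \<le> p \<Longrightarrow> \<exists>B\<ge>0. \<forall>a. rapidly_decreasing a \<longrightarrow> cmod (dirichlet_form (fourier (\<mu> n)) n a)
      \<le> B * (Re (dirichlet_form (fourier \<nu>) 0 a) + Re (dirichlet_form (fourier (\<mu> (Suc p))) (Suc p) a))"
    and Bz: "\<exists>B\<ge>0. \<forall>a. rapidly_decreasing a \<longrightarrow> cmod (dirichlet_form (fourier (\<mu> (Suc p))) p a)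
      \<le> B * (Re (dirichlet_form (fourier \<nu>) 0 a) + Re (dirichlet_form (fourier (\<mu> (Suc p))) (Suc p) a))"
  shows "\<exists>C0>0. \<forall>C\<ge>C0. allowable m
    (\<lambda>n. single_entry (C *\<^sub>R \<nu>) 0 n + \<mu> n + single_entry (C *\<^sub>R \<mu> (Suc p)) (Suc p) n)"
proof -
  let ?q = "Suc p"
  define X where "X = (\<lambda>a. Re (dirichlet_form (fourier \<nu>) 0 a))"
  define Y where "Y = (\<lambda>a. Re (dirichlet_form (fourier (\<mu> ?q)) ?q a))"
  define T where "T = (\<lambda>a. Re (\<Sum>n<?q. dirichlet_form (fourier (\<mu> n)) n a))"
  have "\<forall>n. \<exists>B. n \<le> p \<longrightarrow> (B \<ge> 0 \<and> (\<forall>a. rapidly_decreasing a \<longrightarrow> cmod (dirichlet_form (fourier (\<mu> n)) n a) \<le> B * (X a + Y a)))"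
    using B unfolding X_def Y_def by blast
  then obtain b where b: "\<And>n. n \<le> p \<Longrightarrow> b n \<ge> 0"
    "\<And>n a. n \<le> p \<Longrightarrow> rapidly_decreasing a \<Longrightarrow> cmod (dirichlet_form (fourier (\<mu> n)) n a) \<le> b n * (X a + Y a)"
    by metis
  obtain z where z: "z \<ge> 0"
    "\<And>a. rapidly_decreasing a \<Longrightarrow> cmod (dirichlet_form (fourier (\<mu> ?q)) p a) \<le> z * (X a + Y a)"
    using Bz unfolding X_def Y_def by blast
  define S where "S = (\<Sum>n<?q. b n)"
  have S0: "S \<ge> 0" unfolding S_def using b(1) by (intro sum_nonneg) auto
  have XY0: "0 \<le> X a" "0 \<le> Y a" if "rapidly_decreasing a" for a
    using positive_distr_form_nonneg[OF pos that] top[OF that] by (auto simp: X_def Y_def)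
  have T: "\<bar>T a\<bar> \<le> S * (X a + Y a)" if "rapidly_decreasing a" for a
  proof -
    have "\<bar>T a\<bar> \<le> cmod (\<Sum>n<?q. dirichlet_form (fourier (\<mu> n)) n a)" unfolding T_def by (rule abs_Re_le_cmod)
    also have "\<dots> \<le> (\<Sum>n<?q. b n * (X a + Y a))" by (intro sum_norm_le b(2) that) auto
    finally show ?thesis by (simp only: S_def sum_distrib_right)
  qed
  have im: "Im (dirichlet_form (fourier (\<mu> n)) n a) = 0" if "n < m" "rapidly_decreasing a" for n a
    using real that(1) by (intro dirichlet_form_real real_distr_fourier poly_growth_fourier that(2)) auto
  show ?thesis
  \<comment> \<open>for \<open>C \<ge> S + 1\<close> the squared norm lies between \<open>X + Y\<close> and \<open>(C + 1 + S) (X + Y)\<close>\<close>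
  proof (intro exI[of _ "S + 1"] conjI allI impI)
    show "S + 1 > 0" using S0 by simp
    fix C assume C: "S + 1 \<le> C"
    let ?\<tau> = "\<lambda>n. single_entry (C *\<^sub>R \<nu>) 0 n + \<mu> n + single_entry (C *\<^sub>R \<mu> ?q) ?q n"
    define Q where "Q = (\<lambda>a. C * X a + T a + (1 + C) * Y a)"
    have ns: "norm_sq m ?\<tau> g = of_real (Q a)" if g: "has_taylor g a" for g a
    proof -
      have a: "rapidly_decreasing a" using g by (simp add: has_taylor_def)
      have 1: "dirichlet_form (fourier \<nu>) 0 a = of_real (X a)"
        using positive_distr_form_nonneg[OF pos a] by (simp add: X_def complex_eq_iff)
      have 2: "dirichlet_form (fourier (\<mu> ?q)) ?q a = of_real (Y a)"
        using im[of ?q, OF _ a] m by (simp add: Y_def complex_eq_iff)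
      have "Im (\<Sum>n<?q. dirichlet_form (fourier (\<mu> n)) n a) = 0"
        unfolding Im_sum using m by (intro sum.neutral ballI im a) auto
      then have 3: "(\<Sum>n<?q. dirichlet_form (fourier (\<mu> n)) n a) = of_real (T a)"
        by (simp only: T_def complex_eq_iff Re_complex_of_real Im_complex_of_real)
      show ?thesis
        unfolding norm_sq_eq_forms[OF m g] 1 2 3 Q_def by simp
    qed
    have low: "X a + Y a \<le> Q a" and upp: "Q a \<le> (C + 1 + S) * (X a + Y a)" if a: "rapidly_decreasing a" for a
    proof -
      have t: "- (S * (X a + Y a)) \<le> T a" "T a \<le> S * (X a + Y a)" using T[OF a] by linarith+
      have "(S + 1) * (X a + Y a) \<le> C * (X a + Y a)"
        using C XY0[OF a] by (intro mult_right_mono) auto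
      then show "X a + Y a \<le> Q a" using t XY0[OF a] by (simp add: Q_def algebra_simps)
      show "Q a \<le> (C + 1 + S) * (X a + Y a)" using t XY0[OF a] by (simp add: Q_def algebra_simps)
    qed
    define K where "K = (C + 1 + S) * (1 + z)"
    have K: "K > 0" using C S0 z by (simp add: K_def)
    show "allowable m ?\<tau>"
      unfolding allowable_def
    proof (intro exI[of _ "sqrt K"] conjI ballI)
      show "sqrt K > 0" using K by simp
      fix f assume f: "f \<in> D_a"
      define a where "a = taylor_coeff f"
      have fa: "has_taylor f a" unfolding a_def by (rule D_a_has_taylor[OF f])
      have a: "rapidly_decreasing a" using fa by (simp add: has_taylor_def)
      define a' where "a' = case_nat 0 a"
      have a': "rapidly_decreasing a'" unfolding a'_def by (rule rapidly_decreasing_case_nat[OF a])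
      have Mf: "has_taylor (M_z f) a'" unfolding a'_def by (rule has_taylor_M_z[OF fa])
      have X': "X a' = X a"
        by (simp add: X_def a'_def dirichlet_form_case_nat(1)[OF poly_growth_fourier a])
      have "Y a' = Y a + Re (dirichlet_form (fourier (\<mu> ?q)) p a)"
        by (simp add: Y_def a'_def dirichlet_form_case_nat(2)[OF poly_growth_fourier a])
      also have "Re (dirichlet_form (fourier (\<mu> ?q)) p a) \<le> z * (X a + Y a)"
        using z(2)[OF a] complex_Re_le_cmod order_trans by blast
      finally have XY': "X a' + Y a' \<le> (1 + z) * (X a + Y a)"
        by (simp add: X' algebra_simps)
      have Q0: "0 \<le> Q a'" using low[OF a'] XY0[OF a'] by linarith
      have "Q a' \<le> (C + 1 + S) * (X a' + Y a')" by (rule upp[OF a'])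
      also have "\<dots> \<le> (C + 1 + S) * ((1 + z) * (X a + Y a))"
        using C S0 by (intro mult_left_mono XY') auto
      also have "\<dots> = K * (X a + Y a)" by (simp add: K_def)
      also have "\<dots> \<le> K * Q a" using K by (intro mult_left_mono low[OF a]) auto
      finally have QK: "Q a' \<le> K * Q a" .
      show "0 \<le> norm_sq m ?\<tau> (M_z f)"
        unfolding ns[OF Mf] using Q0 by (simp add: less_eq_complex_def)
      show "norm_sq m ?\<tau> (M_z f) \<le> of_real ((sqrt K)\<^sup>2) * norm_sq m ?\<tau> f"
        unfolding ns[OF Mf] ns[OF fa] using QK K by (simp add: less_eq_complex_def)
    qed
  qed
qed

theorem theorem6p5:
  fixes m :: nat and \<mu> :: "nat \<Rightarrow> distr" and \<nu> :: distr
  assumes m: "m \<ge> 3"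
    and real: "\<forall>n<m. real_distr (\<mu> n)"
    and i: "positive_distr \<nu>"
      "\<exists>c0::real. c0 > 0 \<and>
         (\<forall>f\<in>D_a. of_real ((cmod (taylor_coeff f 0))\<^sup>2) \<le> of_real c0 * dirichlet \<nu> 0 f)"
    and ii: "\<forall>n. real n \<le> (real m - 3) / 2 \<longrightarrow>
      (\<exists>c>0. \<forall>k::int. cmod (fourier (\<mu> n) k) \<le> c * (1 + \<bar>real_of_int k\<bar>) powr ((real m - 3) / 2))"
    and iii: "even m \<longrightarrow>
      (\<exists>\<kappa>::nat \<Rightarrow> distr. (\<forall>j\<le>(m - 4) div 2. finite_measure_distr (\<kappa> j)) \<and>
         \<mu> ((m - 2) div 2) = (\<Sum>j\<le>(m - 4) div 2. (D_op ^^ j) (\<kappa> j)))"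
    and iv: "\<forall>n. (real m - 1) / 2 \<le> real n \<and> n \<le> m - 2 \<longrightarrow>
      (\<exists>\<kappa>::nat \<Rightarrow> distr. (\<forall>j\<le>m - 2 - n. finite_measure_distr (\<kappa> j)) \<and>
         \<mu> n = (\<Sum>j\<le>m - 2 - n. (D_op ^^ j) (\<kappa> j)))"
    and v: "\<exists>c::real. c > 0 \<and> (\<forall>z\<in>ball 0 1. of_real c \<le> poisson (\<mu> (m - 1)) z)"
  shows "\<exists>C0>0. \<forall>C\<ge>C0. allowable m
    (\<lambda>n. single_entry (C *\<^sub>R \<nu>) 0 n + \<mu> n + single_entry (C *\<^sub>R \<mu> (m - 1)) (m - 1) n)"
proof -
  define p where "p = m - 2"
  have mp: "m = Suc (Suc p)" and p1: "p \<ge> 1" using m by (auto simp: p_def)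
  have q: "m - 1 = Suc p" using mp by simp
  let ?u = "fourier (\<mu> (Suc p))"
  obtain c0 where c0: "c0 > 0"
    "\<forall>f\<in>D_a. of_real ((cmod (taylor_coeff f 0))\<^sup>2) \<le> of_real c0 * dirichlet \<nu> 0 f" using i(2) by blast
  obtain c where c: "c > 0" and low: "\<And>z. z \<in> ball 0 1 \<Longrightarrow> of_real c \<le> poisson_series ?u z"
    using v unfolding q poisson_eq_series by blast
  obtain K where K: "K \<ge> 0" "\<And>a N. rapidly_decreasing a \<Longrightarrow> (\<Sum>k<N. (1 + real k) ^ Suc p * (cmod (a k))\<^sup>2)
     \<le> K * (Re (dirichlet_form (fourier \<nu>) 0 a) + Re (dirichlet_form ?u (Suc p) a))"
    using weighted_sum_bound[OF i(1) c0 poly_growth_fourier _ c low, of "Suc p"] by auto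
  have form_bound: "\<exists>B\<ge>0. \<forall>a. rapidly_decreasing a \<longrightarrow> cmod (dirichlet_form (fourier \<rho>) n a)
      \<le> B * (Re (dirichlet_form (fourier \<nu>) 0 a) + Re (dirichlet_form ?u (Suc p) a))"
    if w: "\<exists>d. \<forall>k. cmod (fourier \<rho> k) \<le> d * (1 + \<bar>real_of_int k\<bar>) powr s"
      and s: "0 \<le> s" "2 * s + 2 \<le> real (Suc p)" "real n + s + 1 \<le> real (Suc p)" for \<rho> n s
  proof -
    obtain d where d: "\<And>k. cmod (fourier \<rho> k) \<le> d * (1 + \<bar>real_of_int k\<bar>) powr s" using w by blast
    have d0: "0 \<le> d" using order_trans[OF norm_ge_zero d[of 0]] by simp
    have "cmod (dirichlet_form (fourier \<rho>) n a)
       \<le> (4 * d * K) * (Re (dirichlet_form (fourier \<nu>) 0 a) + Re (dirichlet_form ?u (Suc p) a))"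
      if a: "rapidly_decreasing a" for a
      using dirichlet_form_bound[OF poly_growth_fourier s(1) d s(2,3) a K(2)[OF a]] by (simp add: mult.assoc)
    then show ?thesis using d0 K(1) by (intro exI[of _ "4 * d * K"]) auto
  qed
  have order: "\<exists>s\<ge>0. 2 * s + 2 \<le> real (Suc p) \<and> real n + s + 1 \<le> real (Suc p) \<and>
      (\<exists>d. \<forall>k. cmod (fourier (\<mu> n) k) \<le> d * (1 + \<bar>real_of_int k\<bar>) powr s)" if n: "n \<le> p" for n
  proof -
    \<comment> \<open>these are the ranges of (ii), (iii) and (iv), as \<open>p = m - 2\<close>; each fixes the order \<open>s\<close>\<close>
    consider "2 * n + 1 \<le> p" | "2 * n = p" | "p + 1 \<le> 2 * n" by linarith
    then show ?thesis
    proof cases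
      case 1
      then have "real n \<le> (real m - 3) / 2" by (simp add: mp)
      then obtain d where "\<forall>k. cmod (fourier (\<mu> n) k) \<le> d * (1 + \<bar>real_of_int k\<bar>) powr ((real m - 3) / 2)"
        using ii by blast
      then show ?thesis using p1 1 by (intro exI[of _ "(real m - 3) / 2"]) (auto simp: mp field_simps)
    next
      case 2
      then have "even m" "(m - 2) div 2 = n" "(m - 4) div 2 = n - 1" "n \<ge> 1" using p1 by (auto simp: mp)
      then obtain \<kappa> where "\<forall>j\<le>n - 1. finite_measure_distr (\<kappa> j)" "\<mu> n = (\<Sum>j\<le>n - 1. (D_op ^^ j) (\<kappa> j))"
        using iii by metis
      then show ?thesis
        using sum_D_op_fourier_bound[of "n - 1" \<kappa>] 2 \<open>n \<ge> 1\<close>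
        by (intro exI[of _ "real (n - 1)"]) (auto simp: of_nat_diff)
    next
      case 3
      then have "(real m - 1) / 2 \<le> real n \<and> n \<le> m - 2" "m - 2 - n = p - n" using n by (auto simp: mp)
      then obtain \<kappa> where "\<forall>j\<le>p - n. finite_measure_distr (\<kappa> j)" "\<mu> n = (\<Sum>j\<le>p - n. (D_op ^^ j) (\<kappa> j))"
        using iv by metis
      then show ?thesis
        using sum_D_op_fourier_bound[of "p - n" \<kappa>] 3 n
        by (intro exI[of _ "real (p - n)"]) (auto simp: of_nat_diff)
    qed
  qed
  have herm: "?u (- k) = cnj (?u k)" for k
    using real by (intro real_distr_fourier) (simp add: mp)
  have bounded: "cmod (?u k) \<le> (2 * cmod (?u 0)) * (1 + \<bar>real_of_int k\<bar>) powr 0" for k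
  proof -
    have "0 \<le> poisson_series ?u z" if "z \<in> ball 0 1" for z
      using low[OF that] c by (auto simp: less_eq_complex_def)
    then have "cmod (?u k) \<le> 2 * cmod (?u 0)"
      by (rule poisson_nonneg_imp_coeff_bounded[OF poly_growth_fourier herm])
    then show ?thesis by simp
  qed
  show ?thesis
    unfolding q
  proof (rule allowable_of_form_bounds[OF mp real i(1)])
    show "0 \<le> Re (dirichlet_form ?u (Suc p) a)" if "rapidly_decreasing a" for a
      using dirichlet_form_lower_bound[OF _ poly_growth_fourier that less_imp_le[OF c] low, of "Suc p" 0] by simp
    show "\<exists>B\<ge>0. \<forall>a. rapidly_decreasing a \<longrightarrow> cmod (dirichlet_form (fourier (\<mu> n)) n a)
      \<le> B * (Re (dirichlet_form (fourier \<nu>) 0 a) + Re (dirichlet_form ?u (Suc p) a))" if "n \<le> p" for n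
      using order[OF that] form_bound by blast
    show "\<exists>B\<ge>0. \<forall>a. rapidly_decreasing a \<longrightarrow> cmod (dirichlet_form ?u p a)
      \<le> B * (Re (dirichlet_form (fourier \<nu>) 0 a) + Re (dirichlet_form ?u (Suc p) a))"
    proof (rule form_bound)
      show "\<exists>d. \<forall>k. cmod (?u k) \<le> d * (1 + \<bar>real_of_int k\<bar>) powr 0" using bounded by blast
    qed (use p1 in auto)
  qed
qed

end
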